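(* Let $G$ be a semi étale groupoid. Assume that the isotropy bundle $\mathrm{Is}\,G$ is abelian and discrete. Then $D'_G$ is a Cartan subalgebra of $C^*_r(G)$.
   Context: $G$ denotes a locally compact Hausdorff topological groupoid with unit space $G^0$, range map $r$ and source map $s$. A bisection is an open set $U\subseteq G$ on which both $r$ and $s$ are injective; $G$ is semi étale if its topology has a base consisting of bisections (equivalently, $r$ is locally injective). Let $B_c(G)$ be the $*$-algebra of bounded compactly supported (not necessarily continuous) functions $f:G\to\mathbb C$ with product $(f\star g)(\gamma)=\sum_{\gamma_1\gamma_2=\gamma}f(\gamma_1)g(\gamma_2)$ and involution $f^*(\gamma)=\overline{f(\gamma^{-1})}$. For $x\in G^0$ let $\pi_x$ be the $*$-representation of $B_c(G)$ on $l^2(s^{-1}(x))$ given by $(\pi_x(f)\psi)(\gamma)=\sum_{\gamma_1\gamma_2=\gamma}f(\gamma_1)\psi(\gamma_2)$. $B^*_r(G)$ is the completion of $B_c(G)$ in the norm $\|f\|=\sup_{x\in G^0}\|\pi_x(f)\|$, and $C^*_r(G)$ is the $C^*$-subalgebra of $B^*_r(G)$ generated by the space $C_c(G)\subseteq B_c(G)$ of continuous compactly supported functions. The inclusion of $B_c(G)$ into the Banach space $B_0(G)$ of bounded functions on $G$ vanishing at infinity (supremum norm) extends to an injective norm-decreasing linear map $j:B^*_r(G)\to B_0(G)$. The isotropy bundle is $\mathrm{Is}\,G=\{\gamma\in G:r(\gamma)=s(\gamma)\}$. It is abelian if $\gamma_1\gamma_2=\gamma_2\gamma_1$ for all composable $\gamma_1,\gamma_2\in\mathrm{Is}\,G$,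 and it is called discrete if $\mathrm{Is}\,G\setminus G^0$ is discrete in the topology inherited from $G$. Put $D'_G=\{a\in C^*_r(G):\ \mathrm{supp}\, j(a)\subseteq \mathrm{Is}\,G\}$, a $C^*$-subalgebra of $C^*_r(G)$. For an abelian $C^*$-subalgebra $D$ of a $C^*$-algebra $A$, let $N(D)=\{a\in A: a^*Da\subseteq D,\ aDa^*\subseteq D\}$. $D$ is a Cartan subalgebra of $A$ (in the sense of Renault) if (i) $D$ contains an approximate unit of $A$; (ii) $D$ is maximal abelian; (iii) $D$ is regular, i.e. $A$ is generated as a $C^*$-algebra by $N(D)$; (iv) there is a faithful conditional expectation of $A$ onto $D$. *)

theory Defs
  imports "HOL-Analysis.Analysis"
begin

section \<open>Semi etale groupoids\<close>

text \<open>
  The groupoid is the whole type \<open>'g\<close>, with the unit space embedded in it.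
  \<open>gmul G \<gamma>\<^sub>1 \<gamma>\<^sub>2\<close> is meaningful only when \<open>src G \<gamma>\<^sub>1 = rng G \<gamma>\<^sub>2\<close>.
\<close>

record 'g groupoid =
  rng :: "'g \<Rightarrow> 'g"
  src :: "'g \<Rightarrow> 'g"
  gmul :: "'g \<Rightarrow> 'g \<Rightarrow> 'g"
  ginv :: "'g \<Rightarrow> 'g"

definition units :: "'g groupoid \<Rightarrow> 'g set" where
  "units G = range (src G)"

locale groupoid =
  fixes G :: "'g groupoid"
  assumes rng_rng: "rng G (rng G a) = rng G a"
    and src_rng: "src G (rng G a) = rng G a"
    and rng_src: "rng G (src G a) = src G a"
    and src_src: "src G (src G a) = src G a"
    and rng_gmul: "src G a = rng G b \<Longrightarrow> rng G (gmul G a b) = rng G a"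
    and src_gmul: "src G a = rng G b \<Longrightarrow> src G (gmul G a b) = src G b"
    and gmul_assoc: "src G a = rng G b \<Longrightarrow> src G b = rng G c \<Longrightarrow>
          gmul G (gmul G a b) c = gmul G a (gmul G b c)"
    and gmul_rng: "gmul G (rng G a) a = a"
    and gmul_src: "gmul G a (src G a) = a"
    and rng_ginv: "rng G (ginv G a) = src G a"
    and src_ginv: "src G (ginv G a) = rng G a"
    and gmul_ginv: "gmul G a (ginv G a) = rng G a"
    and ginv_gmul: "gmul G (ginv G a) a = src G a"

text \<open>
  Continuity of the range and source maps follows from the two continuity axioms, because
  \<open>rng G a = gmul G a (ginv G a)\<close> and \<open>src G a = gmul G (ginv G a) a\<close>.
\<close>

locale lch_groupoid = groupoid G for G :: "'g::t2_space groupoid" +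
  assumes locally_compact: "locally_compact_space (euclidean :: 'g topology)"
    and continuous_ginv: "continuous_on UNIV (ginv G)"
    and continuous_gmul: "continuous_on {(a, b). src G a = rng G b} (\<lambda>(a, b). gmul G a b)"

definition bisection :: "'g::topological_space groupoid \<Rightarrow> 'g set \<Rightarrow> bool" where
  "bisection G U \<longleftrightarrow> open U \<and> inj_on (rng G) U \<and> inj_on (src G) U"

locale semi_etale_groupoid = lch_groupoid G for G :: "'g::t2_space groupoid" +
  assumes basis_bisections: "topological_basis {U. bisection G U}"

definition isotropy :: "'g groupoid \<Rightarrow> 'g set" where
  "isotropy G = {a. rng G a = src G a}"

definition abelian_isotropy :: "'g groupoid \<Rightarrow> bool" where
  "abelian_isotropy G \<longleftrightarrow>
    (\<forall>a\<in>isotropy G. \<forall>b\<in>isotropy G. src G a = rng G b \<longrightarrow> gmul G a b = gmul G b a)"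

definition discrete_isotropy :: "'g::topological_space groupoid \<Rightarrow> bool" where
  "discrete_isotropy G \<longleftrightarrow> discrete (isotropy G - units G)"


section \<open>Normed star-algebras and their completions\<close>

record 'a star_algebra =
  acarrier :: "'a set"
  azero :: 'a
  aplus :: "'a \<Rightarrow> 'a \<Rightarrow> 'a"
  ascale :: "complex \<Rightarrow> 'a \<Rightarrow> 'a"
  atimes :: "'a \<Rightarrow> 'a \<Rightarrow> 'a"
  astar :: "'a \<Rightarrow> 'a"
  anorm :: "'a \<Rightarrow> real"

definition adist :: "'a star_algebra \<Rightarrow> 'a \<Rightarrow> 'a \<Rightarrow> real" where
  "adist A a b = anorm A (aplus A a (ascale A (-1) b))"

definition cauchy_seq :: "'a star_algebra \<Rightarrow> (nat \<Rightarrow> 'a) \<Rightarrow> bool" where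
  "cauchy_seq A X \<longleftrightarrow> (\<forall>n. X n \<in> acarrier A) \<and>
    (\<forall>e>0. \<exists>N. \<forall>m\<ge>N. \<forall>n\<ge>N. adist A (X m) (X n) < e)"

definition cauchy_rel :: "'a star_algebra \<Rightarrow> ((nat \<Rightarrow> 'a) \<times> (nat \<Rightarrow> 'a)) set" where
  "cauchy_rel A = {(X, Y). cauchy_seq A X \<and> cauchy_seq A Y \<and>
     (\<lambda>n. adist A (X n) (Y n)) \<longlonglongrightarrow> 0}"

definition cauchy_class :: "'a star_algebra \<Rightarrow> (nat \<Rightarrow> 'a) \<Rightarrow> (nat \<Rightarrow> 'a) set" where
  "cauchy_class A X = cauchy_rel A `` {X}"

definition rep :: "(nat \<Rightarrow> 'a) set \<Rightarrow> nat \<Rightarrow> 'a" where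
  "rep c = (SOME X. X \<in> c)"

definition completion :: "'a star_algebra \<Rightarrow> (nat \<Rightarrow> 'a) set star_algebra" where
  "completion A = \<lparr>
     acarrier = {X. cauchy_seq A X} // cauchy_rel A,
     azero = cauchy_class A (\<lambda>n. azero A),
     aplus = (\<lambda>c d. cauchy_class A (\<lambda>n. aplus A (rep c n) (rep d n))),
     ascale = (\<lambda>z c. cauchy_class A (\<lambda>n. ascale A z (rep c n))),
     atimes = (\<lambda>c d. cauchy_class A (\<lambda>n. atimes A (rep c n) (rep d n))),
     astar = (\<lambda>c. cauchy_class A (\<lambda>n. astar A (rep c n))),
     anorm = (\<lambda>c. lim (\<lambda>n. anorm A (rep c n)))\<rparr>"

definition to_completion :: "'a star_algebra \<Rightarrow> 'a \<Rightarrow> (nat \<Rightarrow> 'a) set" where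
  "to_completion A a = cauchy_class A (\<lambda>n. a)"


section \<open>Cartan subalgebras\<close>

text \<open>
  Throughout this section the ambient structure \<open>A\<close> is understood to be a C*-algebra;
  in particular sequential closure and closure in \<open>A\<close> agree.
\<close>

definition cstar_subalgebra :: "'a star_algebra \<Rightarrow> 'a set \<Rightarrow> bool" where
  "cstar_subalgebra A B \<longleftrightarrow>
     B \<subseteq> acarrier A \<and> azero A \<in> B \<and>
     (\<forall>a\<in>B. \<forall>b\<in>B. aplus A a b \<in> B) \<and>
     (\<forall>z. \<forall>a\<in>B. ascale A z a \<in> B) \<and>
     (\<forall>a\<in>B. \<forall>b\<in>B. atimes A a b \<in> B) \<and>
     (\<forall>a\<in>B. astar A a \<in> B) \<and>
     (\<forall>X. \<forall>a\<in>acarrier A. (\<forall>n. X n \<in> B) \<and> (\<lambda>n. adist A (X n) a) \<longlonglongrightarrow> 0 \<longrightarrow> a \<in> B)"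

definition cstar_generated :: "'a star_algebra \<Rightarrow> 'a set \<Rightarrow> 'a set" where
  "cstar_generated A S = \<Inter>{B. cstar_subalgebra A B \<and> S \<subseteq> B}"

definition abelian :: "'a star_algebra \<Rightarrow> 'a set \<Rightarrow> bool" where
  "abelian A B \<longleftrightarrow> (\<forall>a\<in>B. \<forall>b\<in>B. atimes A a b = atimes A b a)"

definition positive :: "'a star_algebra \<Rightarrow> 'a \<Rightarrow> bool" where
  "positive A a \<longleftrightarrow> (\<exists>b\<in>acarrier A. a = atimes A (astar A b) b)"

text \<open>
  An approximate unit is a net of positive elements of norm at most 1 converging strictly to
  the identity. Nets are rendered as filters: a net in \<open>D\<close> gives the filter generated by its
  tails, and every proper filter containing \<open>D\<close> arises in this way.
\<close>

definition contains_approximate_unit :: "'a star_algebra \<Rightarrow> 'a set \<Rightarrow> bool" where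
  "contains_approximate_unit A D \<longleftrightarrow>
     (\<exists>F :: 'a filter. F \<noteq> bot \<and>
        (\<forall>\<^sub>F e in F. e \<in> D \<and> positive A e \<and> anorm A e \<le> 1) \<and>
        (\<forall>a\<in>acarrier A.
           ((\<lambda>e. adist A (atimes A e a) a) \<longlongrightarrow> 0) F \<and>
           ((\<lambda>e. adist A (atimes A a e) a) \<longlongrightarrow> 0) F))"

definition maximal_abelian :: "'a star_algebra \<Rightarrow> 'a set \<Rightarrow> bool" where
  "maximal_abelian A D \<longleftrightarrow>
     cstar_subalgebra A D \<and> abelian A D \<and>
     (\<forall>E. cstar_subalgebra A E \<and> abelian A E \<and> D \<subseteq> E \<longrightarrow> E = D)"

definition normalizers :: "'a star_algebra \<Rightarrow> 'a set \<Rightarrow> 'a set" where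
  "normalizers A D = {a \<in> acarrier A.
     (\<forall>d\<in>D. atimes A (atimes A (astar A a) d) a \<in> D) \<and>
     (\<forall>d\<in>D. atimes A (atimes A a d) (astar A a) \<in> D)}"

definition regular :: "'a star_algebra \<Rightarrow> 'a set \<Rightarrow> bool" where
  "regular A D \<longleftrightarrow> cstar_generated A (normalizers A D) = acarrier A"

text \<open>Complete positivity is automatic here, since \<open>D\<close> is commutative.\<close>

definition conditional_expectation :: "'a star_algebra \<Rightarrow> 'a set \<Rightarrow> ('a \<Rightarrow> 'a) \<Rightarrow> bool" where
  "conditional_expectation A D E \<longleftrightarrow>
     (\<forall>a\<in>acarrier A. E a \<in> D) \<and>
     (\<forall>d\<in>D. E d = d) \<and>
     (\<forall>a\<in>acarrier A. \<forall>b\<in>acarrier A. E (aplus A a b) = aplus A (E a) (E b)) \<and>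
     (\<forall>z. \<forall>a\<in>acarrier A. E (ascale A z a) = ascale A z (E a)) \<and>
     (\<forall>a\<in>acarrier A. anorm A (E a) \<le> anorm A a) \<and>
     (\<forall>a\<in>acarrier A. positive A a \<longrightarrow> positive A (E a)) \<and>
     (\<forall>a\<in>acarrier A. \<forall>d\<in>D. E (atimes A d a) = atimes A d (E a) \<and>
        E (atimes A a d) = atimes A (E a) d)"

definition faithful :: "'a star_algebra \<Rightarrow> ('a \<Rightarrow> 'a) \<Rightarrow> bool" where
  "faithful A E \<longleftrightarrow>
     (\<forall>a\<in>acarrier A. E (atimes A (astar A a) a) = azero A \<longrightarrow> a = azero A)"

text \<open>That \<open>D\<close> is an abelian C*-subalgebra is part of \<^const>\<open>maximal_abelian\<close>.\<close>

definition cartan_subalgebra :: "'a star_algebra \<Rightarrow> 'a set \<Rightarrow> bool" where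
  "cartan_subalgebra A D \<longleftrightarrow>
     contains_approximate_unit A D \<and>
     maximal_abelian A D \<and>
     regular A D \<and>
     (\<exists>E. conditional_expectation A D E \<and> faithful A E)"


section \<open>The algebras of a semi etale groupoid\<close>

definition supp :: "('g::topological_space \<Rightarrow> complex) \<Rightarrow> 'g set" where
  "supp f = closure {a. f a \<noteq> 0}"

definition bounded_compact_support :: "('g::topological_space \<Rightarrow> complex) set" where
  "bounded_compact_support = {f. bounded (range f) \<and> compact (supp f)}"

definition continuous_compact_support :: "('g::topological_space \<Rightarrow> complex) set" where
  "continuous_compact_support = {f. continuous_on UNIV f \<and> compact (supp f)}"

text \<open>
  In a semi etale groupoid a compact set meets each fibre of the range map in a finite set,
  so this is a finite sum whenever \<open>f\<close> is compactly supported.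
\<close>

definition conv :: "'g groupoid \<Rightarrow> ('g \<Rightarrow> complex) \<Rightarrow> ('g \<Rightarrow> complex) \<Rightarrow> 'g \<Rightarrow> complex" where
  "conv G f g c =
     (\<Sum>\<^sub>\<infinity>(a, b)\<in>{(a, b). src G a = rng G b \<and> gmul G a b = c}. f a * g b)"

definition invol :: "'g groupoid \<Rightarrow> ('g \<Rightarrow> complex) \<Rightarrow> 'g \<Rightarrow> complex" where
  "invol G f a = cnj (f (ginv G a))"

text \<open>
  \<open>l2_fibre G x\<close> is the Hilbert space of square-summable functions on the fibre over \<open>x\<close> of the
  source map, extended by zero to the whole groupoid.
\<close>

definition l2_fibre :: "'g groupoid \<Rightarrow> 'g \<Rightarrow> ('g \<Rightarrow> complex) set" where
  "l2_fibre G x = {\<psi>. (\<forall>a. src G a \<noteq> x \<longrightarrow> \<psi> a = 0) \<and>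
     (\<lambda>a. (cmod (\<psi> a))\<^sup>2) summable_on {a. src G a = x}}"

definition l2_norm :: "'g groupoid \<Rightarrow> 'g \<Rightarrow> ('g \<Rightarrow> complex) \<Rightarrow> real" where
  "l2_norm G x \<psi> = sqrt (\<Sum>\<^sub>\<infinity>a\<in>{a. src G a = x}. (cmod (\<psi> a))\<^sup>2)"

definition regular_rep ::
    "'g groupoid \<Rightarrow> 'g \<Rightarrow> ('g \<Rightarrow> complex) \<Rightarrow> ('g \<Rightarrow> complex) \<Rightarrow> 'g \<Rightarrow> complex" where
  "regular_rep G x f \<psi> c = (if src G c = x
     then \<Sum>\<^sub>\<infinity>(a, b)\<in>{(a, b). src G a = rng G b \<and> gmul G a b = c}. f a * \<psi> b
     else 0)"

definition regular_rep_norm :: "'g groupoid \<Rightarrow> 'g \<Rightarrow> ('g \<Rightarrow> complex) \<Rightarrow> real" where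
  "regular_rep_norm G x f =
     (SUP \<psi>\<in>{\<psi> \<in> l2_fibre G x. l2_norm G x \<psi> \<le> 1}. l2_norm G x (regular_rep G x f \<psi>))"

definition reduced_norm :: "'g groupoid \<Rightarrow> ('g \<Rightarrow> complex) \<Rightarrow> real" where
  "reduced_norm G f = (SUP x\<in>units G. regular_rep_norm G x f)"

definition Bc :: "'g::topological_space groupoid \<Rightarrow> ('g \<Rightarrow> complex) star_algebra" where
  "Bc G = \<lparr>
     acarrier = bounded_compact_support,
     azero = (\<lambda>a. 0),
     aplus = (\<lambda>f g a. f a + g a),
     ascale = (\<lambda>z f a. z * f a),
     atimes = conv G,
     astar = invol G,
     anorm = reduced_norm G\<rparr>"

definition Br :: "'g::topological_space groupoid \<Rightarrow> (nat \<Rightarrow> 'g \<Rightarrow> complex) set star_algebra" where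
  "Br G = completion (Bc G)"

definition Cr :: "'g::topological_space groupoid \<Rightarrow> (nat \<Rightarrow> 'g \<Rightarrow> complex) set star_algebra" where
  "Cr G = (Br G)\<lparr>acarrier :=
     cstar_generated (Br G) (to_completion (Bc G) ` continuous_compact_support)\<rparr>"

text \<open>
  The extension by continuity of the inclusion of \<^term>\<open>bounded_compact_support\<close> into the
  bounded functions vanishing at infinity: the supremum norm is dominated by the reduced norm,
  so a Cauchy sequence for the latter converges uniformly, and in particular pointwise.
\<close>

definition jmap :: "(nat \<Rightarrow> 'g \<Rightarrow> complex) set \<Rightarrow> 'g \<Rightarrow> complex" where
  "jmap c a = lim (\<lambda>n. rep c n a)"

definition isotropy_subalgebra ::
    "'g::topological_space groupoid \<Rightarrow> (nat \<Rightarrow> 'g \<Rightarrow> complex) set set" where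
  "isotropy_subalgebra G = {c \<in> acarrier (Cr G). supp (jmap c) \<subseteq> isotropy G}"

end

theory Submission
  imports Defs
begin

text \<open>
  Everything takes place in the algebra of those functions on the groupoid whose convolution operators
  are uniformly bounded on the fibres of the source map. It is complete, has the indicator function of
  the unit space as identity, and the map \<open>j\<close> identifies \<open>B\<^sup>*\<^sub>r(G)\<close> isometrically with the closure of
  \<open>B\<^sub>c(G)\<close> in it.

  By Stone--Weierstrass on the composable pairs, pointwise multiplication by a function in \<open>C\<^sub>c(G)\<close>
  preserves \<open>C\<^sup>*\<^sub>r(G)\<close>. Since the isotropy outside the unit space is discrete, multiplying an element
  of \<open>D'\<close> by a bump at such a point \<open>\<gamma>\<close> shows that \<open>D'\<close> is carried by the set \<open>H\<close> of units together
  with those isotropy elements \<open>\<gamma>\<close> whose indicator function lies in \<open>C\<^sup>*\<^sub>r(G)\<close>. This \<open>H\<close> is a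
  subgroupoid, and restriction of functions to \<open>H\<close> is the conditional expectation: on each fibre it
  is the compression to a block diagonal, hence contractive and positive. It is faithful because
  \<open>(a\<^sup>* \<star> a)(x)\<close> is the sum of \<open>\<bar>a\<bar>\<^sup>2\<close> over the fibre at \<open>x\<close>. An element commuting with
  \<open>C\<^sub>c(G\<^sup>0)\<close> is supported in the isotropy, which gives maximality, and functions supported in a
  bisection normalise \<open>D'\<close>, which gives regularity.
\<close>

section \<open>Functions acting boundedly on the fibres\<close>

text \<open>The range map need not be open, so convolution need not preserve continuity: if an
  isolated isotropy element \<gamma> of order two sits over a non-isolated unit x, the square of its
  indicator function is that of x. Hence C_c(G) need not be an algebra, and pointwise multiplication
  must be followed through iterated convolutions. Nor can the expectation be restriction to the
  whole isotropy: for the reflection of the line, the flip at its fixed point is isolated in the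
  isotropy off the units, but its indicator function is not in C*_r(G). Restriction to H stays
  inside because a compact support meets the isotropy off the units in a compact discrete set: what
  remains is a cut-off to the clopen unit space plus finitely many indicator functions that lie in
  the algebra by the choice of H. Positivity asks for a factor in C*_r(G) itself, whereas
  compression yields only a positive semidefinite kernel. The square root comes from an iteration in
  the ambient unital algebra, arranged without constant term so that it never leaves D', although
  the identity may lie outside C*_r(G).\<close>

text \<open>\<open>C\<close> bounds the norms of the regular representations of \<open>f\<close>, tested on finitely supported
  vectors so that it makes sense for every function.\<close>

definition op_bound :: "'g groupoid \<Rightarrow> ('g \<Rightarrow> complex) \<Rightarrow> real \<Rightarrow> bool" where
  "op_bound G f C \<longleftrightarrow> 0 \<le> C \<and>
     (\<forall>x S T \<phi> \<psi>. finite S \<longrightarrow> finite T \<longrightarrow> S \<subseteq> {a. src G a = x} \<longrightarrow> T \<subseteq> {a. src G a = x} \<longrightarrow>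
        cmod (\<Sum>a\<in>S. \<Sum>b\<in>T. \<phi> a * f (gmul G a (ginv G b)) * \<psi> b)
          \<le> C * L2_set (\<lambda>a. cmod (\<phi> a)) S * L2_set (\<lambda>b. cmod (\<psi> b)) T)"

definition op_bounded :: "'g groupoid \<Rightarrow> ('g \<Rightarrow> complex) set" where
  "op_bounded G = {f. \<exists>C. op_bound G f C}"

definition opnorm :: "'g groupoid \<Rightarrow> ('g \<Rightarrow> complex) \<Rightarrow> real" where
  "opnorm G f = Inf {C. op_bound G f C}"

definition unit_fn :: "'g groupoid \<Rightarrow> 'g \<Rightarrow> complex" where
  "unit_fn G a = (if rng G a = a then 1 else 0)"

context groupoid
begin

section \<open>Cancellation laws and convolution as matrix multiplication on source fibres\<close>

lemma ginv_ginv [simp]: "ginv G (ginv G a) = a"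
proof -
  have "gmul G (ginv G (ginv G a)) (gmul G (ginv G a) a) = gmul G (rng G a) a"
    by (metis gmul_assoc ginv_gmul rng_ginv src_ginv)
  then show ?thesis
    by (metis ginv_gmul gmul_rng gmul_src rng_ginv src_ginv)
qed

declare rng_ginv [simp] src_ginv [simp] gmul_rng [simp] gmul_src [simp] rng_rng [simp]
  src_rng [simp] rng_src [simp] src_src [simp] rng_gmul [simp] src_gmul [simp]
  gmul_ginv [simp] ginv_gmul [simp]

lemma ginv_cancel_left [simp]: "src G a = rng G b \<Longrightarrow> gmul G (ginv G a) (gmul G a b) = b"
  using gmul_assoc[of "ginv G a" a b] by simp

lemma cancel_ginv_left [simp]: "rng G a = rng G b \<Longrightarrow> gmul G a (gmul G (ginv G a) b) = b"
  using gmul_assoc[of a "ginv G a" b] by simp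

lemma cancel_ginv_right [simp]: "src G a = rng G b \<Longrightarrow> gmul G (gmul G a b) (ginv G b) = a"
  using gmul_assoc[of a b "ginv G b"] by (metis gmul_ginv gmul_src rng_ginv)

lemma ginv_cancel_right [simp]: "src G a = src G b \<Longrightarrow> gmul G (gmul G a (ginv G b)) b = a"
  using gmul_assoc[of a "ginv G b" b] by (simp) (metis gmul_src)

lemma ginv_unique: "src G a = rng G b \<Longrightarrow> gmul G a b = rng G a \<Longrightarrow> ginv G a = b"
  by (metis ginv_cancel_left gmul_src src_ginv)

lemma ginv_mult: "src G a = rng G b \<Longrightarrow> ginv G (gmul G a b) = gmul G (ginv G b) (ginv G a)"
  by (rule ginv_unique) (auto simp: gmul_assoc)

lemma ginv_src [simp]: "ginv G (src G a) = src G a"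
  by (rule ginv_unique) (auto, metis gmul_src src_src)

lemma ginv_rng [simp]: "ginv G (rng G a) = rng G a"
  by (metis ginv_src src_rng)

lemma ginv_div [simp]: "src G a = src G b \<Longrightarrow> ginv G (gmul G a (ginv G b)) = gmul G b (ginv G a)"
  by (simp add: ginv_mult)

lemma div_mult_div [simp]:
  "src G a = src G c \<Longrightarrow> src G b = src G c \<Longrightarrow>
     gmul G (gmul G a (ginv G c)) (gmul G c (ginv G b)) = gmul G a (ginv G b)"
  by (simp add: gmul_assoc)

lemma gmul_unit_simps [simp]:
  "rng G b = src G a \<Longrightarrow> gmul G a (rng G b) = a"
  "src G a = src G c \<Longrightarrow> gmul G a (src G c) = a"
  "rng G a = rng G c \<Longrightarrow> gmul G (rng G c) a = a"
  "rng G a = src G c \<Longrightarrow> gmul G (src G c) a = a"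
  by (metis gmul_src) (metis gmul_src, metis gmul_rng, metis gmul_rng)

text \<open>In the matrix picture, where \<open>f\<close> acts on a source fibre with entries
  \<open>f (gmul G a (ginv G b))\<close>, this is what turns \<open>unit_fn\<close> into the
  identity matrix.\<close>

lemma div_unit_iff: "src G a = src G b \<Longrightarrow> rng G (gmul G a (ginv G b)) = gmul G a (ginv G b) \<longleftrightarrow> a = b"
proof
  assume s: "src G a = src G b" and u: "rng G (gmul G a (ginv G b)) = gmul G a (ginv G b)"
  have e: "gmul G a (ginv G b) = rng G a" using u s by simp
  have "src G (gmul G a (ginv G b)) = rng G b" using s by simp
  then have "rng G a = rng G b" unfolding e by simp
  then show "a = b"
    using ginv_cancel_right[OF s] unfolding e by (simp add: \<open>rng G a = rng G b\<close>)
qed simp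

lemma mem_units_iff: "a \<in> units G \<longleftrightarrow> rng G a = a"
proof
  assume "rng G a = a"
  then have "src G a = a" using src_rng[of a] by simp
  then show "a \<in> units G" unfolding units_def by (metis rangeI)
qed (auto simp: units_def)

text \<open>A factorisation \<open>p q\<close> of \<open>a b^{-1}\<close> amounts to the choice of
  an intermediate point \<open>d = q b\<close> of the source fibre, with \<open>p = a d^{-1}\<close>
  and \<open>q = d b^{-1}\<close>. In this parametrisation convolution is multiplication of matrices
  indexed by the fibre, and the operator estimates are made in that form.\<close>

lemma conv_pair_bij:
  "bij_betw (\<lambda>d. (gmul G a (ginv G d), gmul G d (ginv G b))) {d. src G d = x}
     {(p, q). src G p = rng G q \<and> gmul G p q = gmul G a (ginv G b)}"
  if "src G a = x" "src G b = x"
proof (rule bij_betw_byWitness[where f' = "\<lambda>z. gmul G (snd z) b"])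
  show "\<forall>d\<in>{d. src G d = x}. gmul G (snd (gmul G a (ginv G d), gmul G d (ginv G b))) b = d"
    using that by auto
  have *: "gmul G a (gmul G (ginv G b) (ginv G q)) = p \<and> src G q = rng G b"
    if pq: "src G p = rng G q" "gmul G p q = gmul G a (ginv G b)" for p q
  proof -
    have s: "src G q = rng G b" by (metis that(2) pq(1) src_gmul \<open>src G a = x\<close> \<open>src G b = x\<close> rng_ginv src_ginv)
    have "p = gmul G (gmul G p q) (ginv G q)"
      using cancel_ginv_right[OF pq(1)] by simp
    also have "\<dots> = gmul G a (gmul G (ginv G b) (ginv G q))"
      unfolding pq(2) using s \<open>src G a = x\<close> \<open>src G b = x\<close> by (intro gmul_assoc) simp_all
    finally show ?thesis using s by simp
  qed
  show "\<forall>z\<in>{(p, q). src G p = rng G q \<and> gmul G p q = gmul G a (ginv G b)}.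
      (gmul G a (ginv G (gmul G (snd z) b)), gmul G (gmul G (snd z) b) (ginv G b)) = z"
    using * by (auto simp: ginv_mult)
  show "(\<lambda>d. (gmul G a (ginv G d), gmul G d (ginv G b))) ` {d. src G d = x}
    \<subseteq> {(p, q). src G p = rng G q \<and> gmul G p q = gmul G a (ginv G b)}"
    using that by auto
  show "(\<lambda>z. gmul G (snd z) b) `
    {(p, q). src G p = rng G q \<and> gmul G p q = gmul G a (ginv G b)} \<subseteq> {d. src G d = x}"
    using that * by auto
qed

lemma conv_div:
  "src G a = x \<Longrightarrow> src G b = x \<Longrightarrow>
     conv G f g (gmul G a (ginv G b)) =
       (\<Sum>\<^sub>\<infinity>d\<in>{d. src G d = x}. f (gmul G a (ginv G d)) * g (gmul G d (ginv G b)))"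
  unfolding conv_def
  by (subst infsum_reindex_bij_betw[OF conv_pair_bij, symmetric]) auto

lemma conv_src: "conv G f g c = (\<Sum>\<^sub>\<infinity>d\<in>{d. src G d = src G c}. f (gmul G c (ginv G d)) * g d)"
proof -
  have "conv G f g c = conv G f g (gmul G c (ginv G (src G c)))" by simp
  also have "\<dots> = (\<Sum>\<^sub>\<infinity>d\<in>{d. src G d = src G c}. f (gmul G c (ginv G d)) * g (gmul G d (ginv G (src G c))))"
    by (rule conv_div) auto
  also have "\<dots> = (\<Sum>\<^sub>\<infinity>d\<in>{d. src G d = src G c}. f (gmul G c (ginv G d)) * g d)"
    by (intro infsum_cong) simp
  finally show ?thesis .
qed

lemma rng_fibre_bij: "bij_betw (\<lambda>d. gmul G c (ginv G d)) {d. src G d = src G c} {a. rng G a = rng G c}"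
  by (rule bij_betw_byWitness[where f' = "\<lambda>a. gmul G (ginv G a) c"]) (auto simp: ginv_mult gmul_assoc)

text \<open>Substituting \<open>a = c d^{-1}\<close> moves the sum from a source fibre to a range
  fibre, where the support of the left factor can cut it down to finitely many terms.\<close>

lemma conv_rng: "conv G f g c = (\<Sum>\<^sub>\<infinity>a\<in>{a. rng G a = rng G c}. f a * g (gmul G (ginv G a) c))"
  unfolding conv_src
  by (subst infsum_reindex_bij_betw[OF rng_fibre_bij, symmetric])
    (auto intro!: infsum_cong simp: gmul_assoc)

lemma regular_rep_eq: "regular_rep G x f \<psi> c = (if src G c = x then conv G f \<psi> c else 0)"
  unfolding regular_rep_def conv_def by simp

section \<open>Operator bounds and the operator norm\<close>

lemma op_boundD:
  assumes "op_bound G f C" "finite S" "finite T" "\<And>a. a \<in> S \<Longrightarrow> src G a = x" "\<And>a. a \<in> T \<Longrightarrow> src G a = x"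
  shows "cmod (\<Sum>a\<in>S. \<Sum>b\<in>T. \<phi> a * f (gmul G a (ginv G b)) * \<psi> b)
          \<le> C * L2_set (\<lambda>a. cmod (\<phi> a)) S * L2_set (\<lambda>b. cmod (\<psi> b)) T"
  using assms unfolding op_bound_def by (metis (mono_tags, lifting) mem_Collect_eq subsetI)

lemma op_boundI:
  assumes "0 \<le> C"
    and "\<And>x S T \<phi> \<psi>. finite S \<Longrightarrow> finite T \<Longrightarrow> (\<And>a. a \<in> S \<Longrightarrow> src G a = x) \<Longrightarrow>
        (\<And>a. a \<in> T \<Longrightarrow> src G a = x) \<Longrightarrow>
        cmod (\<Sum>a\<in>S. \<Sum>b\<in>T. \<phi> a * f (gmul G a (ginv G b)) * \<psi> b)
          \<le> C * L2_set (\<lambda>a. cmod (\<phi> a)) S * L2_set (\<lambda>b. cmod (\<psi> b)) T"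
  shows "op_bound G f C"
  unfolding op_bound_def using assms by (auto simp: subset_iff)

lemma op_bound_nonneg: "op_bound G f C \<Longrightarrow> 0 \<le> C"
  by (simp add: op_bound_def)

lemma op_bound_mono: "op_bound G f C \<Longrightarrow> C \<le> D \<Longrightarrow> op_bound G f D"
proof (rule op_boundI)
  assume C: "op_bound G f C" "C \<le> D"
  then show "0 \<le> D" using op_bound_nonneg by fastforce
  fix x S T and \<phi> \<psi> :: "'g \<Rightarrow> complex"
  assume fin: "finite S" "finite T" and st: "\<And>a. a \<in> S \<Longrightarrow> src G a = x" "\<And>a. a \<in> T \<Longrightarrow> src G a = x"
  show "cmod (\<Sum>a\<in>S. \<Sum>b\<in>T. \<phi> a * f (gmul G a (ginv G b)) * \<psi> b)
      \<le> D * L2_set (\<lambda>a. cmod (\<phi> a)) S * L2_set (\<lambda>b. cmod (\<psi> b)) T"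
    using op_boundD[OF C(1) fin st] mult_right_mono[OF mult_right_mono[OF C(2)]]
    by (rule order_trans) simp_all
qed

text \<open>Each test inequality is a closed condition on the constant and survives the limit as
  \<epsilon> decreases to 0. This is why the infimum defining \<open>opnorm\<close> is itself a
  bound.\<close>

lemma op_bound_lim:
  assumes "\<And>\<epsilon>. 0 < \<epsilon> \<Longrightarrow> op_bound G f (C + \<epsilon>)"
  shows "op_bound G f C"
proof (rule op_boundI)
  show "0 \<le> C"
    using op_bound_nonneg[OF assms] by (meson field_le_epsilon)
next
  fix x S T and \<phi> \<psi> :: "'g \<Rightarrow> complex"
  assume fin: "finite S" "finite T" and st: "\<And>a. a \<in> S \<Longrightarrow> src G a = x" "\<And>a. a \<in> T \<Longrightarrow> src G a = x"
  let ?p = "L2_set (\<lambda>a. cmod (\<phi> a)) S" and ?q = "L2_set (\<lambda>b. cmod (\<psi> b)) T"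
  let ?s = "cmod (\<Sum>a\<in>S. \<Sum>b\<in>T. \<phi> a * f (gmul G a (ginv G b)) * \<psi> b)"
  have "?s \<le> (C + \<epsilon>) * ?p * ?q" if "0 < \<epsilon>" for \<epsilon>
    using op_boundD[OF assms[OF that] fin st] by simp
  then have "\<forall>\<^sub>F \<epsilon> in at_right 0. ?s \<le> (C + \<epsilon>) * ?p * ?q"
    by (auto simp: eventually_at_right_less eventually_at_filter intro!: always_eventually)
  moreover have "((\<lambda>\<epsilon>. (C + \<epsilon>) * ?p * ?q) \<longlongrightarrow> (C + 0) * ?p * ?q) (at_right 0)"
    by (intro tendsto_intros)
  ultimately show "?s \<le> C * ?p * ?q"
    using tendsto_lowerbound[of "\<lambda>\<epsilon>. (C + \<epsilon>) * ?p * ?q"] by simp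
qed

lemma op_bounded_iff: "f \<in> op_bounded G \<longleftrightarrow> (\<exists>C. op_bound G f C)"
  by (simp add: op_bounded_def)

lemma op_bound_opnorm:
  assumes "f \<in> op_bounded G"
  shows "op_bound G f (opnorm G f)"
proof (rule op_bound_lim)
  fix \<epsilon> :: real assume "0 < \<epsilon>"
  have ne: "{C. op_bound G f C} \<noteq> {}" using assms by (auto simp: op_bounded_iff)
  then have "\<exists>C\<in>{C. op_bound G f C}. C < Inf {C. op_bound G f C} + \<epsilon>"
    using \<open>0 < \<epsilon>\<close> by (metis cInf_lessD less_add_same_cancel1)
  then show "op_bound G f (opnorm G f + \<epsilon>)"
    unfolding opnorm_def using op_bound_mono by fastforce
qed

lemma opnorm_le: "op_bound G f C \<Longrightarrow> opnorm G f \<le> C"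
  unfolding opnorm_def by (rule cInf_lower) (auto intro!: bdd_belowI[of _ 0] op_bound_nonneg)

lemma opnorm_nonneg: "f \<in> op_bounded G \<Longrightarrow> 0 \<le> opnorm G f"
  using op_bound_opnorm op_bound_nonneg by blast

lemma op_boundedI: "op_bound G f C \<Longrightarrow> f \<in> op_bounded G"
  by (auto simp: op_bounded_iff)

lemma op_bound_le: "f \<in> op_bounded G \<Longrightarrow> opnorm G f \<le> C \<Longrightarrow> op_bound G f C"
  using op_bound_opnorm op_bound_mono by blast

lemma op_bound_add:
  assumes "op_bound G f C" "op_bound G g D"
  shows "op_bound G (\<lambda>a. f a + g a) (C + D)"
proof (rule op_boundI)
  show "0 \<le> C + D" using assms by (simp add: op_bound_nonneg)
next
  fix x S T and \<phi> \<psi> :: "'g \<Rightarrow> complex"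
  assume fin: "finite S" "finite T" and st: "\<And>a. a \<in> S \<Longrightarrow> src G a = x" "\<And>a. a \<in> T \<Longrightarrow> src G a = x"
  let ?p = "L2_set (\<lambda>a. cmod (\<phi> a)) S" and ?q = "L2_set (\<lambda>b. cmod (\<psi> b)) T"
  let ?s = "\<lambda>f. (\<Sum>a\<in>S. \<Sum>b\<in>T. \<phi> a * f (gmul G a (ginv G b)) * \<psi> b)"
  have "?s (\<lambda>a. f a + g a) = ?s f + ?s g"
    by (simp add: algebra_simps sum.distrib)
  also have "cmod \<dots> \<le> C * ?p * ?q + D * ?p * ?q"
    using op_boundD[OF assms(1) fin st, of \<phi> \<psi>] op_boundD[OF assms(2) fin st, of \<phi> \<psi>]
    by (intro norm_triangle_mono) auto
  finally show "cmod (?s (\<lambda>a. f a + g a)) \<le> (C + D) * ?p * ?q"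
    by (simp add: algebra_simps)
qed

lemma op_bound_scale:
  assumes "op_bound G f C"
  shows "op_bound G (\<lambda>a. z * f a) (cmod z * C)"
proof (rule op_boundI)
  show "0 \<le> cmod z * C" using assms by (simp add: op_bound_nonneg)
next
  fix x S T and \<phi> \<psi> :: "'g \<Rightarrow> complex"
  assume fin: "finite S" "finite T" and st: "\<And>a. a \<in> S \<Longrightarrow> src G a = x" "\<And>a. a \<in> T \<Longrightarrow> src G a = x"
  let ?s = "\<lambda>f. (\<Sum>a\<in>S. \<Sum>b\<in>T. \<phi> a * f (gmul G a (ginv G b)) * \<psi> b)"
  have "?s (\<lambda>a. z * f a) = z * ?s f"
    by (simp add: sum_distrib_left mult.assoc mult.left_commute)
  then show "cmod (?s (\<lambda>a. z * f a)) \<le> cmod z * C * L2_set (\<lambda>a. cmod (\<phi> a)) S * L2_set (\<lambda>b. cmod (\<psi> b)) T"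
    using mult_left_mono[OF op_boundD[OF assms fin st], of "cmod z" \<phi> \<psi>]
    by (simp add: norm_mult mult.assoc)
qed

lemma op_bound_zero [simp]: "op_bound G (\<lambda>a. 0) 0"
  by (rule op_boundI) auto

lemma op_bounded_zero [simp]: "(\<lambda>a. 0) \<in> op_bounded G"
  using op_bound_zero op_boundedI by blast

lemma op_bounded_add: "f \<in> op_bounded G \<Longrightarrow> g \<in> op_bounded G \<Longrightarrow> (\<lambda>a. f a + g a) \<in> op_bounded G"
  unfolding op_bounded_iff using op_bound_add by blast

lemma opnorm_add: "f \<in> op_bounded G \<Longrightarrow> g \<in> op_bounded G \<Longrightarrow>
    opnorm G (\<lambda>a. f a + g a) \<le> opnorm G f + opnorm G g"
  by (intro opnorm_le op_bound_add op_bound_opnorm)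

lemma op_bounded_scale: "f \<in> op_bounded G \<Longrightarrow> (\<lambda>a. z * f a) \<in> op_bounded G"
  unfolding op_bounded_iff using op_bound_scale by blast

lemma opnorm_scale_le: "f \<in> op_bounded G \<Longrightarrow> opnorm G (\<lambda>a. z * f a) \<le> cmod z * opnorm G f"
  by (intro opnorm_le op_bound_scale op_bound_opnorm)

lemma op_bounded_uminus: "f \<in> op_bounded G \<Longrightarrow> (\<lambda>a. - f a) \<in> op_bounded G"
  using op_bounded_scale[of f "-1"] by simp

lemma op_bounded_diff: "f \<in> op_bounded G \<Longrightarrow> g \<in> op_bounded G \<Longrightarrow> (\<lambda>a. f a - g a) \<in> op_bounded G"
  using op_bounded_add[OF _ op_bounded_uminus, of f g] by simp

lemma opnorm_minus_commute:
  assumes "f \<in> op_bounded G" "g \<in> op_bounded G"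
  shows "opnorm G (\<lambda>a. f a - g a) = opnorm G (\<lambda>a. g a - f a)"
proof -
  have "opnorm G (\<lambda>a. f a - g a) \<le> opnorm G (\<lambda>a. g a - f a)"
    if "f \<in> op_bounded G" "g \<in> op_bounded G" for f g
    using opnorm_scale_le[OF op_bounded_diff[OF that(2,1)], of "-1"] by simp
  then show ?thesis using assms by (simp add: antisym)
qed

lemma opnorm_triangle:
  assumes "f \<in> op_bounded G" "g \<in> op_bounded G" "h \<in> op_bounded G"
  shows "opnorm G (\<lambda>a. f a - h a) \<le> opnorm G (\<lambda>a. f a - g a) + opnorm G (\<lambda>a. g a - h a)"
  using opnorm_add[OF op_bounded_diff[OF assms(1,2)] op_bounded_diff[OF assms(2,3)]] by simp

text \<open>The entry in row \<open>a\<close> and column \<open>src G a\<close> is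
  \<open>f a\<close> itself, so two basis vectors suffice as a test. This is the domination of the
  supremum norm by the operator norm that makes the map j well defined and norm-decreasing.\<close>

lemma op_bound_apply:
  assumes "op_bound G f C"
  shows "cmod (f a) \<le> C"
proof -
  have "cmod (\<Sum>c\<in>{a}. \<Sum>b\<in>{src G a}. 1 * f (gmul G c (ginv G b)) * 1)
      \<le> C * L2_set (\<lambda>a. cmod 1) {a} * L2_set (\<lambda>b. cmod 1) {src G a}"
    by (rule op_boundD[OF assms]) auto
  then show ?thesis by (simp add: L2_set_def)
qed

lemma cmod_le_opnorm: "f \<in> op_bounded G \<Longrightarrow> cmod (f a) \<le> opnorm G f"
  using op_bound_apply op_bound_opnorm by blast

end

lemma L2_set_power2: "(L2_set f A)\<^sup>2 = (\<Sum>i\<in>A. (f i)\<^sup>2)"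
  by (simp add: L2_set_def sum_nonneg)

lemma has_sum_norm_le:
  fixes F :: "'a \<Rightarrow> complex"
  assumes "(F has_sum s) A" and "\<And>R. finite R \<Longrightarrow> R \<subseteq> A \<Longrightarrow> cmod (sum F R) \<le> B"
  shows "cmod s \<le> B"
proof (rule tendsto_upperbound)
  show "((\<lambda>R. cmod (sum F R)) \<longlongrightarrow> cmod s) (finite_subsets_at_top A)"
    using assms(1) unfolding has_sum_def by (rule tendsto_norm)
  show "\<forall>\<^sub>F R in finite_subsets_at_top A. cmod (sum F R) \<le> B"
    using assms(2) by (intro eventually_finite_subsets_at_top_weakI) auto
qed simp

lemma has_sum_sum:
  fixes F :: "'i \<Rightarrow> 'a \<Rightarrow> complex"
  assumes "finite I" "\<And>i. i \<in> I \<Longrightarrow> (F i has_sum s i) A"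
  shows "((\<lambda>x. \<Sum>i\<in>I. F i x) has_sum (\<Sum>i\<in>I. s i)) A"
  using assms by (induction I rule: finite_induct) (auto intro!: has_sum_add)

lemma infsum_single:
  fixes F :: "'a \<Rightarrow> complex"
  assumes "i \<in> A" "\<And>j. j \<in> A \<Longrightarrow> j \<noteq> i \<Longrightarrow> F j = 0"
  shows "infsum F A = F i"
proof -
  have "infsum F A = infsum F {i}" using assms by (intro infsum_cong_neutral) auto
  then show ?thesis by simp
qed

context groupoid
begin

text \<open>Testing with the conjugate of the output vector in place of \<phi> gives
  \<open>?n\<^sup>2 \<le> C * ?n * ?q\<close>, from which one factor \<open>?n\<close>
  cancels.\<close>

lemma op_bound_vec:
  assumes f: "op_bound G f C" and fin: "finite S" "finite T"
    and st: "\<And>a. a \<in> S \<Longrightarrow> src G a = x" "\<And>a. a \<in> T \<Longrightarrow> src G a = x"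
  shows "L2_set (\<lambda>a. cmod (\<Sum>b\<in>T. f (gmul G a (ginv G b)) * \<psi> b)) S \<le> C * L2_set (\<lambda>b. cmod (\<psi> b)) T"
    (is "?n \<le> C * ?q")
proof -
  define v where "v a = (\<Sum>b\<in>T. f (gmul G a (ginv G b)) * \<psi> b)" for a
  have "(\<Sum>a\<in>S. \<Sum>b\<in>T. cnj (v a) * f (gmul G a (ginv G b)) * \<psi> b) = (\<Sum>a\<in>S. cnj (v a) * v a)"
    by (simp add: v_def sum_distrib_left mult.assoc)
  also have "\<dots> = of_real (\<Sum>a\<in>S. (cmod (v a))\<^sup>2)"
    unfolding of_real_sum complex_norm_square by (simp add: mult.commute)
  also have "\<dots> = of_real (?n\<^sup>2)" by (simp add: L2_set_power2 v_def)
  finally have "cmod (of_real (?n\<^sup>2)) \<le> C * L2_set (\<lambda>a. cmod (cnj (v a))) S * ?q"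
    using op_boundD[OF f fin st, of "\<lambda>a. cnj (v a)" \<psi>] by simp
  moreover have "L2_set (\<lambda>a. cmod (cnj (v a))) S = ?n"
    by (simp only: complex_mod_cnj v_def)
  ultimately have "?n * ?n \<le> ?n * (C * ?q)"
    by (simp only: norm_of_real power2_eq_square mult_ac abs_mult abs_of_nonneg L2_set_nonneg)
  moreover have "0 \<le> C * ?q" using op_bound_nonneg[OF f] by simp
  ultimately show ?thesis
    using L2_set_nonneg by (smt (verit) mult_le_cancel_left_pos)
qed

lemma op_bound_invol: "op_bound G (invol G f) C" if f: "op_bound G f C"
proof (rule op_boundI)
  show "0 \<le> C" using f by (rule op_bound_nonneg)
  fix x S T and \<phi> \<psi> :: "'g \<Rightarrow> complex"
  assume fin: "finite S" "finite T" and st: "\<And>a. a \<in> S \<Longrightarrow> src G a = x" "\<And>a. a \<in> T \<Longrightarrow> src G a = x"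
  have "(\<Sum>a\<in>S. \<Sum>b\<in>T. \<phi> a * invol G f (gmul G a (ginv G b)) * \<psi> b) =
      cnj (\<Sum>a\<in>S. \<Sum>b\<in>T. cnj (\<psi> b) * f (gmul G b (ginv G a)) * cnj (\<phi> a))"
    using st by (simp add: invol_def mult.commute mult.left_commute)
  also have "\<dots> = cnj (\<Sum>b\<in>T. \<Sum>a\<in>S. cnj (\<psi> b) * f (gmul G b (ginv G a)) * cnj (\<phi> a))"
    by (subst sum.swap) simp
  finally have "cmod (\<Sum>a\<in>S. \<Sum>b\<in>T. \<phi> a * invol G f (gmul G a (ginv G b)) * \<psi> b) =
      cmod (\<Sum>b\<in>T. \<Sum>a\<in>S. cnj (\<psi> b) * f (gmul G b (ginv G a)) * cnj (\<phi> a))"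
    by (simp only: complex_mod_cnj)
  also have "\<dots> \<le> C * L2_set (\<lambda>b. cmod (cnj (\<psi> b))) T * L2_set (\<lambda>a. cmod (cnj (\<phi> a))) S"
    by (rule op_boundD[OF f fin(2,1) st(2,1)])
  finally show "cmod (\<Sum>a\<in>S. \<Sum>b\<in>T. \<phi> a * invol G f (gmul G a (ginv G b)) * \<psi> b)
      \<le> C * L2_set (\<lambda>a. cmod (\<phi> a)) S * L2_set (\<lambda>b. cmod (\<psi> b)) T"
    by (simp only: complex_mod_cnj mult_ac)
qed

lemma op_bounded_invol: "f \<in> op_bounded G \<Longrightarrow> invol G f \<in> op_bounded G"
  unfolding op_bounded_iff using op_bound_invol by blast

lemma invol_invol [simp]: "invol G (invol G f) = f"
  by (simp add: invol_def fun_eq_iff)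

lemma opnorm_invol: "f \<in> op_bounded G \<Longrightarrow> opnorm G (invol G f) = opnorm G f"
  by (metis antisym invol_invol op_bound_invol op_bound_opnorm op_bounded_invol opnorm_le)

text \<open>Row combinations of \<open>f\<close> are conjugates of column combinations of
  \<open>invol G f\<close>, which has the same bound.\<close>

lemma op_bound_vec':
  assumes f: "op_bound G f C" and fin: "finite S" "finite T"
    and st: "\<And>a. a \<in> S \<Longrightarrow> src G a = x" "\<And>a. a \<in> T \<Longrightarrow> src G a = x"
  shows "L2_set (\<lambda>b. cmod (\<Sum>a\<in>S. \<phi> a * f (gmul G a (ginv G b)))) T \<le> C * L2_set (\<lambda>a. cmod (\<phi> a)) S"
proof -
  have "L2_set (\<lambda>b. cmod (\<Sum>a\<in>S. invol G f (gmul G b (ginv G a)) * cnj (\<phi> a))) T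
      \<le> C * L2_set (\<lambda>a. cmod (cnj (\<phi> a))) S"
    by (rule op_bound_vec[OF op_bound_invol[OF f] fin(2,1) st(2,1)])
  also have "L2_set (\<lambda>b. cmod (\<Sum>a\<in>S. invol G f (gmul G b (ginv G a)) * cnj (\<phi> a))) T =
     L2_set (\<lambda>b. cmod (cnj (\<Sum>a\<in>S. \<phi> a * f (gmul G a (ginv G b))))) T"
    using st by (intro L2_set_cong refl arg_cong[where f = cmod])
      (simp add: invol_def mult.commute)
  finally show ?thesis by (simp only: complex_mod_cnj)
qed

section \<open>Convolution of operator-bounded functions\<close>

lemma op_bound_col:
  assumes "op_bound G f C" "finite S" "\<And>a. a \<in> S \<Longrightarrow> src G a = x" "src G b = x"
  shows "L2_set (\<lambda>a. cmod (f (gmul G a (ginv G b)))) S \<le> C"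
proof -
  have "L2_set (\<lambda>a. cmod (\<Sum>b\<in>{b}. f (gmul G a (ginv G b)) * 1)) S \<le> C * L2_set (\<lambda>b. cmod 1) {b}"
    by (rule op_bound_vec[OF assms(1,2)]) (use assms in auto)
  then show ?thesis by (simp add: L2_set_def)
qed

lemma op_bound_row:
  assumes "op_bound G f C" "finite T" "\<And>a. a \<in> T \<Longrightarrow> src G a = x" "src G a = x"
  shows "L2_set (\<lambda>b. cmod (f (gmul G a (ginv G b)))) T \<le> C"
proof -
  have "L2_set (\<lambda>b. cmod (\<Sum>a\<in>{a}. 1 * f (gmul G a (ginv G b)))) T \<le> C * L2_set (\<lambda>b. cmod 1) {a}"
    by (rule op_bound_vec'[OF assms(1) _ assms(2)]) (use assms in auto)
  then show ?thesis by (simp add: L2_set_def)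
qed

text \<open>A row of \<open>f\<close> and a column of \<open>g\<close> are square summable with
  norms at most \<open>opnorm G f\<close> and \<open>opnorm G g\<close>, so Cauchy-Schwarz gives
  absolute convergence. Hence convolution makes sense on all of \<open>op_bounded G\<close>,
  including norm limits of compactly supported functions.\<close>

lemma conv_abs_summable:
  assumes f: "f \<in> op_bounded G" and g: "g \<in> op_bounded G" and a: "src G a = x" and b: "src G b = x"
  shows "(\<lambda>d. cmod (f (gmul G a (ginv G d)) * g (gmul G d (ginv G b)))) summable_on {d. src G d = x}"
proof (rule nonneg_bdd_above_summable_on)
  show "bdd_above (sum (\<lambda>d. cmod (f (gmul G a (ginv G d)) * g (gmul G d (ginv G b)))) `
          {F. F \<subseteq> {d. src G d = x} \<and> finite F})"
  proof (rule bdd_aboveI2)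
    fix R assume "R \<in> {F. F \<subseteq> {d. src G d = x} \<and> finite F}"
    then have R: "finite R" "\<And>d. d \<in> R \<Longrightarrow> src G d = x" by auto
    have "(\<Sum>d\<in>R. cmod (f (gmul G a (ginv G d)) * g (gmul G d (ginv G b)))) \<le>
      L2_set (\<lambda>d. cmod (f (gmul G a (ginv G d)))) R * L2_set (\<lambda>d. cmod (g (gmul G d (ginv G b)))) R"
      using L2_set_mult_ineq[of "\<lambda>d. cmod (f (gmul G a (ginv G d)))" "\<lambda>d. cmod (g (gmul G d (ginv G b)))" R]
      by (simp add: norm_mult)
    also have "\<dots> \<le> opnorm G f * opnorm G g"
      by (intro mult_mono op_bound_row[OF op_bound_opnorm[OF f] R] op_bound_col[OF op_bound_opnorm[OF g] R])
        (auto simp: a b opnorm_nonneg f)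
    finally show "(\<Sum>d\<in>R. cmod (f (gmul G a (ginv G d)) * g (gmul G d (ginv G b)))) \<le> opnorm G f * opnorm G g" .
  qed
qed auto

lemma conv_has_sum:
  assumes "f \<in> op_bounded G" "g \<in> op_bounded G" "src G a = x" "src G b = x"
  shows "((\<lambda>d. f (gmul G a (ginv G d)) * g (gmul G d (ginv G b))) has_sum conv G f g (gmul G a (ginv G b)))
     {d. src G d = x}"
  unfolding conv_div[OF assms(3,4), of f g]
  by (rule has_sum_infsum, rule abs_summable_summable, rule conv_abs_summable[OF assms])

lemma conv_has_sum_src:
  assumes "f \<in> op_bounded G" "g \<in> op_bounded G"
  shows "((\<lambda>d. f (gmul G c (ginv G d)) * g d) has_sum conv G f g c) {d. src G d = src G c}"
proof -
  have "((\<lambda>d. f (gmul G c (ginv G d)) * g (gmul G d (ginv G (src G c)))) has_sum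
      conv G f g (gmul G c (ginv G (src G c)))) {d. src G d = src G c}"
    by (rule conv_has_sum[OF assms]) simp_all
  then have "((\<lambda>d. f (gmul G c (ginv G d)) * g (gmul G d (ginv G (src G c)))) has_sum
      conv G f g c) {d. src G d = src G c}"
    by simp
  then show ?thesis
    by (rule has_sum_cong[THEN iffD1, rotated]) simp
qed

text \<open>Over a finite set \<open>R\<close> of intermediate points the form is the sum of
  \<open>u d * v d\<close>, where \<open>u\<close> is the row vector \<phi> applied to
  \<open>f\<close> and \<open>v\<close> is \<open>g\<close> applied to \<psi>. Cauchy-Schwarz bounds
  it independently of \<open>R\<close>, so the bound passes to the infinite sum.\<close>

lemma op_bound_conv:
  assumes f: "op_bound G f C" and g: "op_bound G g D"
  shows "op_bound G (conv G f g) (C * D)"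
proof (rule op_boundI)
  show "0 \<le> C * D" using assms by (simp add: op_bound_nonneg)
  fix x S T and \<phi> \<psi> :: "'g \<Rightarrow> complex"
  assume fin: "finite S" "finite T" and st: "\<And>a. a \<in> S \<Longrightarrow> src G a = x" "\<And>a. a \<in> T \<Longrightarrow> src G a = x"
  let ?p = "L2_set (\<lambda>a. cmod (\<phi> a)) S" and ?q = "L2_set (\<lambda>b. cmod (\<psi> b)) T"
  have "((\<lambda>d. \<Sum>a\<in>S. \<Sum>b\<in>T. \<phi> a * (f (gmul G a (ginv G d)) * g (gmul G d (ginv G b))) * \<psi> b)
      has_sum (\<Sum>a\<in>S. \<Sum>b\<in>T. \<phi> a * conv G f g (gmul G a (ginv G b)) * \<psi> b)) {d. src G d = x}"
    by (intro has_sum_sum fin has_sum_cmult_left has_sum_cmult_right conv_has_sum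
        op_boundedI[OF f] op_boundedI[OF g] st)
  then show "cmod (\<Sum>a\<in>S. \<Sum>b\<in>T. \<phi> a * conv G f g (gmul G a (ginv G b)) * \<psi> b) \<le> C * D * ?p * ?q"
  proof (rule has_sum_norm_le)
    fix R assume R: "finite R" "R \<subseteq> {d. src G d = x}"
    then have Rx: "\<And>d. d \<in> R \<Longrightarrow> src G d = x" by auto
    define u where "u d = (\<Sum>a\<in>S. \<phi> a * f (gmul G a (ginv G d)))" for d
    define v where "v d = (\<Sum>b\<in>T. g (gmul G d (ginv G b)) * \<psi> b)" for d
    have "(\<Sum>d\<in>R. \<Sum>a\<in>S. \<Sum>b\<in>T. \<phi> a * (f (gmul G a (ginv G d)) * g (gmul G d (ginv G b))) * \<psi> b)
        = (\<Sum>d\<in>R. u d * v d)"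
      unfolding u_def v_def sum_product by (simp add: mult.assoc)
    also have "cmod \<dots> \<le> (\<Sum>d\<in>R. \<bar>cmod (u d)\<bar> * \<bar>cmod (v d)\<bar>)"
      by (rule norm_sum[THEN order_trans]) (simp add: norm_mult)
    also have "\<dots> \<le> L2_set (\<lambda>d. cmod (u d)) R * L2_set (\<lambda>d. cmod (v d)) R"
      by (rule L2_set_mult_ineq)
    also have "\<dots> \<le> (C * ?p) * (D * ?q)"
      unfolding u_def v_def
      by (intro mult_mono op_bound_vec'[OF f fin(1) R(1) st(1) Rx] op_bound_vec[OF g R(1) fin(2) Rx st(2)])
        (auto simp: op_bound_nonneg[OF f])
    finally show "cmod (\<Sum>d\<in>R. \<Sum>a\<in>S. \<Sum>b\<in>T. \<phi> a * (f (gmul G a (ginv G d)) * g (gmul G d (ginv G b))) * \<psi> b)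
        \<le> C * D * ?p * ?q" by (simp add: mult_ac)
  qed
qed

lemma op_bounded_conv: "f \<in> op_bounded G \<Longrightarrow> g \<in> op_bounded G \<Longrightarrow> conv G f g \<in> op_bounded G"
  unfolding op_bounded_iff using op_bound_conv by blast

lemma opnorm_conv: "f \<in> op_bounded G \<Longrightarrow> g \<in> op_bounded G \<Longrightarrow> opnorm G (conv G f g) \<le> opnorm G f * opnorm G g"
  by (intro opnorm_le op_bound_conv op_bound_opnorm)

lemma conv_add_left:
  assumes "f \<in> op_bounded G" "g \<in> op_bounded G" "h \<in> op_bounded G"
  shows "conv G (\<lambda>a. f a + g a) h = (\<lambda>a. conv G f h a + conv G g h a)"
proof
  fix c
  have "((\<lambda>d. f (gmul G c (ginv G d)) * h d + g (gmul G c (ginv G d)) * h d) has_sum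
      conv G f h c + conv G g h c) {d. src G d = src G c}"
    by (intro has_sum_add conv_has_sum_src assms)
  then show "conv G (\<lambda>a. f a + g a) h c = conv G f h c + conv G g h c"
    using conv_has_sum_src[OF op_bounded_add[OF assms(1,2)] assms(3), of c]
    by (simp add: distrib_right has_sum_unique)
qed

lemma conv_add_right:
  assumes "f \<in> op_bounded G" "g \<in> op_bounded G" "h \<in> op_bounded G"
  shows "conv G h (\<lambda>a. f a + g a) = (\<lambda>a. conv G h f a + conv G h g a)"
proof
  fix c
  have "((\<lambda>d. h (gmul G c (ginv G d)) * f d + h (gmul G c (ginv G d)) * g d) has_sum
      conv G h f c + conv G h g c) {d. src G d = src G c}"
    by (intro has_sum_add conv_has_sum_src assms)
  then show "conv G h (\<lambda>a. f a + g a) c = conv G h f c + conv G h g c"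
    using conv_has_sum_src[OF assms(3) op_bounded_add[OF assms(1,2)], of c]
    by (simp add: distrib_left has_sum_unique)
qed

lemma conv_scale_left: "conv G (\<lambda>a. z * f a) h = (\<lambda>a. z * conv G f h a)"
  unfolding conv_def by (simp add: infsum_cmult_right' mult.assoc case_prod_unfold fun_eq_iff)

lemma conv_scale_right: "conv G h (\<lambda>a. z * f a) = (\<lambda>a. z * conv G h f a)"
  unfolding conv_def
  by (simp add: infsum_cmult_right'[symmetric] mult.left_commute case_prod_unfold fun_eq_iff)

lemma conv_diff_left:
  assumes "f \<in> op_bounded G" "g \<in> op_bounded G" "h \<in> op_bounded G"
  shows "conv G (\<lambda>a. f a - g a) h = (\<lambda>a. conv G f h a - conv G g h a)"
  using conv_add_left[OF assms(1) op_bounded_scale[OF assms(2)] assms(3), of "-1"]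
    conv_scale_left[of "-1" g h] by simp

lemma conv_diff_right:
  assumes "f \<in> op_bounded G" "g \<in> op_bounded G" "h \<in> op_bounded G"
  shows "conv G h (\<lambda>a. f a - g a) = (\<lambda>a. conv G h f a - conv G h g a)"
  using conv_add_right[OF assms(1) op_bounded_scale[OF assms(2)] assms(3), of "-1"]
    conv_scale_right[of h "-1" g] by simp

lemma opnorm_conv_diff:
  assumes "f \<in> op_bounded G" "f' \<in> op_bounded G" "g \<in> op_bounded G" "g' \<in> op_bounded G"
  shows "opnorm G (\<lambda>a. conv G f g a - conv G f' g' a) \<le>
    opnorm G f * opnorm G (\<lambda>a. g a - g' a) + opnorm G (\<lambda>a. f a - f' a) * opnorm G g'"
proof -
  have "opnorm G (\<lambda>a. conv G f g a - conv G f' g' a) \<le>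
      opnorm G (\<lambda>a. conv G f g a - conv G f g' a) + opnorm G (\<lambda>a. conv G f g' a - conv G f' g' a)"
    by (intro opnorm_triangle op_bounded_conv assms)
  also have "\<dots> \<le> opnorm G f * opnorm G (\<lambda>a. g a - g' a) + opnorm G (\<lambda>a. f a - f' a) * opnorm G g'"
    using assms
    by (intro add_mono) (simp_all add: conv_diff_left[symmetric] conv_diff_right[symmetric] opnorm_conv op_bounded_diff)
  finally show ?thesis .
qed

lemma invol_conv: "invol G (conv G f g) = conv G (invol G g) (invol G f)"
proof
  fix c
  have "conv G f g (gmul G (src G c) (ginv G c)) =
      (\<Sum>\<^sub>\<infinity>d\<in>{d. src G d = src G c}. f (gmul G (src G c) (ginv G d)) * g (gmul G d (ginv G c)))"
    by (rule conv_div) simp_all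
  also have "gmul G (src G c) (ginv G c) = ginv G c"
    by simp
  finally have "invol G (conv G f g) c =
      (\<Sum>\<^sub>\<infinity>d\<in>{d. src G d = src G c}. cnj (f (gmul G (src G c) (ginv G d)) * g (gmul G d (ginv G c))))"
    unfolding invol_def by (simp only: infsum_cnj)
  also have "\<dots> = conv G (invol G g) (invol G f) c"
    unfolding conv_src by (intro infsum_cong) (simp add: invol_def)
  finally show "invol G (conv G f g) c = conv G (invol G g) (invol G f) c" .
qed

lemma invol_add: "invol G (\<lambda>a. f a + g a) = (\<lambda>a. invol G f a + invol G g a)"
  by (simp add: invol_def fun_eq_iff)

lemma invol_diff: "invol G (\<lambda>a. f a - g a) = (\<lambda>a. invol G f a - invol G g a)"
  by (simp add: invol_def fun_eq_iff)

lemma invol_scale: "invol G (\<lambda>a. z * f a) = (\<lambda>a. cnj z * invol G f a)"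
  by (simp add: invol_def fun_eq_iff)

text \<open>Each test inequality is closed and involves finitely many values of the function, so it
  survives pointwise limits.\<close>

lemma op_bound_limit:
  assumes "\<And>n. op_bound G (F n) C" "\<And>a. (\<lambda>n::nat. F n a) \<longlonglongrightarrow> f a"
  shows "op_bound G f C"
proof (rule op_boundI)
  show "0 \<le> C" using assms(1) op_bound_nonneg by blast
  fix x S T and \<phi> \<psi> :: "'g \<Rightarrow> complex"
  assume fin: "finite S" "finite T" and st: "\<And>a. a \<in> S \<Longrightarrow> src G a = x" "\<And>a. a \<in> T \<Longrightarrow> src G a = x"
  show "cmod (\<Sum>a\<in>S. \<Sum>b\<in>T. \<phi> a * f (gmul G a (ginv G b)) * \<psi> b)
      \<le> C * L2_set (\<lambda>a. cmod (\<phi> a)) S * L2_set (\<lambda>b. cmod (\<psi> b)) T"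
  proof (rule LIMSEQ_le_const2)
    show "(\<lambda>n. cmod (\<Sum>a\<in>S. \<Sum>b\<in>T. \<phi> a * F n (gmul G a (ginv G b)) * \<psi> b)) \<longlonglongrightarrow>
        cmod (\<Sum>a\<in>S. \<Sum>b\<in>T. \<phi> a * f (gmul G a (ginv G b)) * \<psi> b)"
      by (intro tendsto_intros assms)
    show "\<exists>N. \<forall>n\<ge>N. cmod (\<Sum>a\<in>S. \<Sum>b\<in>T. \<phi> a * F n (gmul G a (ginv G b)) * \<psi> b)
        \<le> C * L2_set (\<lambda>a. cmod (\<phi> a)) S * L2_set (\<lambda>b. cmod (\<psi> b)) T"
      by (intro exI[of _ 0] allI impI op_boundD[OF assms(1) fin st])
  qed
qed

lemma opnorm_tendsto_pointwise:
  assumes "\<And>n. X n \<in> op_bounded G" "f \<in> op_bounded G" "(\<lambda>n::nat. opnorm G (\<lambda>a. X n a - f a)) \<longlonglongrightarrow> 0"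
  shows "(\<lambda>n. X n a) \<longlonglongrightarrow> f a"
proof (rule LIM_zero_cancel, rule Lim_null_comparison[OF _ assms(3)])
  show "\<forall>\<^sub>F n in sequentially. norm (X n a - f a) \<le> opnorm G (\<lambda>a. X n a - f a)"
    using cmod_le_opnorm[OF op_bounded_diff[OF assms(1,2)], of _ a] by (intro always_eventually allI)
qed

text \<open>The limit is found pointwise, using the supremum estimate. With \<open>n\<close> fixed
  and the other index tending to infinity, \<open>op_bound_limit\<close> turns the Cauchy condition
  into a bound for the difference of \<open>X n\<close> and \<open>f\<close>, which yields both
  membership of \<open>f\<close> and convergence in norm.\<close>

lemma opnorm_complete:
  assumes X: "\<And>n. X n \<in> op_bounded G"
    and cauchy: "\<And>e. 0 < e \<Longrightarrow> \<exists>N. \<forall>m\<ge>N. \<forall>n\<ge>N. opnorm G (\<lambda>a. X m a - X n a) < e"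
  obtains f where "f \<in> op_bounded G" "(\<lambda>n::nat. opnorm G (\<lambda>a. X n a - f a)) \<longlonglongrightarrow> 0"
proof -
  have "Cauchy (\<lambda>n. X n a)" for a
  proof (rule CauchyI)
    fix e :: real assume "0 < e"
    then obtain N where "\<forall>m\<ge>N. \<forall>n\<ge>N. opnorm G (\<lambda>a. X m a - X n a) < e" using cauchy by blast
    moreover have "norm (X m a - X n a) \<le> opnorm G (\<lambda>a. X m a - X n a)" for m n
      using cmod_le_opnorm[OF op_bounded_diff[OF X X]] .
    ultimately show "\<exists>M. \<forall>m\<ge>M. \<forall>n\<ge>M. norm (X m a - X n a) < e"
      by (meson order_le_less_trans)
  qed
  then have f: "(\<lambda>n. X n a) \<longlonglongrightarrow> lim (\<lambda>n. X n a)" for a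
    using Cauchy_convergent_iff convergent_LIMSEQ_iff by blast
  define f where "f a = lim (\<lambda>n. X n a)" for a
  note f = f[folded f_def]
  have near: "\<exists>N. \<forall>n\<ge>N. op_bound G (\<lambda>a. X n a - f a) e" if e: "0 < e" for e
  proof -
    obtain N where N: "\<forall>m\<ge>N. \<forall>n\<ge>N. opnorm G (\<lambda>a. X m a - X n a) < e" using cauchy e by blast
    have "op_bound G (\<lambda>a. X n a - f a) e" if "n \<ge> N" for n
    \<comment> \<open>The shift by \<open>N\<close> makes the bound hold for every term of the
      sequence, as \<open>op_bound_limit\<close> requires.\<close>
    proof (rule op_bound_limit[where F = "\<lambda>m a. X n a - X (m + N) a"])
      show "op_bound G (\<lambda>a. X n a - X (m + N) a) e" for m
        using N that by (intro op_bound_le op_bounded_diff X) (simp add: less_imp_le)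
      show "(\<lambda>m. X n a - X (m + N) a) \<longlonglongrightarrow> X n a - f a" for a
        by (intro tendsto_intros LIMSEQ_ignore_initial_segment f)
    qed
    then show ?thesis by blast
  qed
  obtain N where "op_bound G (\<lambda>a. X N a - f a) 1" using near[of 1] by auto
  then have "(\<lambda>a. X N a - (X N a - f a)) \<in> op_bounded G"
    by (intro op_bounded_diff X op_boundedI)
  then have fM: "f \<in> op_bounded G" by simp
  moreover have "(\<lambda>n. opnorm G (\<lambda>a. X n a - f a)) \<longlonglongrightarrow> 0"
  proof (rule LIMSEQ_I)
    fix r :: real assume "0 < r"
    then obtain N where "\<forall>n\<ge>N. op_bound G (\<lambda>a. X n a - f a) (r/2)" using near[of "r/2"] by auto
    then have "\<forall>n\<ge>N. opnorm G (\<lambda>a. X n a - f a) \<le> r/2" using opnorm_le by blast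
    moreover have "0 \<le> opnorm G (\<lambda>a. X n a - f a)" for n
      by (intro opnorm_nonneg op_bounded_diff X fM)
    ultimately show "\<exists>no. \<forall>n\<ge>no. norm (opnorm G (\<lambda>a. X n a - f a) - 0) < r"
      using \<open>0 < r\<close> by (intro exI[of _ N]) (auto simp: order_le_less_trans)
  qed
  ultimately show ?thesis using that by blast
qed

section \<open>The convolution identity and quadratic tests\<close>

lemma unit_fn_div: "src G a = src G b \<Longrightarrow> unit_fn G (gmul G a (ginv G b)) = (if a = b then 1 else 0)"
  using div_unit_iff[of a b] by (simp add: unit_fn_def)

lemma conv_unit_left [simp]: "conv G (unit_fn G) f = f"
proof
  fix c
  have "conv G (unit_fn G) f c = unit_fn G (rng G c) * f (gmul G (ginv G (rng G c)) c)"
    unfolding conv_rng by (rule infsum_single) (auto simp: unit_fn_def)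
  then show "conv G (unit_fn G) f c = f c" by (simp add: unit_fn_def)
qed

lemma conv_unit_right [simp]: "conv G f (unit_fn G) = f"
proof
  fix c
  have "conv G f (unit_fn G) c = f (gmul G c (ginv G (src G c))) * unit_fn G (src G c)"
    unfolding conv_src by (rule infsum_single) (auto simp: unit_fn_def, metis src_rng)
  then show "conv G f (unit_fn G) c = f c" by (simp add: unit_fn_def)
qed

text \<open>Scaling both vectors to norm 1 turns the mean of the squared norms into 1, and
  homogeneity restores the product of the norms; a zero vector is treated apart because it cannot be
  scaled. Schur's test and polarisation produce bounds of this additive form.\<close>

lemma op_boundI_quadratic:
  assumes C: "0 \<le> C"
    and q: "\<And>x S T \<phi> \<psi>. finite S \<Longrightarrow> finite T \<Longrightarrow> (\<And>a. a \<in> S \<Longrightarrow> src G a = x) \<Longrightarrow>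
        (\<And>a. a \<in> T \<Longrightarrow> src G a = x) \<Longrightarrow>
        cmod (\<Sum>a\<in>S. \<Sum>b\<in>T. \<phi> a * f (gmul G a (ginv G b)) * \<psi> b)
          \<le> C * ((\<Sum>a\<in>S. (cmod (\<phi> a))\<^sup>2) + (\<Sum>b\<in>T. (cmod (\<psi> b))\<^sup>2)) / 2"
  shows "op_bound G f C"
proof (rule op_boundI[OF C])
  fix x S T and \<phi> \<psi> :: "'g \<Rightarrow> complex"
  assume fin: "finite S" "finite T" and st: "\<And>a. a \<in> S \<Longrightarrow> src G a = x" "\<And>a. a \<in> T \<Longrightarrow> src G a = x"
  let ?p = "L2_set (\<lambda>a. cmod (\<phi> a)) S" and ?q = "L2_set (\<lambda>b. cmod (\<psi> b)) T"
  let ?F = "\<lambda>\<phi> \<psi>. \<Sum>a\<in>S. \<Sum>b\<in>T. \<phi> a * f (gmul G a (ginv G b)) * \<psi> b"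
  show "cmod (?F \<phi> \<psi>) \<le> C * ?p * ?q"
  proof (cases "?p = 0 \<or> ?q = 0")
    case True
    then have "(\<forall>a\<in>S. \<phi> a = 0) \<or> (\<forall>b\<in>T. \<psi> b = 0)"
      using fin by (simp add: L2_set_eq_0_iff)
    then have "?F \<phi> \<psi> = 0" by auto
    then show ?thesis using C by simp
  next
    case False
    then have p: "?p > 0" and q0: "?q > 0" using L2_set_nonneg by (metis less_eq_real_def)+
    let ?\<phi> = "\<lambda>a. \<phi> a / of_real ?p" and ?\<psi> = "\<lambda>b. \<psi> b / of_real ?q"
    have e: "?F ?\<phi> ?\<psi> = ?F \<phi> \<psi> / (of_real ?p * of_real ?q)"
      by (simp add: sum_divide_distrib)
    have "(\<Sum>a\<in>S. (cmod (?\<phi> a))\<^sup>2) = ?p\<^sup>2 / ?p\<^sup>2"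
      unfolding L2_set_power2[of "\<lambda>a. cmod (\<phi> a)"] by (simp add: norm_divide power_divide sum_divide_distrib[symmetric] L2_set_power2)
    then have 1: "(\<Sum>a\<in>S. (cmod (?\<phi> a))\<^sup>2) = 1" using p by simp
    have "(\<Sum>b\<in>T. (cmod (?\<psi> b))\<^sup>2) = ?q\<^sup>2 / ?q\<^sup>2"
      unfolding L2_set_power2[of "\<lambda>a. cmod (\<psi> a)"] by (simp add: norm_divide power_divide sum_divide_distrib[symmetric] L2_set_power2)
    then have 2: "(\<Sum>b\<in>T. (cmod (?\<psi> b))\<^sup>2) = 1" using q0 by simp
    have "cmod (?F ?\<phi> ?\<psi>) \<le> C" using q[OF fin st, of ?\<phi> ?\<psi>] unfolding 1 2 by simp
    then show ?thesis unfolding e using p q0 by (simp add: norm_divide norm_mult divide_simps mult.assoc)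
  qed
qed

lemma op_bound_unit: "op_bound G (unit_fn G) 1"
proof (rule op_boundI)
  fix x S T and \<phi> \<psi> :: "'g \<Rightarrow> complex"
  assume fin: "finite S" "finite T" and st: "\<And>a. a \<in> S \<Longrightarrow> src G a = x" "\<And>a. a \<in> T \<Longrightarrow> src G a = x"
  have "(\<Sum>a\<in>S. \<Sum>b\<in>T. \<phi> a * unit_fn G (gmul G a (ginv G b)) * \<psi> b) =
      (\<Sum>a\<in>S. \<Sum>b\<in>T. if b = a then \<phi> a * \<psi> a else 0)"
    by (intro sum.cong refl) (auto simp: unit_fn_div st)
  also have "\<dots> = (\<Sum>a\<in>S. if a \<in> T then \<phi> a * \<psi> a else 0)"
    using fin by (intro sum.cong refl) (simp add: sum.delta)
  also have "\<dots> = (\<Sum>a\<in>S\<inter>T. \<phi> a * \<psi> a)"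
    using fin by (simp add: sum.inter_restrict)
  also have "cmod \<dots> \<le> (\<Sum>a\<in>S\<inter>T. \<bar>cmod (\<phi> a)\<bar> * \<bar>cmod (\<psi> a)\<bar>)"
    by (rule norm_sum[THEN order_trans]) (simp add: norm_mult)
  also have "\<dots> \<le> L2_set (\<lambda>a. cmod (\<phi> a)) (S\<inter>T) * L2_set (\<lambda>a. cmod (\<psi> a)) (S\<inter>T)"
    by (rule L2_set_mult_ineq)
  also have "\<dots> \<le> L2_set (\<lambda>a. cmod (\<phi> a)) S * L2_set (\<lambda>a. cmod (\<psi> a)) T"
    by (intro mult_mono) (auto simp: L2_set_def fin intro!: sum_mono2 sum_nonneg)
  finally show "cmod (\<Sum>a\<in>S. \<Sum>b\<in>T. \<phi> a * unit_fn G (gmul G a (ginv G b)) * \<psi> b)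
      \<le> 1 * L2_set (\<lambda>a. cmod (\<phi> a)) S * L2_set (\<lambda>b. cmod (\<psi> b)) T" by simp
qed simp

end

section \<open>Compression to a subgroupoid and positivity\<close>

definition cut :: "'g set \<Rightarrow> ('g \<Rightarrow> complex) \<Rightarrow> 'g \<Rightarrow> complex" where
  "cut H f a = (if a \<in> H then f a else 0)"

definition wide_subgroupoid :: "'g groupoid \<Rightarrow> 'g set \<Rightarrow> bool" where
  "wide_subgroupoid G H \<longleftrightarrow> units G \<subseteq> H \<and> (\<forall>a\<in>H. ginv G a \<in> H) \<and>
     (\<forall>a\<in>H. \<forall>b\<in>H. src G a = rng G b \<longrightarrow> gmul G a b \<in> H)"

text \<open>The double sum is the quadratic form of the regular representation on the fibre over
  \<open>x\<close>. Equating it with \<open>of_real r\<close> expresses at once that it is real and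
  that it is nonnegative.\<close>

definition pos_semidef :: "'g groupoid \<Rightarrow> ('g \<Rightarrow> complex) \<Rightarrow> bool" where
  "pos_semidef G f \<longleftrightarrow> (\<forall>x S \<phi>. finite S \<longrightarrow> S \<subseteq> {a. src G a = x} \<longrightarrow>
     (\<exists>r\<ge>0. (\<Sum>a\<in>S. \<Sum>b\<in>S. cnj (\<phi> a) * f (gmul G a (ginv G b)) * \<phi> b) = of_real r))"

text \<open>Pythagoras: \<open>k\<close> splits \<open>S\<close> into disjoint blocks.\<close>

lemma L2_set_group:
  assumes "finite S" "finite K" "k ` S \<subseteq> K"
  shows "L2_set (\<lambda>y. L2_set f {a \<in> S. k a = y}) K = L2_set f S"
  using sum.group[OF assms, of "\<lambda>a. (f a)\<^sup>2"]
  by (simp add: L2_set_power2 L2_set_def[of "\<lambda>y. L2_set f {a \<in> S. k a = y}"] L2_set_def[of f S])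

context groupoid
begin

lemma pos_semidefD:
  assumes "pos_semidef G f" "finite S" "\<And>a. a \<in> S \<Longrightarrow> src G a = x"
  obtains r where "0 \<le> r" "(\<Sum>a\<in>S. \<Sum>b\<in>S. cnj (\<phi> a) * f (gmul G a (ginv G b)) * \<phi> b) = of_real r"
proof -
  have "S \<subseteq> {a. src G a = x}" using assms(3) by auto
  then have "\<exists>r\<ge>0. (\<Sum>a\<in>S. \<Sum>b\<in>S. cnj (\<phi> a) * f (gmul G a (ginv G b)) * \<phi> b) = of_real r"
    using assms(1,2) unfolding pos_semidef_def by simp
  then show ?thesis using that by blast
qed

text \<open>On a source fibre \<open>a b^{-1} \<in> H\<close> is an equivalence relation, because
  \<open>H\<close> contains the units and is closed under inverses and products. Cutting to
  \<open>H\<close> erases exactly the entries between different classes, so the matrix becomes block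
  diagonal.\<close>

lemma block_decomposition:
  assumes H: "wide_subgroupoid G H" and fin: "finite R" and R: "\<And>a. a \<in> R \<Longrightarrow> src G a = x"
  obtains k :: "'g \<Rightarrow> 'g set" where
    "\<And>S T. S \<subseteq> R \<Longrightarrow> T \<subseteq> R \<Longrightarrow>
      (\<Sum>a\<in>S. \<Sum>b\<in>T. \<phi> a * cut H f (gmul G a (ginv G b)) * (\<psi> b :: complex)) =
      (\<Sum>y\<in>k ` R. \<Sum>a\<in>{a \<in> S. k a = y}. \<Sum>b\<in>{b \<in> T. k b = y}. \<phi> a * f (gmul G a (ginv G b)) * \<psi> b)"
proof -
  \<comment> \<open>Each point is labelled by its entire class within \<open>R\<close>, so that
    equal labels mean equivalent points without a choice of representatives.\<close>
  define k where "k a = {b \<in> R. gmul G a (ginv G b) \<in> H}" for a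
  have sub: "k a \<subseteq> k b" if "a \<in> R" "b \<in> R" "gmul G b (ginv G a) \<in> H" for a b
  proof
    fix c assume "c \<in> k a"
    then have c: "c \<in> R" "gmul G a (ginv G c) \<in> H" by (auto simp: k_def)
    have "gmul G (gmul G b (ginv G a)) (gmul G a (ginv G c)) \<in> H"
    proof -
      have "src G (gmul G b (ginv G a)) = rng G (gmul G a (ginv G c))"
        using R[OF that(1)] R[OF that(2)] R[OF c(1)] by simp
      then show ?thesis using H that(3) c(2) unfolding wide_subgroupoid_def by blast
    qed
    then show "c \<in> k b" using R[OF that(1)] R[OF that(2)] R[OF c(1)] c(1) by (simp add: k_def)
  qed
  have inv: "gmul G b (ginv G a) \<in> H" if "a \<in> R" "b \<in> R" "gmul G a (ginv G b) \<in> H" for a b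
  proof -
    have "ginv G (gmul G a (ginv G b)) \<in> H" using H that(3) unfolding wide_subgroupoid_def by blast
    then show ?thesis using R[OF that(1)] R[OF that(2)] by simp
  qed
  have k_iff: "k b = k a \<longleftrightarrow> gmul G a (ginv G b) \<in> H" if "a \<in> R" "b \<in> R" for a b
  proof
    assume "k b = k a"
    \<comment> \<open>Reflexivity: \<open>b b^{-1}\<close> is the unit
      \<open>rng G b\<close>.\<close>
    moreover have "rng G b \<in> H" using H mem_units_iff unfolding wide_subgroupoid_def by auto
    then have "b \<in> k b" using that by (simp add: k_def)
    ultimately show "gmul G a (ginv G b) \<in> H" by (auto simp: k_def)
  next
    assume "gmul G a (ginv G b) \<in> H"
    then show "k b = k a" using sub[of a b] sub[of b a] inv that by blast
  qed
  show ?thesis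
  proof (rule that[of k])
    fix S T assume ST: "S \<subseteq> R" "T \<subseteq> R"
    then have finS: "finite S" "finite T" using fin finite_subset by auto
    have "(\<Sum>b\<in>T. \<phi> a * cut H f (gmul G a (ginv G b)) * \<psi> b) =
        (\<Sum>b\<in>{b\<in>T. k b = k a}. \<phi> a * f (gmul G a (ginv G b)) * \<psi> b)" if "a \<in> S" for a
    proof -
      have "(\<Sum>b\<in>T. \<phi> a * cut H f (gmul G a (ginv G b)) * \<psi> b) =
        (\<Sum>b\<in>{b\<in>T. k b = k a}. \<phi> a * cut H f (gmul G a (ginv G b)) * \<psi> b)"
        using finS k_iff[of a] that ST by (intro sum.mono_neutral_right) (auto simp: cut_def)
      also have "\<dots> = (\<Sum>b\<in>{b\<in>T. k b = k a}. \<phi> a * f (gmul G a (ginv G b)) * \<psi> b)"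
        using k_iff[of a] that ST by (intro sum.cong) (auto simp: cut_def)
      finally show ?thesis .
    qed
    then have "(\<Sum>a\<in>S. \<Sum>b\<in>T. \<phi> a * cut H f (gmul G a (ginv G b)) * \<psi> b) =
      (\<Sum>a\<in>S. \<Sum>b\<in>{b\<in>T. k b = k a}. \<phi> a * f (gmul G a (ginv G b)) * \<psi> b)"
      by simp
    also have "\<dots> = (\<Sum>y\<in>k ` R. \<Sum>a\<in>{a \<in> S. k a = y}. \<Sum>b\<in>{b\<in>T. k b = k a}. \<phi> a * f (gmul G a (ginv G b)) * \<psi> b)"
      using finS ST fin by (intro sum.group[symmetric]) auto
    also have "\<dots> = (\<Sum>y\<in>k ` R. \<Sum>a\<in>{a \<in> S. k a = y}. \<Sum>b\<in>{b\<in>T. k b = y}. \<phi> a * f (gmul G a (ginv G b)) * \<psi> b)"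
      by (intro sum.cong refl) auto
    finally show "(\<Sum>a\<in>S. \<Sum>b\<in>T. \<phi> a * cut H f (gmul G a (ginv G b)) * \<psi> b) =
      (\<Sum>y\<in>k ` R. \<Sum>a\<in>{a \<in> S. k a = y}. \<Sum>b\<in>{b \<in> T. k b = y}. \<phi> a * f (gmul G a (ginv G b)) * \<psi> b)" .
  qed
qed

text \<open>Each diagonal block obeys the bound \<open>C\<close>, and Cauchy-Schwarz over the blocks
  recombines the block norms through \<open>L2_set_group\<close>.\<close>

lemma op_bound_cut:
  assumes H: "wide_subgroupoid G H" and f: "op_bound G f C"
  shows "op_bound G (cut H f) C"
proof (rule op_boundI)
  show C: "0 \<le> C" using f by (rule op_bound_nonneg)
  fix x S T and \<phi> \<psi> :: "'g \<Rightarrow> complex"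
  assume fin: "finite S" "finite T" and st: "\<And>a. a \<in> S \<Longrightarrow> src G a = x" "\<And>a. a \<in> T \<Longrightarrow> src G a = x"
  have finR: "finite (S \<union> T)" and R: "\<And>a. a \<in> S \<union> T \<Longrightarrow> src G a = x" using fin st by auto
  obtain k :: "'g \<Rightarrow> 'g set" where k: "\<And>S' T'. S' \<subseteq> S \<union> T \<Longrightarrow> T' \<subseteq> S \<union> T \<Longrightarrow>
      (\<Sum>a\<in>S'. \<Sum>b\<in>T'. \<phi> a * cut H f (gmul G a (ginv G b)) * \<psi> b) =
      (\<Sum>y\<in>k ` (S \<union> T). \<Sum>a\<in>{a \<in> S'. k a = y}. \<Sum>b\<in>{b \<in> T'. k b = y}. \<phi> a * f (gmul G a (ginv G b)) * \<psi> b)"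
    by (rule block_decomposition[OF H finR R, where f = f and \<phi> = \<phi> and \<psi> = \<psi>]) (assumption, rule that)
  let ?K = "k ` (S \<union> T)"
  let ?p = "\<lambda>y. L2_set (\<lambda>a. cmod (\<phi> a)) {a \<in> S. k a = y}"
  let ?q = "\<lambda>y. L2_set (\<lambda>a. cmod (\<psi> a)) {a \<in> T. k a = y}"
  have "cmod (\<Sum>a\<in>S. \<Sum>b\<in>T. \<phi> a * cut H f (gmul G a (ginv G b)) * \<psi> b) \<le>
      (\<Sum>y\<in>?K. cmod (\<Sum>a\<in>{a \<in> S. k a = y}. \<Sum>b\<in>{b \<in> T. k b = y}. \<phi> a * f (gmul G a (ginv G b)) * \<psi> b))"
    unfolding k[OF Un_upper1 Un_upper2] by (rule norm_sum)
  also have "\<dots> \<le> (\<Sum>y\<in>?K. C * ?p y * ?q y)"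
    by (intro sum_mono op_boundD[OF f]) (use fin st in auto)
  also have "\<dots> = C * (\<Sum>y\<in>?K. \<bar>?p y\<bar> * \<bar>?q y\<bar>)"
    by (simp add: sum_distrib_left mult.assoc)
  also have "\<dots> \<le> C * (L2_set ?p ?K * L2_set ?q ?K)"
    by (intro mult_left_mono L2_set_mult_ineq C)
  also have "L2_set ?p ?K = L2_set (\<lambda>a. cmod (\<phi> a)) S"
    using fin by (intro L2_set_group) auto
  also have "L2_set ?q ?K = L2_set (\<lambda>a. cmod (\<psi> a)) T"
    using fin by (intro L2_set_group) auto
  finally show "cmod (\<Sum>a\<in>S. \<Sum>b\<in>T. \<phi> a * cut H f (gmul G a (ginv G b)) * \<psi> b)
      \<le> C * L2_set (\<lambda>a. cmod (\<phi> a)) S * L2_set (\<lambda>b. cmod (\<psi> b)) T"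
    by (simp add: mult.assoc)
qed

lemma op_bounded_cut: "wide_subgroupoid G H \<Longrightarrow> f \<in> op_bounded G \<Longrightarrow> cut H f \<in> op_bounded G"
  unfolding op_bounded_iff using op_bound_cut by blast

lemma opnorm_cut: "wide_subgroupoid G H \<Longrightarrow> f \<in> op_bounded G \<Longrightarrow> opnorm G (cut H f) \<le> opnorm G f"
  by (intro opnorm_le op_bound_cut op_bound_opnorm)

lemma pos_semidef_cut:
  assumes H: "wide_subgroupoid G H" and f: "pos_semidef G f"
  shows "pos_semidef G (cut H f)"
  unfolding pos_semidef_def
proof (intro allI impI)
  fix x S and \<phi> :: "'g \<Rightarrow> complex"
  assume fin: "finite S" and S: "S \<subseteq> {a. src G a = x}"
  then have Sx: "\<And>a. a \<in> S \<Longrightarrow> src G a = x" by auto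
  obtain k :: "'g \<Rightarrow> 'g set" where k: "\<And>S' T'. S' \<subseteq> S \<Longrightarrow> T' \<subseteq> S \<Longrightarrow>
      (\<Sum>a\<in>S'. \<Sum>b\<in>T'. cnj (\<phi> a) * cut H f (gmul G a (ginv G b)) * \<phi> b) =
      (\<Sum>y\<in>k ` S. \<Sum>a\<in>{a \<in> S'. k a = y}. \<Sum>b\<in>{b \<in> T'. k b = y}. cnj (\<phi> a) * f (gmul G a (ginv G b)) * \<phi> b)"
    by (rule block_decomposition[OF H fin Sx, where f = f and \<phi> = "\<lambda>a. cnj (\<phi> a)" and \<psi> = \<phi>]) (assumption, rule that)
  have "\<exists>r\<ge>0. (\<Sum>a\<in>{a \<in> S. k a = y}. \<Sum>b\<in>{b \<in> S. k b = y}. cnj (\<phi> a) * f (gmul G a (ginv G b)) * \<phi> b) = of_real r"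
    for y
    using f fin S unfolding pos_semidef_def by (elim allE[of _ x] allE[of _ "{a \<in> S. k a = y}"]) auto
  then obtain r where r: "\<And>y. 0 \<le> r y" "\<And>y. (\<Sum>a\<in>{a \<in> S. k a = y}. \<Sum>b\<in>{b \<in> S. k b = y}.
      cnj (\<phi> a) * f (gmul G a (ginv G b)) * \<phi> b) = complex_of_real (r y)"
    by metis
  show "\<exists>r\<ge>0. (\<Sum>a\<in>S. \<Sum>b\<in>S. cnj (\<phi> a) * cut H f (gmul G a (ginv G b)) * \<phi> b) = of_real r"
    unfolding k[OF subset_refl subset_refl] r(2) of_real_sum[symmetric]
    using r(1) by (intro exI[of _ "sum r (k ` S)"]) (simp add: sum_nonneg)
qed

text \<open>Summing over the intermediate point \<open>d\<close> of the convolution exhibits the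
  form at \<phi> as the sum of the squares of \<open>cmod (?v d)\<close>, where \<open>?v\<close> is
  the image of \<phi> under \<open>f\<close>.\<close>

lemma pos_semidef_star_mult:
  assumes f: "f \<in> op_bounded G"
  shows "pos_semidef G (conv G (invol G f) f)"
  unfolding pos_semidef_def
proof (intro allI impI)
  fix x S and \<phi> :: "'g \<Rightarrow> complex"
  assume fin: "finite S" and S: "S \<subseteq> {a. src G a = x}"
  then have Sx: "\<And>a. a \<in> S \<Longrightarrow> src G a = x" by auto
  let ?s = "\<Sum>a\<in>S. \<Sum>b\<in>S. cnj (\<phi> a) * conv G (invol G f) f (gmul G a (ginv G b)) * \<phi> b"
  let ?v = "\<lambda>d. \<Sum>b\<in>S. f (gmul G d (ginv G b)) * \<phi> b"
  have "((\<lambda>d. \<Sum>a\<in>S. \<Sum>b\<in>S. cnj (\<phi> a) * (invol G f (gmul G a (ginv G d)) * f (gmul G d (ginv G b))) * \<phi> b)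
      has_sum ?s) {d. src G d = x}"
    by (intro has_sum_sum fin has_sum_cmult_left has_sum_cmult_right conv_has_sum op_bounded_invol f Sx)
  moreover have "(\<Sum>a\<in>S. \<Sum>b\<in>S. cnj (\<phi> a) * (invol G f (gmul G a (ginv G d)) * f (gmul G d (ginv G b))) * \<phi> b)
      = of_real ((cmod (?v d))\<^sup>2)" if "d \<in> {d. src G d = x}" for d
  proof -
    have "(\<Sum>a\<in>S. \<Sum>b\<in>S. cnj (\<phi> a) * (invol G f (gmul G a (ginv G d)) * f (gmul G d (ginv G b))) * \<phi> b) =
       cnj (?v d) * ?v d"
      unfolding cnj_sum sum_product using Sx that
      by (intro sum.cong refl) (simp add: invol_def mult_ac)
    then show ?thesis unfolding complex_norm_square by (simp add: mult.commute)
  qed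
  ultimately have hs: "((\<lambda>d. of_real ((cmod (?v d))\<^sup>2)) has_sum ?s) {d. src G d = x}"
    by (rule has_sum_cong[THEN iffD1, rotated])
  have "Im ?s = 0"
    using has_sum_Im[OF hs] has_sum_unique[of "\<lambda>_. 0 :: real", OF _ has_sum_0_simp]
    by (simp del: Im_sum)
  moreover have "0 \<le> Re ?s"
    using has_sum_Re[OF hs] by (rule has_sum_nonneg) simp
  ultimately show "\<exists>r\<ge>0. ?s = of_real r"
    by (intro exI[of _ "Re ?s"]) (simp add: complex_eq_iff del: Re_sum Im_sum)
qed

lemma invol_unit [simp]: "invol G (unit_fn G) = unit_fn G"
proof
  fix c show "invol G (unit_fn G) c = unit_fn G c"
    unfolding invol_def unit_fn_def by simp (metis ginv_ginv ginv_rng ginv_src rng_ginv)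
qed

text \<open>As forms, 0 \<le> a \<le> 1 gives 0 \<le> 1 - a \<le> 1. A positive Hermitian form
  \<open>B\<close> satisfies 2 |B(\<alpha>, \<beta>)| \<le> B(\<alpha>, \<alpha>) + B(\<beta>,
  \<beta>), as expanding B at \<alpha> + z \<beta> for a suitable phase z shows; this is the input
  of \<open>op_boundI_quadratic\<close> with constant 1.\<close>

lemma op_bound_unit_diff:
  assumes pos: "pos_semidef G a" and herm: "invol G a = a" and a1: "op_bound G a 1"
  shows "op_bound G (\<lambda>c. unit_fn G c - a c) 1"
proof (rule op_boundI_quadratic)
  fix x S T and \<phi> \<psi> :: "'g \<Rightarrow> complex"
  assume fin: "finite S" "finite T" and st: "\<And>a. a \<in> S \<Longrightarrow> src G a = x" "\<And>a. a \<in> T \<Longrightarrow> src G a = x"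
  define R where "R = S \<union> T"
  have finR: "finite R" and R: "\<And>a. a \<in> R \<Longrightarrow> src G a = x" using fin st by (auto simp: R_def)
  define u where "u = (\<lambda>c. unit_fn G c - a c)"
  define B where "B \<alpha> \<beta> = (\<Sum>c\<in>R. \<Sum>d\<in>R. cnj (\<alpha> c) * u (gmul G c (ginv G d)) * \<beta> d)"
    for \<alpha> \<beta> :: "'g \<Rightarrow> complex"
  have add_left: "B (\<lambda>c. \<alpha> c + \<alpha>' c) \<beta> = B \<alpha> \<beta> + B \<alpha>' \<beta>" for \<alpha> \<alpha>' \<beta>
    by (simp add: B_def algebra_simps sum.distrib)
  have add_right: "B \<beta> (\<lambda>c. \<alpha> c + \<alpha>' c) = B \<beta> \<alpha> + B \<beta> \<alpha>'" for \<alpha> \<alpha>' \<beta>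
    by (simp add: B_def algebra_simps sum.distrib)
  have scale_left: "B (\<lambda>c. z * \<alpha> c) \<beta> = cnj z * B \<alpha> \<beta>" for \<alpha> \<beta> z
    by (simp add: B_def sum_distrib_left mult.assoc mult.left_commute)
  have scale_right: "B \<beta> (\<lambda>c. z * \<alpha> c) = z * B \<beta> \<alpha>" for \<alpha> \<beta> z
    by (simp add: B_def sum_distrib_left mult.assoc mult.left_commute)
  have "invol G u = u" using herm by (simp add: u_def invol_diff)
  then have u_sym: "cnj (u (gmul G d (ginv G c))) = u (gmul G c (ginv G d))" if "c \<in> R" "d \<in> R" for c d
    using that R unfolding invol_def fun_eq_iff by (metis ginv_div)
  have B_sym: "cnj (B \<beta> \<alpha>) = B \<alpha> \<beta>" for \<alpha> \<beta>
  proof -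
    have "cnj (B \<beta> \<alpha>) = (\<Sum>c\<in>R. \<Sum>d\<in>R. cnj (\<alpha> d) * u (gmul G d (ginv G c)) * \<beta> c)"
      unfolding B_def cnj_sum by (intro sum.cong refl) (simp add: u_sym)
    also have "\<dots> = B \<alpha> \<beta>" unfolding B_def by (rule sum.swap)
    finally show ?thesis .
  qed
  have quad: "\<exists>r. 0 \<le> r \<and> r \<le> (\<Sum>c\<in>R. (cmod (\<alpha> c))\<^sup>2) \<and> B \<alpha> \<alpha> = of_real r" for \<alpha>
  proof -
    let ?n = "\<Sum>c\<in>R. (cmod (\<alpha> c))\<^sup>2"
    obtain r where r: "0 \<le> r" "(\<Sum>c\<in>R. \<Sum>d\<in>R. cnj (\<alpha> c) * a (gmul G c (ginv G d)) * \<alpha> d) = of_real r"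
      by (rule pos_semidefD[OF pos finR R, where \<phi> = \<alpha>]) (assumption, rule that)
    have "B \<alpha> \<alpha> = (\<Sum>c\<in>R. \<Sum>d\<in>R. cnj (\<alpha> c) * unit_fn G (gmul G c (ginv G d)) * \<alpha> d) - of_real r"
      unfolding B_def u_def r(2)[symmetric] by (simp add: algebra_simps sum_subtractf)
    also have "(\<Sum>c\<in>R. \<Sum>d\<in>R. cnj (\<alpha> c) * unit_fn G (gmul G c (ginv G d)) * \<alpha> d) =
        (\<Sum>c\<in>R. \<Sum>d\<in>R. if c = d then cnj (\<alpha> c) * \<alpha> c else 0)"
      by (intro sum.cong refl) (auto simp: unit_fn_div R)
    also have "\<dots> = (\<Sum>c\<in>R. cnj (\<alpha> c) * \<alpha> c)"
      using finR by simp
    also have "\<dots> = of_real ?n"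
      unfolding of_real_sum complex_norm_square by (simp add: mult.commute)
    finally have "B \<alpha> \<alpha> = of_real (?n - r)" by simp
    moreover have "r \<le> ?n"
    proof -
      have "cmod (of_real r) \<le> 1 * L2_set (\<lambda>a. cmod (cnj (\<alpha> a))) R * L2_set (\<lambda>a. cmod (\<alpha> a)) R"
        unfolding r(2)[symmetric] by (rule op_boundD[OF a1 finR finR R R])
      then show ?thesis
        using r(1) by (simp add: L2_set_power2[symmetric]) (simp add: power2_eq_square)
    qed
    ultimately show ?thesis using r(1) by (intro exI[of _ "?n - r"]) auto
  qed
  \<comment> \<open>\<open>B\<close> is conjugate linear in its first argument, so \<phi> enters
    conjugated. Both vectors are extended by zero to the common index set \<open>R\<close>.\<close>
  define \<alpha> where "\<alpha> c = (if c \<in> S then cnj (\<phi> c) else 0)" for c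
  define \<beta> where "\<beta> c = (if c \<in> T then \<psi> c else 0)" for c
  define w where "w = B \<alpha> \<beta>"
  have w_eq: "w = (\<Sum>c\<in>S. \<Sum>d\<in>T. \<phi> c * u (gmul G c (ginv G d)) * \<psi> d)"
  proof -
    have "w = (\<Sum>c\<in>S. \<Sum>d\<in>R. cnj (\<alpha> c) * u (gmul G c (ginv G d)) * \<beta> d)"
      unfolding w_def B_def using finR by (intro sum.mono_neutral_right) (auto simp: R_def \<alpha>_def)
    also have "\<dots> = (\<Sum>c\<in>S. \<Sum>d\<in>T. cnj (\<alpha> c) * u (gmul G c (ginv G d)) * \<beta> d)"
      using finR by (intro sum.cong refl sum.mono_neutral_right) (auto simp: R_def \<beta>_def)
    also have "\<dots> = (\<Sum>c\<in>S. \<Sum>d\<in>T. \<phi> c * u (gmul G c (ginv G d)) * \<psi> d)"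
      by (intro sum.cong refl) (auto simp: \<alpha>_def \<beta>_def)
    finally show ?thesis .
  qed
  have n\<alpha>: "(\<Sum>c\<in>R. (cmod (\<alpha> c))\<^sup>2) = (\<Sum>c\<in>S. (cmod (\<phi> c))\<^sup>2)"
    using finR by (intro sum.mono_neutral_cong_right) (auto simp: R_def \<alpha>_def)
  have n\<beta>: "(\<Sum>c\<in>R. (cmod (\<beta> c))\<^sup>2) = (\<Sum>c\<in>T. (cmod (\<psi> c))\<^sup>2)"
    using finR by (intro sum.mono_neutral_cong_right) (auto simp: R_def \<beta>_def)
  \<comment> \<open>The phase that rotates \<open>w\<close> onto the negative real axis, making the
    cross terms \<open>- 2 * cmod w\<close>; the value 1 at \<open>w = 0\<close> keeps
    \<open>z\<close> unimodular.\<close>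
  define z where "z = (if w = 0 then 1 else - cnj w / of_real (cmod w))"
  have nn: "cnj w * w = of_real (cmod w) * of_real (cmod w)"
    using complex_norm_square[of w] by (simp add: power2_eq_square mult.commute)
  have z1: "cnj z * z = 1"
    using nn by (simp add: z_def divide_simps mult.commute)
  have zw: "z * w = - of_real (cmod w)"
    using nn by (simp add: z_def divide_simps)
  obtain r1 where r1: "r1 \<le> (\<Sum>c\<in>S. (cmod (\<phi> c))\<^sup>2)" "B \<alpha> \<alpha> = of_real r1"
    using quad[of \<alpha>] n\<alpha> by auto
  obtain r2 where r2: "r2 \<le> (\<Sum>c\<in>T. (cmod (\<psi> c))\<^sup>2)" "B \<beta> \<beta> = of_real r2"
    using quad[of \<beta>] n\<beta> by auto
  obtain r3 where r3: "0 \<le> r3" "B (\<lambda>c. \<alpha> c + z * \<beta> c) (\<lambda>c. \<alpha> c + z * \<beta> c) = of_real r3"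
    using quad by blast
  have "of_real r3 = B \<alpha> \<alpha> + z * w + cnj (z * w) + cnj z * z * B \<beta> \<beta>"
    unfolding r3(2)[symmetric] add_left add_right scale_left scale_right w_def
    by (simp add: B_sym algebra_simps)
  also have "\<dots> = of_real (r1 - 2 * cmod w + r2)"
    unfolding zw z1 r1 r2 by simp
  finally have "r3 = r1 - 2 * cmod w + r2" using of_real_eq_iff by blast
  then show "cmod (\<Sum>c\<in>S. \<Sum>d\<in>T. \<phi> c * (unit_fn G (gmul G c (ginv G d)) - a (gmul G c (ginv G d))) * \<psi> d)
          \<le> 1 * ((\<Sum>a\<in>S. (cmod (\<phi> a))\<^sup>2) + (\<Sum>b\<in>T. (cmod (\<psi> b))\<^sup>2)) / 2"
    using r1(1) r2(1) r3(1) w_eq unfolding u_def by simp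
qed simp

end

section \<open>Square roots and the reduced norm\<close>

context groupoid
begin

section \<open>Square roots by a majorised iteration\<close>

lemma conv_zero [simp]: "conv G (\<lambda>a. 0) f = (\<lambda>a. 0)" "conv G f (\<lambda>a. 0) = (\<lambda>a. 0)"
  using conv_scale_left[of 0 f f] conv_scale_right[of f 0 f] by simp_all

lemma op_bounded_unit: "unit_fn G \<in> op_bounded G"
  using op_bound_unit by (rule op_boundedI)

primrec sqrt_scalar :: "nat \<Rightarrow> real" where
  "sqrt_scalar 0 = 0"
| "sqrt_scalar (Suc n) = ((sqrt_scalar n)\<^sup>2 + 1) / 2"

lemma sqrt_scalar_bounds: "0 \<le> sqrt_scalar n \<and> sqrt_scalar n \<le> 1"
proof (induction n)
  case (Suc n)
  then have "(sqrt_scalar n)\<^sup>2 \<le> 1" by (simp add: power_le_one)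
  then show ?case by simp
qed simp

lemma sqrt_scalar_incseq: "incseq sqrt_scalar"
proof (rule incseq_SucI)
  fix n
  have "0 \<le> (sqrt_scalar n - 1)\<^sup>2" by simp
  then show "sqrt_scalar n \<le> sqrt_scalar (Suc n)" by (simp add: power2_eq_square algebra_simps)
qed

lemma sqrt_scalar_tendsto: "sqrt_scalar \<longlonglongrightarrow> 1"
proof -
  obtain l where l: "sqrt_scalar \<longlonglongrightarrow> l"
    using incseq_convergent[OF sqrt_scalar_incseq, of 1] sqrt_scalar_bounds by blast
  then have "(\<lambda>n. sqrt_scalar (Suc n)) \<longlonglongrightarrow> (l\<^sup>2 + 1) / 2"
    unfolding sqrt_scalar.simps by (intro tendsto_intros) auto
  then have "l = (l\<^sup>2 + 1) / 2" using LIMSEQ_Suc[OF l] LIMSEQ_unique by blast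
  then have "(l - 1)\<^sup>2 = 0" by (simp add: power2_eq_square algebra_simps)
  then show ?thesis using l by simp
qed

primrec sqrt_step :: "('g \<Rightarrow> complex) \<Rightarrow> nat \<Rightarrow> 'g \<Rightarrow> complex" where
  "sqrt_step a 0 = (\<lambda>c. 0)"
| "sqrt_step a (Suc n) = (\<lambda>c. of_real (sqrt_scalar n) * sqrt_step a n c +
     ((-1/2) * conv G (sqrt_step a n) (sqrt_step a n) c + (1/2) * a c))"

text \<open>With \<open>u = 1 - a\<close> the iteration is \<open>v\<^sub>0 = 0\<close>, \<open>v\<^bsub>n+1\<^esub> = (v\<^sub>n\<^sup>2 + u) / 2\<close>, whose fixed point
  \<open>v\<close> satisfies \<open>(1 - v)\<^sup>2 = a\<close>; the same iteration for scalars with \<open>u = 1\<close> majorises it in norm.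
  Writing \<open>v\<^sub>n = s\<^sub>n - d\<^sub>n\<close> with \<open>s\<^sub>n\<close> the scalar iteration, \<open>d\<^sub>n\<close> is a polynomial in \<open>a\<close> without
  constant term.\<close>

lemma op_sqrt:
  assumes aM: "a \<in> op_bounded G" and pos: "pos_semidef G a" and herm: "invol G a = a"
    and a1: "opnorm G a \<le> 1"
  obtains b where "b \<in> op_bounded G" "invol G b = b" "conv G b b = a"
    "(\<lambda>n. opnorm G (\<lambda>c. sqrt_step a n c - b c)) \<longlonglongrightarrow> 0"
proof -
  define u where "u = (\<lambda>c. unit_fn G c - a c)"
  have u1: "op_bound G u 1"
    unfolding u_def by (rule op_bound_unit_diff[OF pos herm op_bound_le[OF aM a1]])
  note uM = op_boundedI[OF u1]
  let ?d = "sqrt_step a" and ?s = sqrt_scalar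
  define v where "v n = (\<lambda>c. of_real (?s n) * unit_fn G c - ?d n c)" for n
  have dM: "?d n \<in> op_bounded G" for n
    by (induction n) (simp_all only: sqrt_step.simps op_bounded_zero op_bounded_add op_bounded_scale op_bounded_conv aM)
  have vM: "v n \<in> op_bounded G" for n
    unfolding v_def by (intro op_bounded_diff op_bounded_scale op_bounded_unit dM)
  \<comment> \<open>Expanding the square of \<open>v n\<close> shows that \<open>sqrt_step\<close>
    is the recursion for \<open>v\<close> with the multiples of the identity collected in
    \<open>sqrt_scalar\<close>.\<close>
  have v_Suc: "v (Suc n) = (\<lambda>c. (1/2) * (conv G (v n) (v n) c + u c))" for n
  proof -
    have "conv G (v n) (v n) = (\<lambda>c. (?s n)\<^sup>2 * unit_fn G c - 2 * ?s n * ?d n c + conv G (?d n) (?d n) c)"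
      unfolding v_def
      by (subst conv_diff_left, (intro op_bounded_diff op_bounded_scale op_bounded_unit dM)+,
          subst (1 2) conv_diff_right, (intro op_bounded_diff op_bounded_scale op_bounded_unit dM)+)
        (simp only: conv_scale_left conv_scale_right conv_unit_left conv_unit_right,
          simp add: power2_eq_square algebra_simps)
    then show ?thesis
      unfolding v_def[of "Suc n"] u_def by (simp only: sqrt_scalar.simps sqrt_step.simps)
        (simp add: fun_eq_iff field_simps)
  qed
  have v_norm: "opnorm G (v n) \<le> ?s n" for n
  proof (induction n)
    case 0
    then show ?case using opnorm_le[OF op_bound_zero] by (simp add: v_def)
  next
    case (Suc n)
    have "opnorm G (v (Suc n)) \<le> (1/2) * opnorm G (\<lambda>c. conv G (v n) (v n) c + u c)"
      unfolding v_Suc using opnorm_scale_le[OF op_bounded_add[OF op_bounded_conv[OF vM vM] uM], of "1/2" n n] by simp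
    also have "\<dots> \<le> (1/2) * (opnorm G (conv G (v n) (v n)) + opnorm G u)"
      by (intro mult_left_mono opnorm_add op_bounded_conv vM uM) simp
    also have "\<dots> \<le> (1/2) * (?s n * ?s n + 1)"
      using order_trans[OF opnorm_conv[OF vM vM, of n n] mult_mono[OF Suc Suc]] opnorm_le[OF u1]
        sqrt_scalar_bounds[of n] opnorm_nonneg[OF vM]
      by (intro mult_left_mono add_mono) auto
    finally show ?case by (simp add: power2_eq_square)
  qed
  \<comment> \<open>The increments are dominated by those of the scalar iteration, and the latter
    telescope: this gives the Cauchy property.\<close>
  have v_diff: "opnorm G (\<lambda>c. v (Suc n) c - v n c) \<le> ?s (Suc n) - ?s n" for n
  proof (induction n)
    case 0
    have "(\<lambda>c. v (Suc 0) c - v 0 c) = (\<lambda>c. (1/2) * u c)"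
      unfolding v_Suc by (simp add: v_def)
    moreover have "opnorm G (\<lambda>c. (1/2) * u c) \<le> cmod (1/2) * 1"
      by (rule opnorm_le, rule op_bound_scale[OF u1])
    ultimately show ?case by simp
  next
    case (Suc n)
    let ?a = "v (Suc n)" and ?b = "v n"
    have "(\<lambda>c. v (Suc (Suc n)) c - ?a c) = (\<lambda>c. (1/2) * (conv G ?a ?a c - conv G ?b ?b c))"
    proof
      fix c
      have "v (Suc (Suc n)) c = (1/2) * (conv G ?a ?a c + u c)" "v (Suc n) c = (1/2) * (conv G ?b ?b c + u c)"
        using v_Suc[of "Suc n"] v_Suc[of n] by metis+
      then show "v (Suc (Suc n)) c - ?a c = (1/2) * (conv G ?a ?a c - conv G ?b ?b c)"
        by (simp add: algebra_simps)
    qed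
    then have "opnorm G (\<lambda>c. v (Suc (Suc n)) c - ?a c) \<le> (1/2) * opnorm G (\<lambda>c. conv G ?a ?a c - conv G ?b ?b c)"
      using opnorm_scale_le[OF op_bounded_diff[OF op_bounded_conv[OF vM vM] op_bounded_conv[OF vM vM]], of "1/2"] by simp
    \<comment> \<open>This is x x - y y = x (x - y) + (x - y) y in norm; the same identity for the
      scalars turns the bound back into an exact difference of squares.\<close>
    also have "opnorm G (\<lambda>c. conv G ?a ?a c - conv G ?b ?b c) \<le>
       opnorm G ?a * opnorm G (\<lambda>c. ?a c - ?b c) + opnorm G (\<lambda>c. ?a c - ?b c) * opnorm G ?b"
      by (rule opnorm_conv_diff) (rule vM)+
    also have "\<dots> \<le> ?s (Suc n) * (?s (Suc n) - ?s n) + (?s (Suc n) - ?s n) * ?s n"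
      by (intro add_mono mult_mono Suc v_norm opnorm_nonneg op_bounded_diff vM)
        (use sqrt_scalar_bounds incseq_SucD[OF sqrt_scalar_incseq] in auto)
    finally have "opnorm G (\<lambda>c. v (Suc (Suc n)) c - ?a c) \<le>
        (1/2) * (?s (Suc n) * (?s (Suc n) - ?s n) + (?s (Suc n) - ?s n) * ?s n)"
      by (simp del: sqrt_scalar.simps)
    also have "\<dots> = ((?s (Suc n))\<^sup>2 + 1) / 2 - ((?s n)\<^sup>2 + 1) / 2"
      by (simp add: power2_eq_square field_simps del: sqrt_scalar.simps)
    also have "\<dots> = ?s (Suc (Suc n)) - ?s (Suc n)"
      by (simp only: sqrt_scalar.simps)
    finally show ?case .
  qed
  have v_diff': "opnorm G (\<lambda>c. v (n + k) c - v n c) \<le> ?s (n + k) - ?s n" for n k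
  proof (induction k)
    case 0
    then show ?case using opnorm_le[OF op_bound_zero] by simp
  next
    case (Suc k)
    have "opnorm G (\<lambda>c. v (Suc (n + k)) c - v n c) \<le>
        opnorm G (\<lambda>c. v (Suc (n + k)) c - v (n + k) c) + opnorm G (\<lambda>c. v (n + k) c - v n c)"
      by (intro opnorm_triangle vM)
    then show ?case using Suc v_diff[of "n + k"] by (simp del: sqrt_scalar.simps)
  qed
  have cauchy: "\<exists>N. \<forall>m\<ge>N. \<forall>n\<ge>N. opnorm G (\<lambda>c. v m c - v n c) < e" if "0 < e" for e
  proof -
    have "\<exists>N. \<forall>n\<ge>N. norm (?s n - 1) < e" using LIMSEQ_D[OF sqrt_scalar_tendsto that] .
    then obtain N where N: "\<And>n. n \<ge> N \<Longrightarrow> 1 - ?s n < e" by (metis abs_le_D1 abs_minus_commute order_le_less_trans order_refl real_norm_def)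
    have "opnorm G (\<lambda>c. v m c - v n c) < e" if "m \<ge> n" "n \<ge> N" for m n
      using v_diff'[of n "m - n"] N[OF that(2)] sqrt_scalar_bounds[of m] that by simp
    moreover have "opnorm G (\<lambda>c. v m c - v n c) = opnorm G (\<lambda>c. v n c - v m c)" for m n
      by (rule opnorm_minus_commute[OF vM vM])
    ultimately show ?thesis by (metis nat_le_linear)
  qed
  obtain w where wM: "w \<in> op_bounded G" and w: "(\<lambda>n. opnorm G (\<lambda>c. v n c - w c)) \<longlonglongrightarrow> 0"
    using opnorm_complete[OF vM cauchy] by blast
  have vw: "(\<lambda>n. v n c) \<longlonglongrightarrow> w c" for c by (rule opnorm_tendsto_pointwise[OF vM wM w])
  have "(\<lambda>n. opnorm G (\<lambda>c. conv G (v n) (v n) c - conv G w w c)) \<longlonglongrightarrow> 0"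
  proof (rule tendsto_sandwich[OF _ _ tendsto_const])
    show "\<forall>\<^sub>F n in sequentially. opnorm G (\<lambda>c. conv G (v n) (v n) c - conv G w w c) \<le>
       1 * opnorm G (\<lambda>c. v n c - w c) + opnorm G (\<lambda>c. v n c - w c) * opnorm G w"
    proof (intro always_eventually allI)
      fix n
      have "opnorm G (v n) \<le> 1" using v_norm[of n] sqrt_scalar_bounds[of n] by linarith
      then have "opnorm G (v n) * opnorm G (\<lambda>c. v n c - w c) \<le> 1 * opnorm G (\<lambda>c. v n c - w c)"
        by (intro mult_right_mono opnorm_nonneg op_bounded_diff vM wM)
      then show "opnorm G (\<lambda>c. conv G (v n) (v n) c - conv G w w c) \<le>
         1 * opnorm G (\<lambda>c. v n c - w c) + opnorm G (\<lambda>c. v n c - w c) * opnorm G w"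
        using opnorm_conv_diff[OF vM wM vM wM, of n n] by linarith
    qed
    show "(\<lambda>n. 1 * opnorm G (\<lambda>c. v n c - w c) + opnorm G (\<lambda>c. v n c - w c) * opnorm G w) \<longlonglongrightarrow> 0"
      using w by (auto intro!: tendsto_eq_intros)
    show "\<forall>\<^sub>F n in sequentially. 0 \<le> opnorm G (\<lambda>c. conv G (v n) (v n) c - conv G w w c)"
      by (intro always_eventually allI opnorm_nonneg op_bounded_diff op_bounded_conv vM wM)
  qed
  then have "(\<lambda>n. conv G (v n) (v n) c) \<longlonglongrightarrow> conv G w w c" for c
    by (rule opnorm_tendsto_pointwise[rotated -1]) (intro op_bounded_conv vM wM)+
  then have "(\<lambda>n. v (Suc n) c) \<longlonglongrightarrow> (1/2) * (conv G w w c + u c)" for c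
    unfolding v_Suc by (intro tendsto_intros)
  then have fixed: "w c = (1/2) * (conv G w w c + u c)" for c
    using LIMSEQ_Suc[OF vw] LIMSEQ_unique by blast
  define b where "b = (\<lambda>c. unit_fn G c - w c)"
  have bM: "b \<in> op_bounded G" unfolding b_def by (intro op_bounded_diff op_bounded_unit wM)
  \<comment> \<open>\<open>v n\<close> is \<open>sqrt_scalar n\<close> times the identity minus
    \<open>sqrt_step a n\<close>; the scalars tend to 1 and \<open>v n\<close> tends to
    \<open>w\<close>, so the steps tend to \<open>b\<close>.\<close>
  have d_b: "(\<lambda>n. opnorm G (\<lambda>c. ?d n c - b c)) \<longlonglongrightarrow> 0"
  proof (rule tendsto_sandwich[OF _ _ tendsto_const])
    show "\<forall>\<^sub>F n in sequentially. opnorm G (\<lambda>c. ?d n c - b c) \<le>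
       cmod (of_real (?s n - 1)) * opnorm G (unit_fn G) + opnorm G (\<lambda>c. v n c - w c)"
    proof (intro always_eventually allI)
      fix n
      have "(\<lambda>c. ?d n c - b c) = (\<lambda>c. of_real (?s n - 1) * unit_fn G c + (w c - v n c))"
        by (simp add: v_def b_def algebra_simps)
      then have "opnorm G (\<lambda>c. ?d n c - b c) \<le>
        opnorm G (\<lambda>c. of_real (?s n - 1) * unit_fn G c) + opnorm G (\<lambda>c. w c - v n c)"
        by (simp only: opnorm_add op_bounded_scale op_bounded_unit op_bounded_diff vM wM)
      also have "\<dots> \<le> cmod (of_real (?s n - 1)) * opnorm G (unit_fn G) + opnorm G (\<lambda>c. v n c - w c)"
        unfolding opnorm_minus_commute[OF wM vM]
        by (intro add_mono opnorm_scale_le op_bounded_unit order_refl)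
      finally show "opnorm G (\<lambda>c. ?d n c - b c) \<le>
       cmod (of_real (?s n - 1)) * opnorm G (unit_fn G) + opnorm G (\<lambda>c. v n c - w c)" .
    qed
    have "(\<lambda>n. cmod (of_real (?s n - 1)) * opnorm G (unit_fn G) + opnorm G (\<lambda>c. v n c - w c))
       \<longlonglongrightarrow> cmod (of_real (1 - 1)) * opnorm G (unit_fn G) + 0"
      by (intro tendsto_intros sqrt_scalar_tendsto w)
    then show "(\<lambda>n. cmod (of_real (?s n - 1)) * opnorm G (unit_fn G) + opnorm G (\<lambda>c. v n c - w c)) \<longlonglongrightarrow> 0"
      by simp
    show "\<forall>\<^sub>F n in sequentially. 0 \<le> opnorm G (\<lambda>c. ?d n c - b c)"
      by (intro always_eventually allI opnorm_nonneg op_bounded_diff dM bM)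
  qed
  have d_herm: "invol G (?d n) = ?d n" for n
  proof (induction n)
    case 0
    then show ?case by (simp add: invol_def)
  next
    case (Suc n)
    then show ?case unfolding sqrt_step.simps invol_add invol_scale invol_conv by (simp add: herm)
  qed
  have "invol G b = b"
  proof
    fix c
    have "(\<lambda>n. invol G (?d n) c) \<longlonglongrightarrow> invol G b c"
      unfolding invol_def by (intro tendsto_cnj opnorm_tendsto_pointwise[OF dM bM d_b])
    then show "invol G b c = b c"
      unfolding d_herm using opnorm_tendsto_pointwise[OF dM bM d_b] LIMSEQ_unique by blast
  qed
  moreover have "conv G b b = a"
  proof
    fix c
    have "conv G b b c = unit_fn G c - 2 * w c + conv G w w c"
      unfolding b_def
      by (subst conv_diff_left, (intro op_bounded_diff op_bounded_unit wM)+,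
          subst (1 2) conv_diff_right, (intro op_bounded_unit wM)+) simp
    also have "conv G w w c = 2 * w c - u c"
    proof -
      have "2 * w c = 2 * ((1/2) * (conv G w w c + u c))" using fixed[of c] by (rule arg_cong)
      also have "\<dots> = conv G w w c + u c" by simp
      finally show ?thesis by simp
    qed
    also have "unit_fn G c - 2 * w c + (2 * w c - u c) = a c" by (simp add: u_def)
    finally show "conv G b b c = a c" .
  qed
  ultimately show ?thesis using that bM d_b by blast
qed

section \<open>Regular representations and the reduced norm\<close>

lemma l2_norm_nonneg: "0 \<le> l2_norm G x \<psi>"
  unfolding l2_norm_def by (simp add: infsum_nonneg)

lemma L2_set_le_l2_norm:
  assumes "\<psi> \<in> l2_fibre G x" "finite T" "\<And>b. b \<in> T \<Longrightarrow> src G b = x"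
  shows "L2_set (\<lambda>b. cmod (\<psi> b)) T \<le> l2_norm G x \<psi>"
  unfolding L2_set_def l2_norm_def
  using assms by (intro real_sqrt_le_mono finite_sum_le_infsum) (auto simp: l2_fibre_def)

lemma conv_l2_summable:
  assumes f: "f \<in> op_bounded G" and \<psi>: "\<psi> \<in> l2_fibre G x" and c: "src G c = x"
  shows "((\<lambda>d. f (gmul G c (ginv G d)) * \<psi> d) has_sum conv G f \<psi> c) {d. src G d = x}"
proof -
  have "(\<lambda>d. cmod (f (gmul G c (ginv G d)) * \<psi> d)) summable_on {d. src G d = x}"
  proof (rule nonneg_bdd_above_summable_on)
    show "bdd_above (sum (\<lambda>d. cmod (f (gmul G c (ginv G d)) * \<psi> d)) ` {F. F \<subseteq> {d. src G d = x} \<and> finite F})"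
    proof (rule bdd_aboveI2)
      fix R assume "R \<in> {F. F \<subseteq> {d. src G d = x} \<and> finite F}"
      then have R: "finite R" "\<And>d. d \<in> R \<Longrightarrow> src G d = x" by auto
      have "(\<Sum>d\<in>R. cmod (f (gmul G c (ginv G d)) * \<psi> d)) \<le>
        L2_set (\<lambda>d. cmod (f (gmul G c (ginv G d)))) R * L2_set (\<lambda>d. cmod (\<psi> d)) R"
        using L2_set_mult_ineq[of "\<lambda>d. cmod (f (gmul G c (ginv G d)))" "\<lambda>d. cmod (\<psi> d)" R]
        by (simp add: norm_mult)
      also have "\<dots> \<le> opnorm G f * l2_norm G x \<psi>"
        by (intro mult_mono op_bound_row[OF op_bound_opnorm[OF f] R] L2_set_le_l2_norm[OF \<psi> R])
          (auto simp: c opnorm_nonneg f)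
      finally show "(\<Sum>d\<in>R. cmod (f (gmul G c (ginv G d)) * \<psi> d)) \<le> opnorm G f * l2_norm G x \<psi>" .
    qed
  qed auto
  then show ?thesis
    using c unfolding conv_src by (simp add: abs_summable_summable has_sum_infsum)
qed

text \<open>The output vector again serves as its own test. For square-summable \<psi>, the bound
  holds on finite parts \<open>R\<close> of the fibre and passes to the full sum.\<close>

lemma regular_rep_L2_set:
  assumes f: "f \<in> op_bounded G" and \<psi>: "\<psi> \<in> l2_fibre G x"
    and S: "finite S" "\<And>a. a \<in> S \<Longrightarrow> src G a = x"
  shows "L2_set (\<lambda>a. cmod (regular_rep G x f \<psi> a)) S \<le> opnorm G f * l2_norm G x \<psi>" (is "?n \<le> _")
proof -
  define v where "v a = conv G f \<psi> a" for a
  have n: "?n = L2_set (\<lambda>a. cmod (v a)) S"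
    using S by (intro L2_set_cong) (auto simp: regular_rep_eq v_def)
  have "((\<lambda>d. \<Sum>a\<in>S. cnj (v a) * (f (gmul G a (ginv G d)) * \<psi> d)) has_sum (\<Sum>a\<in>S. cnj (v a) * v a)) {d. src G d = x}"
    unfolding v_def by (intro has_sum_sum has_sum_cmult_right conv_l2_summable f \<psi> S)
  then have "cmod (\<Sum>a\<in>S. cnj (v a) * v a) \<le> ?n * (opnorm G f * l2_norm G x \<psi>)"
  proof (rule has_sum_norm_le)
    fix R assume "finite R" "R \<subseteq> {d. src G d = x}"
    then have R: "finite R" "\<And>d. d \<in> R \<Longrightarrow> src G d = x" by auto
    have "(\<Sum>d\<in>R. \<Sum>a\<in>S. cnj (v a) * (f (gmul G a (ginv G d)) * \<psi> d)) =
        (\<Sum>a\<in>S. \<Sum>d\<in>R. cnj (v a) * f (gmul G a (ginv G d)) * \<psi> d)"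
      by (subst sum.swap) (simp add: mult.assoc)
    also have "cmod \<dots> \<le> opnorm G f * L2_set (\<lambda>a. cmod (cnj (v a))) S * L2_set (\<lambda>d. cmod (\<psi> d)) R"
      by (rule op_boundD[OF op_bound_opnorm[OF f] S(1) R(1) S(2) R(2)])
    also have "\<dots> \<le> opnorm G f * L2_set (\<lambda>a. cmod (cnj (v a))) S * l2_norm G x \<psi>"
      by (intro mult_left_mono L2_set_le_l2_norm[OF \<psi> R] mult_nonneg_nonneg opnorm_nonneg f L2_set_nonneg)
    finally show "cmod (\<Sum>d\<in>R. \<Sum>a\<in>S. cnj (v a) * (f (gmul G a (ginv G d)) * \<psi> d))
        \<le> ?n * (opnorm G f * l2_norm G x \<psi>)"
      unfolding n by (simp only: complex_mod_cnj mult_ac)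
  qed
  also have "(\<Sum>a\<in>S. cnj (v a) * v a) = of_real (?n\<^sup>2)"
    unfolding n L2_set_power2 of_real_sum complex_norm_square by (simp add: mult.commute)
  finally have "?n * ?n \<le> ?n * (opnorm G f * l2_norm G x \<psi>)"
    by (simp only: norm_of_real power2_eq_square abs_mult abs_of_nonneg L2_set_nonneg)
  moreover have "0 \<le> opnorm G f * l2_norm G x \<psi>" by (simp add: opnorm_nonneg f l2_norm_nonneg)
  ultimately show ?thesis
    using L2_set_nonneg by (smt (verit) mult_le_cancel_left_pos)
qed

lemma regular_rep_l2:
  assumes f: "f \<in> op_bounded G" and \<psi>: "\<psi> \<in> l2_fibre G x"
  shows "regular_rep G x f \<psi> \<in> l2_fibre G x"
    and "l2_norm G x (regular_rep G x f \<psi>) \<le> opnorm G f * l2_norm G x \<psi>"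
proof -
  let ?B = "opnorm G f * l2_norm G x \<psi>"
  have B: "0 \<le> ?B" by (simp add: opnorm_nonneg f l2_norm_nonneg)
  have le: "(\<Sum>a\<in>S. (cmod (regular_rep G x f \<psi> a))\<^sup>2) \<le> ?B\<^sup>2"
    if "finite S" "S \<subseteq> {a. src G a = x}" for S
    using power_mono[OF regular_rep_L2_set[OF f \<psi>, of S], of 2] that
    by (auto simp: L2_set_power2)
  then have sm: "(\<lambda>a. (cmod (regular_rep G x f \<psi> a))\<^sup>2) summable_on {a. src G a = x}"
    by (intro nonneg_bdd_above_summable_on bdd_aboveI2[where M = "?B\<^sup>2"]) auto
  then show "regular_rep G x f \<psi> \<in> l2_fibre G x"
    by (simp add: l2_fibre_def regular_rep_eq)
  have "(\<Sum>\<^sub>\<infinity>a\<in>{a. src G a = x}. (cmod (regular_rep G x f \<psi> a))\<^sup>2) \<le> ?B\<^sup>2"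
    by (rule infsum_le_finite_sums[OF sm le])
  then show "l2_norm G x (regular_rep G x f \<psi>) \<le> ?B"
    using B unfolding l2_norm_def[of G x "regular_rep G x f \<psi>"] by (intro real_le_lsqrt)
qed

lemma regular_rep_norm_le:
  assumes f: "f \<in> op_bounded G"
  shows "regular_rep_norm G x f \<le> opnorm G f"
  unfolding regular_rep_norm_def
proof (rule cSUP_least)
  have "(\<lambda>a. 0) \<in> {\<psi> \<in> l2_fibre G x. l2_norm G x \<psi> \<le> 1}"
    by (simp add: l2_fibre_def l2_norm_def)
  then show "{\<psi> \<in> l2_fibre G x. l2_norm G x \<psi> \<le> 1} \<noteq> {}" by blast
  fix \<psi> assume "\<psi> \<in> {\<psi> \<in> l2_fibre G x. l2_norm G x \<psi> \<le> 1}"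
  then show "l2_norm G x (regular_rep G x f \<psi>) \<le> opnorm G f"
    using regular_rep_l2(2)[OF f, of \<psi> x] mult_left_mono[of "l2_norm G x \<psi>" 1 "opnorm G f"]
      opnorm_nonneg[OF f] by auto
qed

text \<open>Bounds on finitely supported vectors extend to square-summable ones, and conversely a
  finite vector extended by zero is a vector of the Hilbert space. So the suprema and the infimum
  measure the same quantity.\<close>

lemma reduced_norm_eq:
  assumes f: "f \<in> op_bounded G"
  shows "reduced_norm G f = opnorm G f"
proof (rule antisym)
  show "reduced_norm G f \<le> opnorm G f"
    unfolding reduced_norm_def by (rule cSUP_least) (auto simp: units_def regular_rep_norm_le f)
  let ?N = "reduced_norm G f"
  have rep_le: "l2_norm G x (regular_rep G x f \<psi>) \<le> ?N"
    if x: "x \<in> units G" and \<psi>: "\<psi> \<in> l2_fibre G x" "l2_norm G x \<psi> \<le> 1" for x \<psi>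
  proof -
    have "l2_norm G x (regular_rep G x f \<psi>) \<le> regular_rep_norm G x f"
      unfolding regular_rep_norm_def
    proof (rule cSUP_upper)
      show "bdd_above ((\<lambda>\<psi>. l2_norm G x (regular_rep G x f \<psi>)) ` {\<psi> \<in> l2_fibre G x. l2_norm G x \<psi> \<le> 1})"
      proof (rule bdd_aboveI2)
        fix \<psi> assume "\<psi> \<in> {\<psi> \<in> l2_fibre G x. l2_norm G x \<psi> \<le> 1}"
        then show "l2_norm G x (regular_rep G x f \<psi>) \<le> opnorm G f"
          using regular_rep_l2(2)[OF f, of \<psi> x] mult_left_mono[of "l2_norm G x \<psi>" 1 "opnorm G f"]
            opnorm_nonneg[OF f] by auto
      qed
    qed (use \<psi> in simp)
    also have "\<dots> \<le> ?N"
      unfolding reduced_norm_def using x regular_rep_norm_le[OF f]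
      by (intro cSUP_upper bdd_aboveI2[where M = "opnorm G f"])
    finally show ?thesis .
  qed
  \<comment> \<open>\<open>src G undefined\<close> is merely some unit; the zero vector there shows
    that the supremum is nonnegative, as \<open>op_boundI\<close> demands.\<close>
  have "(\<lambda>a. 0) \<in> l2_fibre G (src G undefined)" "l2_norm G (src G undefined) (\<lambda>a. 0) \<le> 1"
    by (simp_all add: l2_fibre_def l2_norm_def)
  then have N0: "0 \<le> ?N"
    using rep_le[of "src G undefined" "\<lambda>a. 0"] l2_norm_nonneg order_trans unfolding units_def by blast
  show "opnorm G f \<le> ?N"
  proof (rule opnorm_le, rule op_boundI[OF N0])
    fix x S T and \<phi> \<psi> :: "'g \<Rightarrow> complex"
    assume fin: "finite S" "finite T" and st: "\<And>a. a \<in> S \<Longrightarrow> src G a = x" "\<And>a. a \<in> T \<Longrightarrow> src G a = x"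
    let ?p = "L2_set (\<lambda>a. cmod (\<phi> a)) S" and ?q = "L2_set (\<lambda>b. cmod (\<psi> b)) T"
    let ?F = "\<Sum>a\<in>S. \<Sum>b\<in>T. \<phi> a * f (gmul G a (ginv G b)) * \<psi> b"
    show "cmod ?F \<le> ?N * ?p * ?q"
    proof (cases "?q = 0 \<or> S = {}")
      case True
      then have "(\<forall>b\<in>T. \<psi> b = 0) \<or> S = {}" using fin by (simp add: L2_set_eq_0_iff)
      then have "?F = 0" by auto
      then show ?thesis using N0 by simp
    next
      case False
      then obtain a where "a \<in> S" by auto
      then have x: "x \<in> units G" using st unfolding units_def by auto
      have q: "0 < ?q" using False L2_set_nonneg by (metis less_eq_real_def)
      \<comment> \<open>\<psi> normalised and extended by zero: a unit vector of the fibre space,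
        whose image the reduced norm controls.\<close>
      define \<theta> where "\<theta> b = (if b \<in> T then \<psi> b / of_real ?q else 0)" for b
      have sm: "((\<lambda>b. (cmod (\<theta> b))\<^sup>2) has_sum (\<Sum>b\<in>T. (cmod (\<theta> b))\<^sup>2)) {b. src G b = x}"
      proof (rule has_sum_finite_neutralI[OF fin(2) _ _ refl])
        show "T \<subseteq> {b. src G b = x}" using st(2) by auto
        show "\<And>b. b \<in> {b. src G b = x} - T \<Longrightarrow> (cmod (\<theta> b))\<^sup>2 = 0" by (simp add: \<theta>_def)
      qed
      have "(\<Sum>b\<in>T. (cmod (\<theta> b))\<^sup>2) = (\<Sum>b\<in>T. (cmod (\<psi> b))\<^sup>2) / ?q\<^sup>2"
        unfolding sum_divide_distrib by (intro sum.cong) (auto simp: \<theta>_def norm_divide power_divide)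
      also have "\<dots> = 1" using q by (simp add: L2_set_power2[symmetric])
      finally have "l2_norm G x \<theta> = 1" using sm by (simp add: l2_norm_def infsumI)
      moreover have \<theta>: "\<theta> \<in> l2_fibre G x"
        using has_sum_imp_summable[OF sm] st by (auto simp: l2_fibre_def \<theta>_def)
      ultimately have N: "l2_norm G x (regular_rep G x f \<theta>) \<le> ?N" using rep_le x by simp
      have "(\<Sum>b\<in>T. f (gmul G a (ginv G b)) * \<psi> b) = of_real ?q * regular_rep G x f \<theta> a" if "a \<in> S" for a
      proof -
        have "conv G f \<theta> a = (\<Sum>\<^sub>\<infinity>b\<in>T. f (gmul G a (ginv G b)) * \<theta> b)"
          unfolding conv_src using st that by (intro infsum_cong_neutral) (auto simp: \<theta>_def)
        also have "\<dots> = (\<Sum>b\<in>T. f (gmul G a (ginv G b)) * \<psi> b) / of_real ?q"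
          using fin by (simp add: \<theta>_def sum_divide_distrib)
        finally show ?thesis using st that q by (simp add: regular_rep_eq)
      qed
      then have "?F = (\<Sum>a\<in>S. \<phi> a * (of_real ?q * regular_rep G x f \<theta> a))"
        unfolding mult.assoc sum_distrib_left[symmetric] by simp
      also have "\<dots> = of_real ?q * (\<Sum>a\<in>S. \<phi> a * regular_rep G x f \<theta> a)"
        by (simp add: sum_distrib_left mult.left_commute)
      finally have "cmod ?F = ?q * cmod (\<Sum>a\<in>S. \<phi> a * regular_rep G x f \<theta> a)"
        by (simp add: norm_mult)
      also have "cmod (\<Sum>a\<in>S. \<phi> a * regular_rep G x f \<theta> a) \<le>
          (\<Sum>a\<in>S. \<bar>cmod (\<phi> a)\<bar> * \<bar>cmod (regular_rep G x f \<theta> a)\<bar>)"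
        by (rule norm_sum[THEN order_trans]) (simp add: norm_mult)
      also have "\<dots> \<le> ?p * L2_set (\<lambda>a. cmod (regular_rep G x f \<theta> a)) S"
        by (rule L2_set_mult_ineq)
      also have "\<dots> \<le> ?p * l2_norm G x (regular_rep G x f \<theta>)"
        by (intro mult_left_mono L2_set_le_l2_norm regular_rep_l2 f \<theta> fin st L2_set_nonneg)
      also have "\<dots> \<le> ?p * ?N" by (intro mult_left_mono N L2_set_nonneg)
      finally show ?thesis using q by (simp add: mult_ac)
    qed
  qed
qed

end

section \<open>Compactly supported functions\<close>

text \<open>In a Hausdorff space a compact set outside which \<open>f\<close> vanishes is closed and
  so contains \<open>supp f\<close>. Supports are handled below through any such set.\<close>

lemma compact_supp_iff:
  fixes f :: "'g::t2_space \<Rightarrow> complex"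
  shows "compact (supp f) \<longleftrightarrow> (\<exists>K. compact K \<and> (\<forall>a. a \<notin> K \<longrightarrow> f a = 0))"
proof
  have "f a = 0" if "a \<notin> supp f" for a
    using closure_subset[of "{a. f a \<noteq> 0}"] that unfolding supp_def by auto
  then show "\<exists>K. compact K \<and> (\<forall>a. a \<notin> K \<longrightarrow> f a = 0)" if "compact (supp f)"
    using that by (intro exI[of _ "supp f"]) simp
next
  assume "\<exists>K. compact K \<and> (\<forall>a. a \<notin> K \<longrightarrow> f a = 0)"
  then obtain K where K: "compact K" "\<forall>a. a \<notin> K \<longrightarrow> f a = 0" by (elim exE conjE)
  have "supp f \<subseteq> K"
    unfolding supp_def using K by (intro closure_minimal compact_imp_closed) auto
  then have "K \<inter> supp f = supp f" by auto
  moreover have "closed (supp f)" by (simp add: supp_def)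
  ultimately show "compact (supp f)" using compact_Int_closed[OF K(1)] by metis
qed

lemma bounded_compact_support_iff:
  fixes f :: "'g::t2_space \<Rightarrow> complex"
  shows "f \<in> bounded_compact_support \<longleftrightarrow>
    (\<exists>B. \<forall>a. cmod (f a) \<le> B) \<and> (\<exists>K. compact K \<and> (\<forall>a. a \<notin> K \<longrightarrow> f a = 0))"
  unfolding bounded_compact_support_def compact_supp_iff bounded_iff by simp

lemma continuous_compact_support_iff:
  fixes f :: "'g::t2_space \<Rightarrow> complex"
  shows "f \<in> continuous_compact_support \<longleftrightarrow>
    continuous_on UNIV f \<and> (\<exists>K. compact K \<and> (\<forall>a. a \<notin> K \<longrightarrow> f a = 0))"
  unfolding continuous_compact_support_def compact_supp_iff by simp

lemma bounded_compact_supportI: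
  fixes f :: "'g::t2_space \<Rightarrow> complex"
  shows "compact K \<Longrightarrow> (\<And>a. a \<notin> K \<Longrightarrow> f a = 0) \<Longrightarrow> (\<And>a. cmod (f a) \<le> B) \<Longrightarrow> f \<in> bounded_compact_support"
  unfolding bounded_compact_support_iff by blast

lemma continuous_compact_supportI:
  fixes f :: "'g::t2_space \<Rightarrow> complex"
  shows "continuous_on UNIV f \<Longrightarrow> compact K \<Longrightarrow> (\<And>a. a \<notin> K \<Longrightarrow> f a = 0) \<Longrightarrow> f \<in> continuous_compact_support"
  unfolding continuous_compact_support_iff by blast

lemma bounded_compact_supportE:
  fixes f :: "'g::t2_space \<Rightarrow> complex"
  assumes "f \<in> bounded_compact_support"
  obtains B K where "compact K" "\<forall>a. a \<notin> K \<longrightarrow> f a = 0" "0 \<le> B" "\<forall>a. cmod (f a) \<le> B"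
  using assms unfolding bounded_compact_support_iff by (meson norm_ge_zero order_trans)

lemma continuous_compact_supportE:
  fixes f :: "'g::t2_space \<Rightarrow> complex"
  assumes "f \<in> continuous_compact_support"
  obtains K where "continuous_on UNIV f" "compact K" "\<forall>a. a \<notin> K \<longrightarrow> f a = 0"
  using assms unfolding continuous_compact_support_iff by blast

lemma continuous_compact_support_subset:
  "(continuous_compact_support :: ('g::t2_space \<Rightarrow> complex) set) \<subseteq> bounded_compact_support"
proof
  fix f :: "'g \<Rightarrow> complex" assume "f \<in> continuous_compact_support"
  then obtain K where K: "continuous_on UNIV f" "compact K" "\<forall>a. a \<notin> K \<longrightarrow> f a = 0"
    by (rule continuous_compact_supportE)
  have "compact (f ` K)" using K by (meson compact_continuous_image continuous_on_subset subset_UNIV)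
  then obtain B where "\<And>a. a \<in> K \<Longrightarrow> cmod (f a) \<le> B"
    using compact_imp_bounded bounded_iff by (metis imageI)
  then have "cmod (f a) \<le> max B 0" for a
    using K(3) by (cases "a \<in> K") (auto simp: le_max_iff_disj)
  then show "f \<in> bounded_compact_support" using K unfolding bounded_compact_support_iff by blast
qed

context groupoid
begin

text \<open>Every row and every column has at most \<open>N\<close> nonzero entries, of modulus at
  most \<open>B\<close>. Splitting each product by 2 x y \<le> x^2 + y^2, the first part is summed
  along rows and the second along columns.\<close>

lemma op_bound_schur_test:
  assumes B: "0 \<le> B" "\<And>a. cmod (f a) \<le> B" and K: "\<And>a. a \<notin> K \<Longrightarrow> f a = 0"
    and r: "\<And>x. finite {a \<in> K. rng G a = x} \<and> card {a \<in> K. rng G a = x} \<le> N"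
    and s: "\<And>x. finite {a \<in> K. src G a = x} \<and> card {a \<in> K. src G a = x} \<le> N"
  shows "op_bound G f (B * real N)"
proof (rule op_boundI_quadratic)
  show "0 \<le> B * real N" using B by simp
  fix x S T and \<phi> \<psi> :: "'g \<Rightarrow> complex"
  assume fin: "finite S" "finite T" and st: "\<And>a. a \<in> S \<Longrightarrow> src G a = x" "\<And>a. a \<in> T \<Longrightarrow> src G a = x"
  define \<kappa> where "\<kappa> a b = (if gmul G a (ginv G b) \<in> K then 1 else 0 :: real)" for a b
  let ?F = "\<Sum>a\<in>S. \<Sum>b\<in>T. \<phi> a * f (gmul G a (ginv G b)) * \<psi> b"
  have row: "(\<Sum>b\<in>T. \<kappa> a b) \<le> real N" if a: "a \<in> S" for a
  proof -
    have "(\<Sum>b\<in>T. \<kappa> a b) = real (card {b \<in> T. gmul G a (ginv G b) \<in> K})"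
      unfolding \<kappa>_def by (subst sum.inter_filter[symmetric]) (auto simp: fin)
    \<comment> \<open>\<open>b\<close> is recovered from \<open>a b^{-1}\<close>, so the nonzero
      entries of row \<open>a\<close> inject into the range fibre of \<open>K\<close> at
      \<open>rng G a\<close>; columns inject into source fibres likewise.\<close>
    also have "card {b \<in> T. gmul G a (ginv G b) \<in> K} \<le> card {c \<in> K. rng G c = rng G a}"
    proof (rule card_inj_on_le)
      show "inj_on (\<lambda>b. gmul G a (ginv G b)) {b \<in> T. gmul G a (ginv G b) \<in> K}"
        by (rule inj_on_inverseI[where g = "\<lambda>c. gmul G (ginv G c) a"]) (use st a in simp)
    qed (use st a r in auto)
    also have "\<dots> \<le> N" using r by blast
    finally show ?thesis by simp
  qed
  have col: "(\<Sum>a\<in>S. \<kappa> a b) \<le> real N" if b: "b \<in> T" for b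
  proof -
    have "(\<Sum>a\<in>S. \<kappa> a b) = real (card {a \<in> S. gmul G a (ginv G b) \<in> K})"
      unfolding \<kappa>_def by (subst sum.inter_filter[symmetric]) (auto simp: fin)
    also have "card {a \<in> S. gmul G a (ginv G b) \<in> K} \<le> card {c \<in> K. src G c = rng G b}"
    proof (rule card_inj_on_le)
      show "inj_on (\<lambda>a. gmul G a (ginv G b)) {a \<in> S. gmul G a (ginv G b) \<in> K}"
        by (rule inj_on_inverseI[where g = "\<lambda>c. gmul G c b"]) (use st b in simp)
    qed (use st b s in auto)
    also have "\<dots> \<le> N" using s by blast
    finally show ?thesis by simp
  qed
  have term_le: "cmod (\<phi> a * f (gmul G a (ginv G b)) * \<psi> b) \<le>
      B / 2 * ((cmod (\<phi> a))\<^sup>2 * \<kappa> a b) + B / 2 * ((cmod (\<psi> b))\<^sup>2 * \<kappa> a b)" for a b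
  proof (cases "gmul G a (ginv G b) \<in> K")
    case True
    have "2 * (cmod (\<phi> a) * cmod (\<psi> b)) \<le> (cmod (\<phi> a))\<^sup>2 + (cmod (\<psi> b))\<^sup>2"
      using sum_squares_bound[of "cmod (\<phi> a)" "cmod (\<psi> b)"] by (simp add: mult.assoc)
    then have "B * (cmod (\<phi> a) * cmod (\<psi> b)) \<le> B * (((cmod (\<phi> a))\<^sup>2 + (cmod (\<psi> b))\<^sup>2) / 2)"
      using B(1) by (intro mult_left_mono) auto
    moreover have "cmod (\<phi> a * f (gmul G a (ginv G b)) * \<psi> b) \<le> B * (cmod (\<phi> a) * cmod (\<psi> b))"
      using mult_right_mono[OF B(2)[of "gmul G a (ginv G b)"], of "cmod (\<phi> a) * cmod (\<psi> b)"]
      by (simp add: norm_mult mult_ac)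
    ultimately show ?thesis using True by (simp add: \<kappa>_def algebra_simps add_divide_distrib)
  next
    case False
    then show ?thesis using K by (simp add: \<kappa>_def)
  qed
  have "cmod ?F \<le> (\<Sum>a\<in>S. \<Sum>b\<in>T. cmod (\<phi> a * f (gmul G a (ginv G b)) * \<psi> b))"
    by (rule order_trans[OF norm_sum]) (intro sum_mono norm_sum)
  also have "\<dots> \<le> (\<Sum>a\<in>S. \<Sum>b\<in>T. B / 2 * ((cmod (\<phi> a))\<^sup>2 * \<kappa> a b) + B / 2 * ((cmod (\<psi> b))\<^sup>2 * \<kappa> a b))"
    by (intro sum_mono term_le)
  also have "\<dots> = B / 2 * (\<Sum>a\<in>S. (cmod (\<phi> a))\<^sup>2 * (\<Sum>b\<in>T. \<kappa> a b)) +
      B / 2 * (\<Sum>a\<in>S. \<Sum>b\<in>T. (cmod (\<psi> b))\<^sup>2 * \<kappa> a b)"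
    by (simp only: sum.distrib sum_distrib_left)
  also have "(\<Sum>a\<in>S. \<Sum>b\<in>T. (cmod (\<psi> b))\<^sup>2 * \<kappa> a b) = (\<Sum>b\<in>T. (cmod (\<psi> b))\<^sup>2 * (\<Sum>a\<in>S. \<kappa> a b))"
    by (subst sum.swap) (simp only: sum_distrib_left)
  also have "B / 2 * (\<Sum>a\<in>S. (cmod (\<phi> a))\<^sup>2 * (\<Sum>b\<in>T. \<kappa> a b)) + B / 2 * (\<Sum>b\<in>T. (cmod (\<psi> b))\<^sup>2 * (\<Sum>a\<in>S. \<kappa> a b))
     \<le> B / 2 * (\<Sum>a\<in>S. (cmod (\<phi> a))\<^sup>2 * real N) + B / 2 * (\<Sum>b\<in>T. (cmod (\<psi> b))\<^sup>2 * real N)"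
    using B(1) by (intro add_mono mult_left_mono sum_mono row col) auto
  also have "\<dots> = B * real N * ((\<Sum>a\<in>S. (cmod (\<phi> a))\<^sup>2) + (\<Sum>b\<in>T. (cmod (\<psi> b))\<^sup>2)) / 2"
    unfolding sum_distrib_right[symmetric] by (simp add: algebra_simps add_divide_distrib)
  finally show "cmod ?F \<le> B * real N * ((\<Sum>a\<in>S. (cmod (\<phi> a))\<^sup>2) + (\<Sum>b\<in>T. (cmod (\<psi> b))\<^sup>2)) / 2" .
qed

lemma conv_rng_finite:
  assumes "\<And>a. a \<notin> K \<Longrightarrow> f a = 0" and "finite {a \<in> K. rng G a = rng G c}"
  shows "conv G f g c = (\<Sum>a\<in>{a \<in> K. rng G a = rng G c}. f a * g (gmul G (ginv G a) c))"
proof -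
  have "conv G f g c = (\<Sum>\<^sub>\<infinity>a\<in>{a \<in> K. rng G a = rng G c}. f a * g (gmul G (ginv G a) c))"
    unfolding conv_rng using assms(1) by (intro infsum_cong_neutral) auto
  then show ?thesis using assms(2) by simp
qed

lemma conv_nonzeroE:
  assumes "conv G f g c \<noteq> 0"
  obtains a b where "f a \<noteq> 0" "g b \<noteq> 0" "src G a = rng G b" "c = gmul G a b"
proof (rule ccontr)
  assume neg: "\<not> thesis"
  have "conv G f g c = 0"
    unfolding conv_def
  proof (rule infsum_0, clarify)
    fix a b assume "src G a = rng G b" "c = gmul G a b"
    then show "f a * g b = 0" using neg that[of a b] by auto
  qed
  then show False using assms by simp
qed

end

context semi_etale_groupoid
begin

section \<open>Units, isotropy and compact sets in a semi etale groupoid\<close>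

lemma continuous_rng: "continuous_on UNIV (rng G)"
proof -
  have "continuous_on UNIV ((\<lambda>(a, b). gmul G a b) \<circ> (\<lambda>a. (a, ginv G a)))"
    by (intro continuous_on_compose continuous_on_Pair continuous_on_id continuous_ginv
        continuous_on_subset[OF continuous_gmul]) auto
  then show ?thesis by (simp add: o_def)
qed

lemma continuous_src: "continuous_on UNIV (src G)"
proof -
  have "continuous_on UNIV (rng G \<circ> ginv G)"
    by (intro continuous_on_compose continuous_ginv continuous_on_subset[OF continuous_rng]) auto
  then show ?thesis by (simp add: o_def)
qed

lemma ex_bisection:
  assumes "open W" "a \<in> W"
  obtains U where "bisection G U" "a \<in> U" "U \<subseteq> W"
  by (rule topological_basisE[OF basis_bisections assms]) (use that in simp)

text \<open>An element and its range have the same range. If both lie in one bisection, injectivity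
  of the range map makes them equal, so the points of \<open>U\<close> whose range lies in
  \<open>U\<close> are units.\<close>

lemma open_units: "open (units G)"
proof (rule Topological_Spaces.openI)
  fix x assume x: "x \<in> units G"
  obtain U where U: "bisection G U" "x \<in> U" by (rule ex_bisection[OF open_UNIV UNIV_I])
  have "open U" using U by (simp add: bisection_def)
  have "open (U \<inter> rng G -` U)"
    using \<open>open U\<close> continuous_rng by (intro open_Int open_vimage)
  moreover have "x \<in> U \<inter> rng G -` U" using x U by (simp add: mem_units_iff)
  moreover have "U \<inter> rng G -` U \<subseteq> units G"
    using U unfolding bisection_def mem_units_iff subset_iff inj_on_def by simp
  ultimately show "\<exists>T. open T \<and> x \<in> T \<and> T \<subseteq> units G" by blast
qed

lemma closed_units: "closed (units G)"
proof -
  have "units G = {a. rng G a = a}" using mem_units_iff by auto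
  then show ?thesis by (simp add: closed_Collect_eq continuous_rng)
qed

lemma closed_isotropy: "closed (isotropy G)"
  unfolding isotropy_def by (intro closed_Collect_eq continuous_rng continuous_src)

lemma closed_composable: "closed {(a, b). src G a = rng G b}"
proof -
  have "closed {p. src G (fst p) = rng G (snd p)}"
    by (intro closed_Collect_eq continuous_on_compose2[OF continuous_src continuous_on_fst]
        continuous_on_compose2[OF continuous_rng continuous_on_snd]) auto
  then show ?thesis by (simp add: case_prod_unfold)
qed

text \<open>Finitely many bisections cover \<open>K\<close>, and each meets a fibre of either map at
  most once; their number therefore bounds all fibres simultaneously. The choice \<open>p\<close> of
  a covering bisection is injective on fibres.\<close>

lemma compact_fibres:
  assumes "compact K"
  shows "\<exists>N::nat. (\<forall>x. finite {a \<in> K. rng G a = x} \<and> card {a \<in> K. rng G a = x} \<le> N) \<and>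
    (\<forall>x. finite {a \<in> K. src G a = x} \<and> card {a \<in> K. src G a = x} \<le> N)"
proof -
  have "K \<subseteq> \<Union> {U. bisection G U}"
  proof
    fix a
    obtain U where "bisection G U" "a \<in> U" by (rule ex_bisection[OF open_UNIV UNIV_I])
    then show "a \<in> \<Union> {U. bisection G U}" by auto
  qed
  then obtain \<U> where \<U>: "\<U> \<subseteq> {U. bisection G U}" "finite \<U>" "K \<subseteq> \<Union>\<U>"
    by (rule compactE[OF assms]) (auto simp: bisection_def)
  define p where "p a = (SOME U. U \<in> \<U> \<and> a \<in> U)" for a
  have p: "p a \<in> \<U>" "a \<in> p a" if "a \<in> K" for a
  proof -
    have "\<exists>U. U \<in> \<U> \<and> a \<in> U" using \<U>(3) that by auto
    from someI_ex[OF this] show "p a \<in> \<U>" "a \<in> p a" unfolding p_def by simp_all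
  qed
  have fib: "finite {a \<in> K. k a = x} \<and> card {a \<in> K. k a = x} \<le> card \<U>"
    if k: "\<And>U. U \<in> \<U> \<Longrightarrow> inj_on k U" for k :: "'g \<Rightarrow> 'g" and x
  proof -
    have inj: "inj_on p {a \<in> K. k a = x}"
    proof (rule inj_onI)
      fix a b assume ab: "a \<in> {a \<in> K. k a = x}" "b \<in> {a \<in> K. k a = x}" "p a = p b"
      then have "a \<in> p a" "b \<in> p a" "p a \<in> \<U>" "k a = k b" using p by auto
      then show "a = b" using k by (metis inj_onD)
    qed
    have sub: "p ` {a \<in> K. k a = x} \<subseteq> \<U>" using p by auto
    show ?thesis
      using inj_on_finite[OF inj sub \<U>(2)] card_inj_on_le[OF inj sub \<U>(2)] by simp
  qed
  show ?thesis
    by (intro exI[of _ "card \<U>"] conjI[OF allI allI] fib) (use \<U>(1) in \<open>auto simp: bisection_def\<close>)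
qed

lemma compact_mult:
  assumes "compact K" "compact L"
  shows "compact {gmul G a b |a b. a \<in> K \<and> b \<in> L \<and> src G a = rng G b}"
proof -
  have "compact (K \<times> L \<inter> {(a, b). src G a = rng G b})"
    by (intro compact_Int_closed compact_Times assms closed_composable)
  then have "compact ((\<lambda>(a, b). gmul G a b) ` (K \<times> L \<inter> {(a, b). src G a = rng G b}))"
    by (intro compact_continuous_image continuous_on_subset[OF continuous_gmul]) auto
  also have "(\<lambda>(a, b). gmul G a b) ` (K \<times> L \<inter> {(a, b). src G a = rng G b}) =
      {gmul G a b |a b. a \<in> K \<and> b \<in> L \<and> src G a = rng G b}"
    by auto
  finally show ?thesis .
qed

lemma compact_ginv: "compact K \<Longrightarrow> compact (ginv G ` K)"
  using continuous_ginv by (meson compact_continuous_image continuous_on_subset subset_UNIV)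

text \<open>The order of quantifiers matters: \<open>N\<close> depends on \<open>K\<close> alone. On
  functions vanishing off a fixed compact set, uniform smallness thus becomes smallness in operator
  norm.\<close>

lemma op_bound_compact:
  assumes "compact K"
  shows "\<exists>N\<ge>0. \<forall>f B. 0 \<le> B \<longrightarrow> (\<forall>a. cmod (f a) \<le> B) \<longrightarrow> (\<forall>a. a \<notin> K \<longrightarrow> f a = 0) \<longrightarrow> op_bound G f (B * N)"
proof -
  obtain N :: nat where N: "\<And>x. finite {a \<in> K. rng G a = x} \<and> card {a \<in> K. rng G a = x} \<le> N"
    "\<And>x. finite {a \<in> K. src G a = x} \<and> card {a \<in> K. src G a = x} \<le> N"
    using compact_fibres[OF assms] by blast
  show ?thesis
    by (intro exI[of _ "real N"] conjI allI impI op_bound_schur_test[where K = K]) (auto simp: N)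
qed

abbreviation Bc_fns :: "('g \<Rightarrow> complex) set" where "Bc_fns \<equiv> bounded_compact_support"
abbreviation Cc_fns :: "('g \<Rightarrow> complex) set" where "Cc_fns \<equiv> continuous_compact_support"

section \<open>The star-algebra of bounded compactly supported functions\<close>

lemma Bc_op_bounded: "f \<in> Bc_fns \<Longrightarrow> f \<in> op_bounded G"
proof (elim bounded_compact_supportE)
  fix B K assume K: "compact K" "\<forall>a. a \<notin> K \<longrightarrow> f a = 0" "0 \<le> B" "\<forall>a. cmod (f a) \<le> B"
  then show "f \<in> op_bounded G" using op_bound_compact[OF K(1)] op_boundedI by blast
qed

lemma Bc_zero: "(\<lambda>a. 0) \<in> Bc_fns"
  by (rule bounded_compact_supportI[of "{}" _ 0]) auto

lemma Bc_add: "f \<in> Bc_fns \<Longrightarrow> g \<in> Bc_fns \<Longrightarrow> (\<lambda>a. f a + g a) \<in> Bc_fns"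
proof (elim bounded_compact_supportE)
  fix B K C L assume "compact K" "\<forall>a. a \<notin> K \<longrightarrow> f a = 0" "\<forall>a. cmod (f a) \<le> B"
    "compact L" "\<forall>a. a \<notin> L \<longrightarrow> g a = 0" "\<forall>a. cmod (g a) \<le> C"
  then show ?thesis
    by (intro bounded_compact_supportI[of "K \<union> L" _ "B + C"] compact_Un norm_triangle_mono) auto
qed

lemma Bc_scale: "f \<in> Bc_fns \<Longrightarrow> (\<lambda>a. z * f a) \<in> Bc_fns"
proof (elim bounded_compact_supportE)
  fix B K assume "compact K" "\<forall>a. a \<notin> K \<longrightarrow> f a = 0" "\<forall>a. cmod (f a) \<le> B"
  then show ?thesis
    by (intro bounded_compact_supportI[of "K" _ "cmod z * B"]) (auto simp: norm_mult mult_left_mono)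
qed

lemma Bc_invol: "f \<in> Bc_fns \<Longrightarrow> invol G f \<in> Bc_fns"
proof (elim bounded_compact_supportE)
  fix B K assume "compact K" and K: "\<forall>a. a \<notin> K \<longrightarrow> f a = 0" and "\<forall>a. cmod (f a) \<le> B"
  moreover have "invol G f a = 0" if "a \<notin> ginv G ` K" for a
  proof -
    have "ginv G a \<notin> K" using that by (metis ginv_ginv imageI)
    then show ?thesis using K by (simp add: invol_def)
  qed
  ultimately show ?thesis
    by (intro bounded_compact_supportI[of "ginv G ` K" _ B] compact_ginv) (auto simp: invol_def)
qed

lemma Bc_conv: "f \<in> Bc_fns \<Longrightarrow> g \<in> Bc_fns \<Longrightarrow> conv G f g \<in> Bc_fns"
proof -
  assume f: "f \<in> Bc_fns" and g: "g \<in> Bc_fns"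
  obtain K where K: "compact K" "\<And>a. a \<notin> K \<Longrightarrow> f a = 0" using f unfolding bounded_compact_support_iff by blast
  obtain L where L: "compact L" "\<And>a. a \<notin> L \<Longrightarrow> g a = 0" using g unfolding bounded_compact_support_iff by blast
  show ?thesis
  proof (rule bounded_compact_supportI[OF compact_mult[OF K(1) L(1)]])
    show "cmod (conv G f g a) \<le> opnorm G (conv G f g)" for a
      by (intro cmod_le_opnorm op_bounded_conv Bc_op_bounded f g)
    fix c assume "c \<notin> {gmul G a b |a b. a \<in> K \<and> b \<in> L \<and> src G a = rng G b}"
    then show "conv G f g c = 0"
      by (rule contrapos_np) (erule conv_nonzeroE, use K(2) L(2) in blast)
  qed
qed

text \<open>Compactness of the supports of the two left factors makes the sums finite, so that they
  can be interchanged after the substitution \<open>d = a b\<close>. The identity is what closes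
  \<open>left_multipliers\<close> under products.\<close>

lemma Bc_conv_assoc:
  assumes f: "f \<in> Bc_fns" and g: "g \<in> Bc_fns"
  shows "conv G (conv G f g) h = conv G f (conv G g h)"
proof
  fix c
  obtain K where K: "compact K" "\<And>a. a \<notin> K \<Longrightarrow> f a = 0" using f unfolding bounded_compact_support_iff by blast
  obtain L where L: "compact L" "\<And>a. a \<notin> L \<Longrightarrow> g a = 0" using g unfolding bounded_compact_support_iff by blast
  define M where "M = {gmul G a b |a b. a \<in> K \<and> b \<in> L \<and> src G a = rng G b}"
  have M: "compact M" unfolding M_def by (rule compact_mult[OF K(1) L(1)])
  have fin: "finite {a \<in> X. rng G a = x}" if "compact X" for X x
    using compact_fibres[OF that] by blast
  have M0: "conv G f g d = 0" if "d \<notin> M" for d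
    using that by (rule contrapos_np) (erule conv_nonzeroE, use K(2) L(2) M_def in blast)
  have inner: "(\<Sum>d\<in>{d \<in> M. rng G d = rng G c}. g (gmul G (ginv G a) d) * h (gmul G (ginv G d) c)) =
      conv G g h (gmul G (ginv G a) c)" if a: "a \<in> K" "rng G a = rng G c" for a
  proof -
    have "conv G g h (gmul G (ginv G a) c) = (\<Sum>b\<in>{b \<in> L. rng G b = src G a}. g b * h (gmul G (ginv G b) (gmul G (ginv G a) c)))"
      using conv_rng_finite[of L g "gmul G (ginv G a) c" h, OF L(2)] fin[OF L(1)] a by simp
    also have "\<dots> = (\<Sum>b\<in>{b \<in> L. rng G b = src G a}. g b * h (gmul G (ginv G (gmul G a b)) c))"
      using a by (intro sum.cong refl) (auto simp: ginv_mult gmul_assoc)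
    also have "\<dots> = (\<Sum>d\<in>gmul G a ` {b \<in> L. rng G b = src G a}. g (gmul G (ginv G a) d) * h (gmul G (ginv G d) c))"
    proof (subst sum.reindex)
      show "inj_on (gmul G a) {b \<in> L. rng G b = src G a}"
        by (rule inj_on_inverseI[where g = "gmul G (ginv G a)"]) simp
    qed (intro sum.cong refl, simp)
    \<comment> \<open>Enlarging the index set to \<open>M\<close> makes it independent of
      \<open>a\<close>, as the interchange of sums requires; the added terms vanish because
      \<open>a^{-1} d\<close> lies outside \<open>L\<close>.\<close>
    also have "\<dots> = (\<Sum>d\<in>{d \<in> M. rng G d = rng G c}. g (gmul G (ginv G a) d) * h (gmul G (ginv G d) c))"
    proof (rule sum.mono_neutral_left)
      show "finite {d \<in> M. rng G d = rng G c}" by (rule fin[OF M])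
      show "gmul G a ` {b \<in> L. rng G b = src G a} \<subseteq> {d \<in> M. rng G d = rng G c}"
        using a unfolding M_def by auto metis
      show "\<forall>d\<in>{d \<in> M. rng G d = rng G c} - gmul G a ` {b \<in> L. rng G b = src G a}.
          g (gmul G (ginv G a) d) * h (gmul G (ginv G d) c) = 0"
      proof
        fix d assume d: "d \<in> {d \<in> M. rng G d = rng G c} - gmul G a ` {b \<in> L. rng G b = src G a}"
        have "gmul G (ginv G a) d \<notin> L"
        proof
          assume "gmul G (ginv G a) d \<in> L"
          then have "gmul G a (gmul G (ginv G a) d) \<in> gmul G a ` {b \<in> L. rng G b = src G a}"
            using d a by (intro imageI) simp
          then show False using d a by simp
        qed
        then show "g (gmul G (ginv G a) d) * h (gmul G (ginv G d) c) = 0" using L(2) by simp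
      qed
    qed
    finally show ?thesis by simp
  qed
  have "conv G (conv G f g) h c =
      (\<Sum>d\<in>{d \<in> M. rng G d = rng G c}. conv G f g d * h (gmul G (ginv G d) c))"
    by (rule conv_rng_finite[OF M0 fin[OF M]])
  also have "\<dots> = (\<Sum>d\<in>{d \<in> M. rng G d = rng G c}. \<Sum>a\<in>{a \<in> K. rng G a = rng G c}.
       f a * (g (gmul G (ginv G a) d) * h (gmul G (ginv G d) c)))"
  proof (intro sum.cong refl)
    fix d assume "d \<in> {d \<in> M. rng G d = rng G c}"
    then show "conv G f g d * h (gmul G (ginv G d) c) = (\<Sum>a\<in>{a \<in> K. rng G a = rng G c}.
       f a * (g (gmul G (ginv G a) d) * h (gmul G (ginv G d) c)))"
      using conv_rng_finite[of K f d g, OF K(2) fin[OF K(1)]] by (simp add: sum_distrib_right mult.assoc)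
  qed
  also have "\<dots> = (\<Sum>a\<in>{a \<in> K. rng G a = rng G c}. f a * conv G g h (gmul G (ginv G a) c))"
    by (subst sum.swap) (auto intro!: sum.cong simp: sum_distrib_left[symmetric] inner)
  also have "\<dots> = conv G f (conv G g h) c"
    by (rule conv_rng_finite[OF K(2) fin[OF K(1)], symmetric])
  finally show "conv G (conv G f g) h c = conv G f (conv G g h) c" .
qed

end

section \<open>Transport of Cartan subalgebras and norm limits\<close>

text \<open>The algebraic half of \<open>cstar_subalgebra\<close>, separated from norm closedness so
  that it also applies to sets whose closure is taken afterwards.\<close>

definition star_closed :: "'a star_algebra \<Rightarrow> 'a set \<Rightarrow> bool" where
  "star_closed A B \<longleftrightarrow> azero A \<in> B \<and> (\<forall>a\<in>B. \<forall>b\<in>B. aplus A a b \<in> B) \<and> (\<forall>z. \<forall>a\<in>B. ascale A z a \<in> B) \<and>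
     (\<forall>a\<in>B. \<forall>b\<in>B. atimes A a b \<in> B) \<and> (\<forall>a\<in>B. astar A a \<in> B)"

lemma star_closedD:
  assumes "star_closed A B"
  shows "azero A \<in> B" "a \<in> B \<Longrightarrow> b \<in> B \<Longrightarrow> aplus A a b \<in> B" "a \<in> B \<Longrightarrow> ascale A z a \<in> B"
    "a \<in> B \<Longrightarrow> b \<in> B \<Longrightarrow> atimes A a b \<in> B" "a \<in> B \<Longrightarrow> astar A a \<in> B"
  using assms unfolding star_closed_def by simp_all

lemma cstar_subalgebra_iff:
  "cstar_subalgebra A B \<longleftrightarrow> B \<subseteq> acarrier A \<and> star_closed A B \<and>
     (\<forall>X. \<forall>a\<in>acarrier A. (\<forall>n. X n \<in> B) \<and> (\<lambda>n. adist A (X n) a) \<longlonglongrightarrow> 0 \<longrightarrow> a \<in> B)"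
  unfolding cstar_subalgebra_def star_closed_def by simp

lemma cstar_subalgebra_closed:
  assumes "cstar_subalgebra A B" "a \<in> acarrier A" "\<And>n. X n \<in> B" "(\<lambda>n. adist A (X n) a) \<longlonglongrightarrow> 0"
  shows "a \<in> B"
  using assms(1)[unfolded cstar_subalgebra_iff, THEN conjunct2, THEN conjunct2, THEN spec[of _ X],
      THEN bspec[OF _ assms(2)]] assms(3,4) by simp

lemma cstar_generated_subalgebra:
  assumes "star_closed A (acarrier A)" "S \<subseteq> acarrier A"
  shows "cstar_subalgebra A (cstar_generated A S)"
proof -
  let ?F = "{B. cstar_subalgebra A B \<and> S \<subseteq> B}"
  have top: "acarrier A \<in> ?F"
    using assms by (simp add: cstar_subalgebra_iff)
  have 1: "star_closed A (\<Inter>?F)"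
    unfolding star_closed_def
    by (intro conjI ballI allI InterI) (auto simp: cstar_subalgebra_iff star_closedD)
  have 2: "a \<in> \<Inter>?F" if "a \<in> acarrier A" "\<forall>n. X n \<in> \<Inter>?F" "(\<lambda>n. adist A (X n) a) \<longlonglongrightarrow> 0" for X a
  proof (rule InterI)
    fix B assume B: "B \<in> ?F"
    then have "\<forall>n. X n \<in> B" using that(2) by auto
    then show "a \<in> B" using B that(1,3) by (simp add: cstar_subalgebra_iff)
  qed
  have 3: "\<Inter>?F \<subseteq> acarrier A" using top by (rule Inter_lower)
  show ?thesis
    unfolding cstar_generated_def
  proof (rule cstar_subalgebra_iff[THEN iffD2], intro conjI allI ballI impI 1 3)
    fix X a assume "a \<in> acarrier A" "(\<forall>n. X n \<in> \<Inter>?F) \<and> (\<lambda>n. adist A (X n) a) \<longlonglongrightarrow> 0"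
    then show "a \<in> \<Inter>?F" by (intro 2[of a X]) simp_all
  qed
qed

lemma cstar_generated_superset: "S \<subseteq> cstar_generated A S"
  unfolding cstar_generated_def by blast

lemma cstar_generated_least: "cstar_subalgebra A B \<Longrightarrow> S \<subseteq> B \<Longrightarrow> cstar_generated A S \<subseteq> B"
  unfolding cstar_generated_def by blast

text \<open>Every clause of \<open>cartan_subalgebra\<close> is invariant under an isometric
  star-isomorphism. This allows the Cauchy classes of the completion to be exchanged for
  functions.\<close>

locale star_iso =
  fixes \<phi> :: "'a \<Rightarrow> 'b" and A :: "'a star_algebra" and A' :: "'b star_algebra"
  assumes closed: "star_closed A (acarrier A)"
    and inj: "inj_on \<phi> (acarrier A)"
    and carrier: "acarrier A' = \<phi> ` acarrier A"
    and zero: "azero A' = \<phi> (azero A)"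
    and plus: "a \<in> acarrier A \<Longrightarrow> b \<in> acarrier A \<Longrightarrow> aplus A' (\<phi> a) (\<phi> b) = \<phi> (aplus A a b)"
    and scale: "a \<in> acarrier A \<Longrightarrow> ascale A' z (\<phi> a) = \<phi> (ascale A z a)"
    and times: "a \<in> acarrier A \<Longrightarrow> b \<in> acarrier A \<Longrightarrow> atimes A' (\<phi> a) (\<phi> b) = \<phi> (atimes A a b)"
    and star: "a \<in> acarrier A \<Longrightarrow> astar A' (\<phi> a) = \<phi> (astar A a)"
    and norm: "a \<in> acarrier A \<Longrightarrow> anorm A' (\<phi> a) = anorm A a"
begin

section \<open>Invariance of the Cartan conditions under isometric star-isomorphism\<close>

lemma mem_iff: "a \<in> acarrier A \<Longrightarrow> B \<subseteq> acarrier A \<Longrightarrow> \<phi> a \<in> \<phi> ` B \<longleftrightarrow> a \<in> B"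
  using inj by (simp add: inj_on_image_mem_iff)

lemma eq_iff: "a \<in> acarrier A \<Longrightarrow> b \<in> acarrier A \<Longrightarrow> \<phi> a = \<phi> b \<longleftrightarrow> a = b"
  using inj by (auto simp: inj_on_def)

lemmas closedD = star_closedD[OF closed]

lemma dist: "a \<in> acarrier A \<Longrightarrow> b \<in> acarrier A \<Longrightarrow> adist A' (\<phi> a) (\<phi> b) = adist A a b"
  unfolding adist_def by (simp add: scale plus norm closedD)

lemma star_closed_image: "B \<subseteq> acarrier A \<Longrightarrow> star_closed A B \<Longrightarrow> star_closed A' (\<phi> ` B)"
  unfolding star_closed_def using zero plus scale times star
  by (simp add: subset_iff)

lemma star_closed_preimage:
  "B' \<subseteq> acarrier A' \<Longrightarrow> star_closed A' B' \<Longrightarrow> star_closed A {a \<in> acarrier A. \<phi> a \<in> B'}"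
  unfolding star_closed_def using zero plus[symmetric] scale[symmetric] times[symmetric] star[symmetric]
  by (simp add: closedD)

lemma cstar_subalgebra_image:
  assumes B: "cstar_subalgebra A B"
  shows "cstar_subalgebra A' (\<phi> ` B)"
proof -
  have sub: "B \<subseteq> acarrier A" using B by (simp add: cstar_subalgebra_iff)
  have "\<phi> a \<in> \<phi> ` B" if a: "a \<in> acarrier A" and X: "\<And>n. X n \<in> \<phi> ` B" "(\<lambda>n. adist A' (X n) (\<phi> a)) \<longlonglongrightarrow> 0" for X a
  proof -
    have "\<forall>n. \<exists>y. y \<in> B \<and> X n = \<phi> y" using X(1) by blast
    then obtain Y where Y: "\<And>n. Y n \<in> B" "\<And>n. X n = \<phi> (Y n)" by metis
    have "(\<lambda>n. adist A (Y n) a) \<longlonglongrightarrow> 0"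
      using X(2) Y(1) sub a by (simp add: Y(2) dist subset_iff)
    then have "a \<in> B" by (rule cstar_subalgebra_closed[OF B a Y(1)])
    then show ?thesis by simp
  qed
  then show ?thesis
    using B star_closed_image[OF sub] sub
    by (auto simp: cstar_subalgebra_iff carrier)
qed

lemma cstar_subalgebra_preimage:
  assumes B: "cstar_subalgebra A' B'"
  shows "cstar_subalgebra A {a \<in> acarrier A. \<phi> a \<in> B'}"
proof -
  have sub: "B' \<subseteq> acarrier A'" "star_closed A' B'" using B by (simp_all add: cstar_subalgebra_iff)
  have "\<phi> a \<in> B'" if a: "a \<in> acarrier A" and X: "\<And>n. X n \<in> acarrier A" "\<And>n. \<phi> (X n) \<in> B'"
      "(\<lambda>n. adist A (X n) a) \<longlonglongrightarrow> 0" for X a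
  proof -
    have "(\<lambda>n. adist A' (\<phi> (X n)) (\<phi> a)) \<longlonglongrightarrow> 0" using X(1,3) a by (simp add: dist)
    moreover have "\<phi> a \<in> acarrier A'" using a carrier by simp
    ultimately show ?thesis using cstar_subalgebra_closed[OF B _ X(2)] by simp
  qed
  then show ?thesis
    using star_closed_preimage[OF sub] by (auto simp: cstar_subalgebra_iff)
qed

lemma image_preimage: "B' \<subseteq> acarrier A' \<Longrightarrow> \<phi> ` {a \<in> acarrier A. \<phi> a \<in> B'} = B'"
  unfolding carrier by blast

text \<open>Images of C*-subalgebras give one inclusion; preimages give the other, since the
  generated subalgebra lies in the preimage of each competitor.\<close>

lemma cstar_generated_image:
  assumes "S \<subseteq> acarrier A"
  shows "cstar_generated A' (\<phi> ` S) = \<phi> ` cstar_generated A S"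
proof
  have gen: "cstar_subalgebra A (cstar_generated A S)"
    by (rule cstar_generated_subalgebra[OF closed assms])
  then show "cstar_generated A' (\<phi> ` S) \<subseteq> \<phi> ` cstar_generated A S"
    by (intro cstar_generated_least cstar_subalgebra_image image_mono cstar_generated_superset)
  show "\<phi> ` cstar_generated A S \<subseteq> cstar_generated A' (\<phi> ` S)"
  proof -
    have "cstar_generated A S \<subseteq> {a \<in> acarrier A. \<phi> a \<in> B'}"
      if B': "cstar_subalgebra A' B'" "\<phi> ` S \<subseteq> B'" for B'
      using assms B'(2) by (intro cstar_generated_least cstar_subalgebra_preimage B'(1)) auto
    then show ?thesis unfolding cstar_generated_def[of A'] by blast
  qed
qed

lemma restrict:
  assumes "cstar_subalgebra A B"
  shows "star_iso \<phi> (A\<lparr>acarrier := B\<rparr>) (A'\<lparr>acarrier := \<phi> ` B\<rparr>)"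
proof -
  have B: "B \<subseteq> acarrier A" "star_closed A B" using assms by (simp_all add: cstar_subalgebra_iff)
  show ?thesis
    using B inj by unfold_locales
      (auto simp: star_closed_def subset_iff zero plus scale times star norm inj_on_subset intro: inj_on_subset)
qed

lemma positive_image: "a \<in> acarrier A \<Longrightarrow> positive A' (\<phi> a) \<longleftrightarrow> positive A a"
  unfolding positive_def carrier by (auto simp: star times closedD eq_iff)

lemma contains_approximate_unit_image:
  assumes D: "D \<subseteq> acarrier A" and au: "contains_approximate_unit A D"
  shows "contains_approximate_unit A' (\<phi> ` D)"
proof -
  obtain F where F: "F \<noteq> bot" and eD: "\<forall>\<^sub>F e in F. e \<in> D \<and> positive A e \<and> anorm A e \<le> 1"
    and lim: "\<And>a. a \<in> acarrier A \<Longrightarrow> ((\<lambda>e. adist A (atimes A e a) a) \<longlongrightarrow> 0) F \<and> ((\<lambda>e. adist A (atimes A a e) a) \<longlongrightarrow> 0) F"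
    using au unfolding contains_approximate_unit_def by blast
  have "\<forall>\<^sub>F e in filtermap \<phi> F. e \<in> \<phi> ` D \<and> positive A' e \<and> anorm A' e \<le> 1"
    unfolding eventually_filtermap
    by (rule eventually_mono[OF eD]) (use D in \<open>auto simp: positive_image norm subset_iff\<close>)
  moreover have "((\<lambda>e. adist A' (atimes A' e (\<phi> a)) (\<phi> a)) \<longlongrightarrow> 0) (filtermap \<phi> F)"
    "((\<lambda>e. adist A' (atimes A' (\<phi> a) e) (\<phi> a)) \<longlongrightarrow> 0) (filtermap \<phi> F)" if a: "a \<in> acarrier A" for a
  proof -
    have "\<forall>\<^sub>F e in F. adist A (atimes A e a) a = adist A' (atimes A' (\<phi> e) (\<phi> a)) (\<phi> a)"
      by (rule eventually_mono[OF eD]) (use D a in \<open>auto simp: times dist closedD subset_iff\<close>)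
    then show "((\<lambda>e. adist A' (atimes A' e (\<phi> a)) (\<phi> a)) \<longlongrightarrow> 0) (filtermap \<phi> F)"
      unfolding filterlim_filtermap using lim[OF a] tendsto_cong by fast
    have "\<forall>\<^sub>F e in F. adist A (atimes A a e) a = adist A' (atimes A' (\<phi> a) (\<phi> e)) (\<phi> a)"
      by (rule eventually_mono[OF eD]) (use D a in \<open>auto simp: times dist closedD subset_iff\<close>)
    then show "((\<lambda>e. adist A' (atimes A' (\<phi> a) e) (\<phi> a)) \<longlongrightarrow> 0) (filtermap \<phi> F)"
      unfolding filterlim_filtermap using lim[OF a] tendsto_cong by fast
  qed
  ultimately show ?thesis
    unfolding contains_approximate_unit_def carrier
    using F by (intro exI[of _ "filtermap \<phi> F"]) (auto simp: filtermap_bot_iff)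
qed

lemma abelian_image: "B \<subseteq> acarrier A \<Longrightarrow> abelian A B \<Longrightarrow> abelian A' (\<phi> ` B)"
  unfolding abelian_def by (simp add: times subset_iff)

lemma maximal_abelian_image:
  assumes "maximal_abelian A D"
  shows "maximal_abelian A' (\<phi> ` D)"
proof -
  have D: "cstar_subalgebra A D" "abelian A D" "D \<subseteq> acarrier A"
    and max: "\<And>E. cstar_subalgebra A E \<Longrightarrow> abelian A E \<Longrightarrow> D \<subseteq> E \<Longrightarrow> E = D"
    using assms unfolding maximal_abelian_def by (simp_all add: cstar_subalgebra_iff)
  have "E' = \<phi> ` D" if E': "cstar_subalgebra A' E'" "abelian A' E'" "\<phi> ` D \<subseteq> E'" for E'
  proof -
    let ?E = "{a \<in> acarrier A. \<phi> a \<in> E'}"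
    have "abelian A ?E"
      unfolding abelian_def
    proof (intro ballI)
      fix a b assume ab: "a \<in> ?E" "b \<in> ?E"
      then have "\<phi> (atimes A a b) = \<phi> (atimes A b a)"
        using E'(2) by (simp add: abelian_def times[symmetric])
      then show "atimes A a b = atimes A b a" using ab by (simp add: eq_iff closedD)
    qed
    then have "?E = D" using D E' by (intro max cstar_subalgebra_preimage) auto
    moreover have "E' \<subseteq> acarrier A'" using E' by (simp add: cstar_subalgebra_def)
    ultimately show ?thesis using image_preimage by metis
  qed
  then show ?thesis
    unfolding maximal_abelian_def
    using cstar_subalgebra_image[OF D(1)] abelian_image[OF D(3,2)] by simp
qed

lemma normalizers_image:
  assumes D: "D \<subseteq> acarrier A"
  shows "normalizers A' (\<phi> ` D) = \<phi> ` normalizers A D"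
proof -
  have "\<phi> a \<in> normalizers A' (\<phi> ` D) \<longleftrightarrow> a \<in> normalizers A D" if a: "a \<in> acarrier A" for a
  proof -
    have "atimes A' (atimes A' (astar A' (\<phi> a)) (\<phi> d)) (\<phi> a) \<in> \<phi> ` D \<longleftrightarrow> atimes A (atimes A (astar A a) d) a \<in> D"
      "atimes A' (atimes A' (\<phi> a) (\<phi> d)) (astar A' (\<phi> a)) \<in> \<phi> ` D \<longleftrightarrow> atimes A (atimes A a d) (astar A a) \<in> D"
      if "d \<in> D" for d
      using that a D by (simp_all add: star times closedD mem_iff subset_iff)
    then show ?thesis using a unfolding normalizers_def by (simp add: carrier)
  qed
  moreover have "normalizers A' (\<phi> ` D) \<subseteq> \<phi> ` acarrier A" "normalizers A D \<subseteq> acarrier A"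
    unfolding normalizers_def carrier by auto
  ultimately show ?thesis by blast
qed

lemma regular_image: "D \<subseteq> acarrier A \<Longrightarrow> regular A D \<Longrightarrow> regular A' (\<phi> ` D)"
proof -
  assume D: "D \<subseteq> acarrier A" and reg: "regular A D"
  have "normalizers A D \<subseteq> acarrier A" by (auto simp: normalizers_def)
  then show "regular A' (\<phi> ` D)"
    using reg unfolding regular_def by (simp add: normalizers_image[OF D] cstar_generated_image carrier)
qed

lemma conditional_expectation_image:
  assumes D: "D \<subseteq> acarrier A" and E: "conditional_expectation A D E" "faithful A E"
  shows "\<exists>E'. conditional_expectation A' (\<phi> ` D) E' \<and> faithful A' E'"
proof -
  define \<psi> where "\<psi> = inv_into (acarrier A) \<phi>"
  have \<psi>: "\<psi> (\<phi> a) = a" if "a \<in> acarrier A" for a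
    unfolding \<psi>_def using inj that by simp
  define E' where "E' a = \<phi> (E (\<psi> a))" for a
  have E': "E' (\<phi> a) = \<phi> (E a)" if "a \<in> acarrier A" for a
    using that by (simp add: E'_def \<psi>)
  note ce = E(1)[unfolded conditional_expectation_def]
  have ED: "E a \<in> D" "E a \<in> acarrier A" if "a \<in> acarrier A" for a
    using ce that D by auto
  have Dc: "d \<in> acarrier A" if "d \<in> D" for d using D that by auto
  have "conditional_expectation A' (\<phi> ` D) E'"
    unfolding conditional_expectation_def carrier ball_simps
    using ce D by (simp add: E' ED plus scale times norm positive_image closedD Dc)
  moreover have "faithful A' E'"
    using E(2) unfolding faithful_def carrier ball_simps
    by (simp add: E' ED times star zero closedD eq_iff)
  ultimately show ?thesis by blast
qed

lemma cartan_subalgebra_image: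
  assumes "cartan_subalgebra A D"
  shows "cartan_subalgebra A' (\<phi> ` D)"
proof -
  have D: "D \<subseteq> acarrier A"
    using assms by (simp add: cartan_subalgebra_def maximal_abelian_def cstar_subalgebra_def)
  show ?thesis
    using assms D contains_approximate_unit_image maximal_abelian_image regular_image
      conditional_expectation_image
    unfolding cartan_subalgebra_def by blast
qed

end

definition oplim :: "'g groupoid \<Rightarrow> (nat \<Rightarrow> 'g \<Rightarrow> complex) \<Rightarrow> ('g \<Rightarrow> complex) \<Rightarrow> bool" where
  "oplim G X f \<longleftrightarrow> f \<in> op_bounded G \<and> (\<forall>n. X n \<in> op_bounded G) \<and> (\<lambda>n. opnorm G (\<lambda>a. X n a - f a)) \<longlonglongrightarrow> 0"

definition op_closure :: "'g groupoid \<Rightarrow> ('g \<Rightarrow> complex) set \<Rightarrow> ('g \<Rightarrow> complex) set" where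
  "op_closure G Q = {f. \<exists>X. (\<forall>n. X n \<in> Q) \<and> oplim G X f}"

text \<open>Carrier and norm are replaced and the operations of \<open>Bc G\<close> are kept:
  \<open>conv\<close> is defined by an infinite sum, so the same formula serves on the norm
  closure.\<close>

definition reg_alg :: "'g::topological_space groupoid \<Rightarrow> ('g \<Rightarrow> complex) star_algebra" where
  "reg_alg G = (Bc G)\<lparr>acarrier := op_closure G bounded_compact_support, anorm := opnorm G\<rparr>"

lemma Bc_simps [simp]: "acarrier (Bc G) = bounded_compact_support" "azero (Bc G) = (\<lambda>a. 0)"
  "aplus (Bc G) f g = (\<lambda>a. f a + g a)" "ascale (Bc G) z f = (\<lambda>a. z * f a)"
  "atimes (Bc G) f g = conv G f g" "astar (Bc G) f = invol G f" "anorm (Bc G) f = reduced_norm G f"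
  by (simp_all add: Bc_def)

lemma reg_alg_simps [simp]: "acarrier (reg_alg G) = op_closure G bounded_compact_support"
  "azero (reg_alg G) = (\<lambda>a. 0)"
  "aplus (reg_alg G) f g = (\<lambda>a. f a + g a)" "ascale (reg_alg G) z f = (\<lambda>a. z * f a)"
  "atimes (reg_alg G) f g = conv G f g" "astar (reg_alg G) f = invol G f" "anorm (reg_alg G) f = opnorm G f"
  by (simp_all add: reg_alg_def)

lemma adist_reg_alg: "adist (reg_alg G) f g = opnorm G (\<lambda>a. f a - g a)"
  by (simp add: adist_def)

context groupoid
begin

section \<open>Limits in operator norm and norm closures\<close>

lemma oplimI:
  assumes "f \<in> op_bounded G" "\<And>n. X n \<in> op_bounded G"
    and "\<And>n. opnorm G (\<lambda>a. X n a - f a) \<le> u n" "u \<longlonglongrightarrow> 0"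
  shows "oplim G X f"
proof -
  have "(\<lambda>n. opnorm G (\<lambda>a. X n a - f a)) \<longlonglongrightarrow> 0"
    using assms(3) opnorm_nonneg[OF op_bounded_diff[OF assms(2,1)]]
    by (intro tendsto_sandwich[OF _ _ tendsto_const assms(4)] always_eventually allI)
  then show ?thesis using assms by (simp add: oplim_def)
qed

lemma oplim_const: "f \<in> op_bounded G \<Longrightarrow> oplim G (\<lambda>n. f) f"
  by (rule oplimI[where u = "\<lambda>n. 0"]) (auto intro: opnorm_le[OF op_bound_zero])

lemma oplim_pointwise: "oplim G X f \<Longrightarrow> (\<lambda>n. X n a) \<longlonglongrightarrow> f a"
  unfolding oplim_def by (blast intro: opnorm_tendsto_pointwise)

lemma oplim_add:
  assumes "oplim G X f" "oplim G Y g"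
  shows "oplim G (\<lambda>n a. X n a + Y n a) (\<lambda>a. f a + g a)"
proof (rule oplimI[where u = "\<lambda>n. opnorm G (\<lambda>a. X n a - f a) + opnorm G (\<lambda>a. Y n a - g a)"])
  fix n
  have "opnorm G (\<lambda>a. (X n a - f a) + (Y n a - g a)) \<le> opnorm G (\<lambda>a. X n a - f a) + opnorm G (\<lambda>a. Y n a - g a)"
    using assms by (intro opnorm_add op_bounded_diff) (auto simp: oplim_def)
  then show "opnorm G (\<lambda>a. X n a + Y n a - (f a + g a)) \<le> opnorm G (\<lambda>a. X n a - f a) + opnorm G (\<lambda>a. Y n a - g a)"
    by (simp add: algebra_simps)
qed (use assms in \<open>auto simp: oplim_def intro!: op_bounded_add tendsto_eq_intros\<close>)

lemma oplim_scale:
  assumes "oplim G X f"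
  shows "oplim G (\<lambda>n a. z * X n a) (\<lambda>a. z * f a)"
proof (rule oplimI[where u = "\<lambda>n. cmod z * opnorm G (\<lambda>a. X n a - f a)"])
  fix n
  have "opnorm G (\<lambda>a. z * (X n a - f a)) \<le> cmod z * opnorm G (\<lambda>a. X n a - f a)"
    using assms by (intro opnorm_scale_le op_bounded_diff) (auto simp: oplim_def)
  then show "opnorm G (\<lambda>a. z * X n a - z * f a) \<le> cmod z * opnorm G (\<lambda>a. X n a - f a)"
    by (simp add: algebra_simps)
qed (use assms in \<open>auto simp: oplim_def intro!: op_bounded_scale tendsto_eq_intros\<close>)

lemma oplim_invol:
  assumes "oplim G X f"
  shows "oplim G (\<lambda>n. invol G (X n)) (invol G f)"
proof (rule oplimI[where u = "\<lambda>n. opnorm G (\<lambda>a. X n a - f a)"])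
  fix n
  show "opnorm G (\<lambda>a. invol G (X n) a - invol G f a) \<le> opnorm G (\<lambda>a. X n a - f a)"
    using assms by (simp add: invol_diff[symmetric] opnorm_invol op_bounded_diff oplim_def)
qed (use assms in \<open>auto simp: oplim_def intro!: op_bounded_invol\<close>)

lemma oplim_cut:
  assumes H: "wide_subgroupoid G H" and X: "oplim G X f"
  shows "oplim G (\<lambda>n. cut H (X n)) (cut H f)"
proof (rule oplimI[where u = "\<lambda>n. opnorm G (\<lambda>a. X n a - f a)"])
  fix n
  have "(\<lambda>a. cut H (X n) a - cut H f a) = cut H (\<lambda>a. X n a - f a)" by (auto simp: cut_def)
  then show "opnorm G (\<lambda>a. cut H (X n) a - cut H f a) \<le> opnorm G (\<lambda>a. X n a - f a)"
    using X by (simp add: opnorm_cut[OF H] op_bounded_diff oplim_def)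
qed (use X in \<open>auto simp: oplim_def intro!: op_bounded_cut[OF H]\<close>)

lemma oplim_norm:
  assumes "oplim G X f"
  shows "(\<lambda>n. opnorm G (X n)) \<longlonglongrightarrow> opnorm G f"
proof (rule LIM_zero_cancel, rule Lim_null_comparison)
  show "\<forall>\<^sub>F n in sequentially. norm (opnorm G (X n) - opnorm G f) \<le> opnorm G (\<lambda>a. X n a - f a)"
  proof (intro always_eventually allI)
    fix n
    have M: "X n \<in> op_bounded G" "f \<in> op_bounded G" using assms by (auto simp: oplim_def)
    have "opnorm G (X n) \<le> opnorm G (\<lambda>a. X n a - f a) + opnorm G f"
      using opnorm_add[OF op_bounded_diff[OF M] M(2)] by simp
    moreover have "opnorm G f \<le> opnorm G (\<lambda>a. f a - X n a) + opnorm G (X n)"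
      using opnorm_add[OF op_bounded_diff[OF M(2,1)] M(1)] by simp
    ultimately show "norm (opnorm G (X n) - opnorm G f) \<le> opnorm G (\<lambda>a. X n a - f a)"
      using opnorm_minus_commute[OF M] by simp
  qed
qed (use assms in \<open>simp add: oplim_def\<close>)

lemma oplim_conv:
  assumes "oplim G X f" "oplim G Y g"
  shows "oplim G (\<lambda>n. conv G (X n) (Y n)) (conv G f g)"
proof (rule oplimI[where u = "\<lambda>n. opnorm G (X n) * opnorm G (\<lambda>a. Y n a - g a) + opnorm G (\<lambda>a. X n a - f a) * opnorm G g"])
  have "(\<lambda>n. opnorm G (X n) * opnorm G (\<lambda>a. Y n a - g a) + opnorm G (\<lambda>a. X n a - f a) * opnorm G g)
     \<longlonglongrightarrow> opnorm G f * 0 + 0 * opnorm G g"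
    using assms by (intro tendsto_intros oplim_norm) (auto simp: oplim_def)
  then show "(\<lambda>n. opnorm G (X n) * opnorm G (\<lambda>a. Y n a - g a) + opnorm G (\<lambda>a. X n a - f a) * opnorm G g) \<longlonglongrightarrow> 0"
    by simp
  show "opnorm G (\<lambda>a. conv G (X n) (Y n) a - conv G f g a)
      \<le> opnorm G (X n) * opnorm G (\<lambda>a. Y n a - g a) + opnorm G (\<lambda>a. X n a - f a) * opnorm G g" for n
    using assms by (intro opnorm_conv_diff) (auto simp: oplim_def)
qed (use assms in \<open>auto simp: oplim_def intro!: op_bounded_conv\<close>)

lemma op_closure_bounded: "f \<in> op_closure G Q \<Longrightarrow> f \<in> op_bounded G"
  by (auto simp: op_closure_def oplim_def)

lemma op_closure_superset: "Q \<subseteq> op_bounded G \<Longrightarrow> Q \<subseteq> op_closure G Q"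
  using oplim_const by (auto simp: op_closure_def subset_iff intro!: exI[of _ "\<lambda>n. _"])

lemma op_closure_mono: "Q \<subseteq> R \<Longrightarrow> op_closure G Q \<subseteq> op_closure G R"
  unfolding op_closure_def by blast

lemma op_closureI:
  assumes f: "f \<in> op_bounded G" and Q: "Q \<subseteq> op_bounded G"
    and e: "\<And>e. 0 < e \<Longrightarrow> \<exists>g\<in>Q. opnorm G (\<lambda>a. g a - f a) < e"
  shows "f \<in> op_closure G Q"
proof -
  have "\<exists>g\<in>Q. opnorm G (\<lambda>a. g a - f a) < inverse (real (Suc n))" for n by (rule e) simp
  then obtain X where X: "\<And>n. X n \<in> Q" "\<And>n. opnorm G (\<lambda>a. X n a - f a) < inverse (real (Suc n))" by metis
  have "oplim G X f"
    using X f Q by (intro oplimI[OF _ _ _ LIMSEQ_inverse_real_of_nat]) (auto intro: less_imp_le)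
  then show ?thesis using X by (auto simp: op_closure_def)
qed

lemma oplim_near: "oplim G X f \<Longrightarrow> 0 < e \<Longrightarrow> \<exists>n. opnorm G (\<lambda>a. X n a - f a) < e"
proof -
  assume "oplim G X f" "0 < e"
  then have "\<exists>N. \<forall>n\<ge>N. norm (opnorm G (\<lambda>a. X n a - f a) - 0) < e"
    by (intro LIMSEQ_D) (simp_all add: oplim_def)
  then obtain N where "norm (opnorm G (\<lambda>a. X N a - f a) - 0) < e" by blast
  then show "\<exists>n. opnorm G (\<lambda>a. X n a - f a) < e" by (intro exI[of _ N]) simp
qed

lemma op_closure_near:
  assumes "f \<in> op_closure G Q" "0 < e"
  shows "\<exists>g\<in>Q. g \<in> op_bounded G \<and> opnorm G (\<lambda>a. g a - f a) < e"
  using assms oplim_near unfolding op_closure_def oplim_def by blast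

lemma op_closure_closed:
  assumes Q: "Q \<subseteq> op_bounded G" and X: "\<And>n. X n \<in> op_closure G Q" "oplim G X f"
  shows "f \<in> op_closure G Q"
proof (rule op_closureI[OF _ Q])
  show f: "f \<in> op_bounded G" using X by (simp add: oplim_def)
  fix e :: real assume e: "0 < e"
  obtain n where n: "opnorm G (\<lambda>a. X n a - f a) < e / 2" using oplim_near[OF X(2), of "e/2"] e by auto
  obtain g where g: "g \<in> Q" "opnorm G (\<lambda>a. g a - X n a) < e / 2"
    using op_closure_near[OF X(1)[of n], of "e/2"] e by auto
  have "opnorm G (\<lambda>a. g a - f a) \<le> opnorm G (\<lambda>a. g a - X n a) + opnorm G (\<lambda>a. X n a - f a)"
    using g Q X by (intro opnorm_triangle f) (auto simp: oplim_def)
  then show "\<exists>g\<in>Q. opnorm G (\<lambda>a. g a - f a) < e" using n g by (intro bexI[of _ g]) auto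
qed

lemma op_closure_star_closed:
  fixes A
  assumes ops: "azero A = (\<lambda>a. 0)" "\<And>f g. aplus A f g = (\<lambda>a. f a + g a)" "\<And>z f. ascale A z f = (\<lambda>a. z * f a)"
    "\<And>f g. atimes A f g = conv G f g" "\<And>f. astar A f = invol G f"
    and Q: "Q \<subseteq> op_bounded G" "star_closed A Q"
  shows "star_closed A (op_closure G Q)"
proof -
  note Qc = star_closedD[OF Q(2), unfolded ops]
  show ?thesis
    unfolding star_closed_def ops
  proof (intro conjI ballI allI)
    show "(\<lambda>a. 0) \<in> op_closure G Q" using op_closure_superset[OF Q(1)] Qc(1) by auto
  next
    fix f g assume "f \<in> op_closure G Q" "g \<in> op_closure G Q"
    then obtain X Y where "\<forall>n. X n \<in> Q" "oplim G X f" "\<forall>n. Y n \<in> Q" "oplim G Y g"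
      unfolding op_closure_def by blast
    note XY = this
    show "(\<lambda>a. f a + g a) \<in> op_closure G Q"
      unfolding op_closure_def mem_Collect_eq using XY Qc(2) oplim_add[of X f Y g]
      by (intro exI[of _ "\<lambda>n a. X n a + Y n a"]) simp
    show "conv G f g \<in> op_closure G Q"
      unfolding op_closure_def mem_Collect_eq using XY Qc(4) oplim_conv[of X f Y g]
      by (intro exI[of _ "\<lambda>n. conv G (X n) (Y n)"]) simp
  next
    fix f z assume "f \<in> op_closure G Q"
    then obtain X where "\<forall>n. X n \<in> Q" "oplim G X f"
      unfolding op_closure_def by blast
    note X = this
    show "(\<lambda>a. z * f a) \<in> op_closure G Q"
      unfolding op_closure_def mem_Collect_eq using X Qc(3) oplim_scale[of X f z]
      by (intro exI[of _ "\<lambda>n a. z * X n a"]) simp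
    show "invol G f \<in> op_closure G Q"
      unfolding op_closure_def mem_Collect_eq using X Qc(5) oplim_invol[of X f]
      by (intro exI[of _ "\<lambda>n. invol G (X n)"]) simp
  qed
qed

end

section \<open>The completion as an algebra of functions\<close>

context semi_etale_groupoid
begin

lemma Bc_subset: "Bc_fns \<subseteq> op_bounded G"
  using Bc_op_bounded by blast

lemma Bc_diff: "f \<in> Bc_fns \<Longrightarrow> g \<in> Bc_fns \<Longrightarrow> (\<lambda>a. f a - g a) \<in> Bc_fns"
  using Bc_add[OF _ Bc_scale[of g "-1"], of f] by simp

lemma star_closed_Bc: "star_closed (reg_alg G) Bc_fns"
  unfolding star_closed_def by (simp add: Bc_zero Bc_add Bc_scale Bc_conv Bc_invol)

lemma star_closed_reg_alg: "star_closed (reg_alg G) (acarrier (reg_alg G))"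
  unfolding reg_alg_simps by (rule op_closure_star_closed[OF _ _ _ _ _ Bc_subset star_closed_Bc]) simp_all

lemma adist_Bc: "f \<in> Bc_fns \<Longrightarrow> g \<in> Bc_fns \<Longrightarrow> adist (Bc G) f g = opnorm G (\<lambda>a. f a - g a)"
  using reduced_norm_eq[OF Bc_op_bounded[OF Bc_diff[of f g]]] by (simp add: adist_def)

text \<open>The element of the completion that corresponds to the function \<open>f\<close>;
  \<open>jmap\<close> recovers \<open>f\<close> from it.\<close>

definition class_of :: "('g \<Rightarrow> complex) \<Rightarrow> (nat \<Rightarrow> 'g \<Rightarrow> complex) set" where
  "class_of f = {X. (\<forall>n. X n \<in> Bc_fns) \<and> oplim G X f}"

lemma oplim_cauchy_seq:
  assumes "\<And>n. X n \<in> Bc_fns" "oplim G X f"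
  shows "cauchy_seq (Bc G) X"
proof -
  have "\<exists>N. \<forall>m\<ge>N. \<forall>n\<ge>N. adist (Bc G) (X m) (X n) < e" if e: "0 < e" for e
  proof -
    have M: "\<And>n. X n \<in> op_bounded G" "f \<in> op_bounded G" using assms(2) by (auto simp: oplim_def)
    have "(\<lambda>n. opnorm G (\<lambda>a. X n a - f a)) \<longlonglongrightarrow> 0" using assms(2) by (simp add: oplim_def)
    then have "\<exists>N. \<forall>n\<ge>N. norm (opnorm G (\<lambda>a. X n a - f a) - 0) < e / 2"
      using e by (intro LIMSEQ_D) auto
    then obtain N where N': "\<forall>n\<ge>N. norm (opnorm G (\<lambda>a. X n a - f a) - 0) < e / 2" by blast
    have N: "opnorm G (\<lambda>a. X n a - f a) < e / 2" if "n \<ge> N" for n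
      using N'[rule_format, OF that] unfolding real_norm_def by linarith
    have "adist (Bc G) (X m) (X n) < e" if "m \<ge> N" "n \<ge> N" for m n
    proof -
      have "adist (Bc G) (X m) (X n) \<le> opnorm G (\<lambda>a. X m a - f a) + opnorm G (\<lambda>a. f a - X n a)"
        unfolding adist_Bc[OF assms(1) assms(1)] by (intro opnorm_triangle M)
      then show ?thesis
        using N[OF that(1)] N[OF that(2)] opnorm_minus_commute[OF M(2) M(1)[of n]] by simp
    qed
    then show ?thesis by blast
  qed
  then show ?thesis using assms(1) by (simp add: cauchy_seq_def)
qed

lemma cauchy_seq_oplim:
  assumes "cauchy_seq (Bc G) X"
  shows "\<exists>f. oplim G X f"
proof -
  have X: "\<And>n. X n \<in> Bc_fns" and c: "\<And>e. 0 < e \<Longrightarrow> \<exists>N. \<forall>m\<ge>N. \<forall>n\<ge>N. adist (Bc G) (X m) (X n) < e"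
    using assms by (auto simp: cauchy_seq_def)
  have M: "\<And>n. X n \<in> op_bounded G" using X by (rule Bc_op_bounded)
  have "\<exists>N. \<forall>m\<ge>N. \<forall>n\<ge>N. opnorm G (\<lambda>a. X m a - X n a) < e" if "0 < e" for e
    using c[OF that] unfolding adist_Bc[OF X X] .
  then obtain f where "f \<in> op_bounded G" "(\<lambda>n. opnorm G (\<lambda>a. X n a - f a)) \<longlonglongrightarrow> 0"
    by (rule opnorm_complete[OF M])
  then show ?thesis using M by (auto simp: oplim_def)
qed

text \<open>By the triangle inequality, two sequences are equivalent exactly if they have the same
  limit function. A class is thus determined by that limit.\<close>

lemma cauchy_class_eq:
  assumes X: "\<And>n. X n \<in> Bc_fns" "oplim G X f"
  shows "cauchy_class (Bc G) X = class_of f"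
proof -
  have lim: "(\<lambda>n. adist (Bc G) (X n) (Y n)) \<longlonglongrightarrow> 0 \<longleftrightarrow> oplim G Y f" if Y: "\<And>n. Y n \<in> Bc_fns" for Y
  proof -
    have M: "\<And>n. X n \<in> op_bounded G" "\<And>n. Y n \<in> op_bounded G" "f \<in> op_bounded G"
      using X Y by (auto simp: oplim_def Bc_op_bounded)
    have Xf: "(\<lambda>n. opnorm G (\<lambda>a. X n a - f a)) \<longlonglongrightarrow> 0" using X(2) by (simp add: oplim_def)
    have eq: "(\<lambda>n. adist (Bc G) (X n) (Y n)) = (\<lambda>n. opnorm G (\<lambda>a. X n a - Y n a))"
      using X(1) Y by (simp add: adist_Bc)
    show ?thesis
      unfolding eq
    proof
      assume XY: "(\<lambda>n. opnorm G (\<lambda>a. X n a - Y n a)) \<longlonglongrightarrow> 0"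
      show "oplim G Y f"
      proof (rule oplimI[OF M(3,2)])
        show "opnorm G (\<lambda>a. Y n a - f a) \<le> opnorm G (\<lambda>a. X n a - Y n a) + opnorm G (\<lambda>a. X n a - f a)" for n
          using opnorm_triangle[OF M(2)[of n] M(1)[of n] M(3)]
          unfolding opnorm_minus_commute[OF M(2)[of n] M(1)[of n]] .
        show "(\<lambda>n. opnorm G (\<lambda>a. X n a - Y n a) + opnorm G (\<lambda>a. X n a - f a)) \<longlonglongrightarrow> 0"
          using tendsto_add[OF XY Xf] by simp
      qed
    next
      assume "oplim G Y f"
      then have Yf: "(\<lambda>n. opnorm G (\<lambda>a. Y n a - f a)) \<longlonglongrightarrow> 0" by (simp add: oplim_def)
      show "(\<lambda>n. opnorm G (\<lambda>a. X n a - Y n a)) \<longlonglongrightarrow> 0"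
      proof (rule tendsto_sandwich[OF _ _ tendsto_const])
        show "\<forall>\<^sub>F n in sequentially. 0 \<le> opnorm G (\<lambda>a. X n a - Y n a)"
          by (intro always_eventually allI opnorm_nonneg op_bounded_diff M)
        show "\<forall>\<^sub>F n in sequentially. opnorm G (\<lambda>a. X n a - Y n a)
            \<le> opnorm G (\<lambda>a. X n a - f a) + opnorm G (\<lambda>a. Y n a - f a)"
        proof (intro always_eventually allI)
          fix n
          show "opnorm G (\<lambda>a. X n a - Y n a) \<le> opnorm G (\<lambda>a. X n a - f a) + opnorm G (\<lambda>a. Y n a - f a)"
            using opnorm_triangle[OF M(1)[of n] M(3) M(2)[of n]]
            unfolding opnorm_minus_commute[OF M(3) M(2)[of n]] .
        qed
        show "(\<lambda>n. opnorm G (\<lambda>a. X n a - f a) + opnorm G (\<lambda>a. Y n a - f a)) \<longlonglongrightarrow> 0"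
          using tendsto_add[OF Xf Yf] by simp
      qed
    qed
  qed
  have "Y \<in> cauchy_class (Bc G) X \<longleftrightarrow> Y \<in> class_of f" for Y
  proof -
    have "Y \<in> cauchy_class (Bc G) X \<longleftrightarrow> cauchy_seq (Bc G) Y \<and> (\<lambda>n. adist (Bc G) (X n) (Y n)) \<longlonglongrightarrow> 0"
      using oplim_cauchy_seq[OF X] by (auto simp: cauchy_class_def cauchy_rel_def)
    also have "\<dots> \<longleftrightarrow> (\<forall>n. Y n \<in> Bc_fns) \<and> oplim G Y f"
      using lim[of Y] oplim_cauchy_seq[of Y f] by (auto simp: cauchy_seq_def)
    finally show ?thesis by (simp add: class_of_def)
  qed
  then show ?thesis by blast
qed

lemma rep_class_of:
  assumes "f \<in> acarrier (reg_alg G)"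
  shows "rep (class_of f) n \<in> Bc_fns" "oplim G (rep (class_of f)) f"
proof -
  have "\<exists>X. X \<in> class_of f" using assms by (auto simp: class_of_def op_closure_def)
  then have "rep (class_of f) \<in> class_of f" unfolding rep_def by (rule someI_ex)
  then show "rep (class_of f) n \<in> Bc_fns" "oplim G (rep (class_of f)) f"
    by (simp_all add: class_of_def)
qed

text \<open>Whichever representative \<open>rep\<close> picks, it converges to \<open>f\<close> in
  operator norm and hence pointwise. This gives the injectivity of j on the completion.\<close>

lemma jmap_class_of: "f \<in> acarrier (reg_alg G) \<Longrightarrow> jmap (class_of f) = f"
  unfolding jmap_def by (rule ext) (intro limI oplim_pointwise rep_class_of)

lemma carrier_Br: "acarrier (Br G) = class_of ` acarrier (reg_alg G)"
proof -
  have "acarrier (Br G) = {cauchy_class (Bc G) X |X. cauchy_seq (Bc G) X}"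
    by (auto simp: Br_def completion_def quotient_def cauchy_class_def)
  also have "\<dots> = class_of ` acarrier (reg_alg G)"
  proof (intro equalityI subsetI)
    fix c assume "c \<in> {cauchy_class (Bc G) X |X. cauchy_seq (Bc G) X}"
    then obtain X where X: "c = cauchy_class (Bc G) X" "cauchy_seq (Bc G) X" by blast
    then obtain f where f: "oplim G X f" using cauchy_seq_oplim by blast
    have "\<And>n. X n \<in> Bc_fns" using X by (simp add: cauchy_seq_def)
    then show "c \<in> class_of ` acarrier (reg_alg G)"
      unfolding X(1) using cauchy_class_eq f by (auto simp: op_closure_def)
  next
    fix c assume "c \<in> class_of ` acarrier (reg_alg G)"
    then obtain f X where "c = class_of f" "\<And>n. X n \<in> Bc_fns" "oplim G X f"
      by (auto simp: op_closure_def)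
    then show "c \<in> {cauchy_class (Bc G) X |X. cauchy_seq (Bc G) X}"
      using cauchy_class_eq[of X f] oplim_cauchy_seq[of X f] by auto
  qed
  finally show ?thesis .
qed

text \<open>The operations of the completion act on representatives picked by \<open>rep\<close>.
  Each operation preserves \<open>oplim\<close>, so the resulting sequence has the expected limit,
  and \<open>cauchy_class_eq\<close> identifies its class.\<close>

lemma star_iso_class_of: "star_iso class_of (reg_alg G) (Br G)"
proof
  show "star_closed (reg_alg G) (acarrier (reg_alg G))" by (rule star_closed_reg_alg)
  show "inj_on class_of (acarrier (reg_alg G))" by (rule inj_on_inverseI[of _ jmap]) (rule jmap_class_of)
  show "acarrier (Br G) = class_of ` acarrier (reg_alg G)" by (rule carrier_Br)
  show "azero (Br G) = class_of (azero (reg_alg G))"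
    by (simp add: Br_def completion_def) (intro cauchy_class_eq Bc_zero oplim_const op_bounded_zero)
next
  fix f g assume fg: "f \<in> acarrier (reg_alg G)" "g \<in> acarrier (reg_alg G)"
  show "aplus (Br G) (class_of f) (class_of g) = class_of (aplus (reg_alg G) f g)"
    by (simp add: Br_def completion_def) (intro cauchy_class_eq Bc_add oplim_add rep_class_of fg)
  show "atimes (Br G) (class_of f) (class_of g) = class_of (atimes (reg_alg G) f g)"
    by (simp add: Br_def completion_def) (intro cauchy_class_eq Bc_conv oplim_conv rep_class_of fg)
next
  fix f z assume f: "f \<in> acarrier (reg_alg G)"
  show "ascale (Br G) z (class_of f) = class_of (ascale (reg_alg G) z f)"
    by (simp add: Br_def completion_def) (intro cauchy_class_eq Bc_scale oplim_scale rep_class_of f)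
  show "astar (Br G) (class_of f) = class_of (astar (reg_alg G) f)"
    by (simp add: Br_def completion_def) (intro cauchy_class_eq Bc_invol oplim_invol rep_class_of f)
  have "(\<lambda>n. reduced_norm G (rep (class_of f) n)) = (\<lambda>n. opnorm G (rep (class_of f) n))"
    using rep_class_of(1)[OF f] by (simp add: reduced_norm_eq Bc_op_bounded)
  then show "anorm (Br G) (class_of f) = anorm (reg_alg G) f"
    using limI[OF oplim_norm[OF rep_class_of(2)[OF f]]] by (simp add: Br_def completion_def)
qed

lemma to_completion_eq: "f \<in> Bc_fns \<Longrightarrow> to_completion (Bc G) f = class_of f"
  unfolding to_completion_def by (intro cauchy_class_eq oplim_const Bc_op_bounded)

section \<open>The function model of C*_r(G) and of its isotropy part\<close>

definition cstar_fns :: "('g \<Rightarrow> complex) set" where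
  "cstar_fns = cstar_generated (reg_alg G) Cc_fns"

definition isotropy_fns :: "('g \<Rightarrow> complex) set" where
  "isotropy_fns = {f \<in> cstar_fns. \<forall>a. a \<notin> isotropy G \<longrightarrow> f a = 0}"

lemma Cc_subset_Bc: "Cc_fns \<subseteq> Bc_fns"
  by (rule continuous_compact_support_subset)

lemma Bc_subset_carrier: "Bc_fns \<subseteq> acarrier (reg_alg G)"
  using op_closure_superset[OF Bc_subset] by simp

lemma cstar_subalgebra_cstar_fns: "cstar_subalgebra (reg_alg G) cstar_fns"
  unfolding cstar_fns_def
  using Cc_subset_Bc Bc_subset_carrier by (intro cstar_generated_subalgebra star_closed_reg_alg) blast

text \<open>The isotropy is closed, so taking the closure of the nonvanishing set adds no
  condition.\<close>

lemma supp_subset_isotropy_iff: "supp f \<subseteq> isotropy G \<longleftrightarrow> (\<forall>a. a \<notin> isotropy G \<longrightarrow> f a = 0)"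
proof
  assume "supp f \<subseteq> isotropy G"
  then show "\<forall>a. a \<notin> isotropy G \<longrightarrow> f a = 0"
    unfolding supp_def using closure_subset[of "{a. f a \<noteq> 0}"] by auto
next
  assume "\<forall>a. a \<notin> isotropy G \<longrightarrow> f a = 0"
  then show "supp f \<subseteq> isotropy G"
    unfolding supp_def by (intro closure_minimal closed_isotropy) auto
qed

lemma cartan_transfer:
  assumes "cartan_subalgebra (reg_alg G\<lparr>acarrier := cstar_fns\<rparr>) isotropy_fns"
  shows "cartan_subalgebra (Cr G) (isotropy_subalgebra G)"
proof -
  interpret star_iso class_of "reg_alg G" "Br G" by (rule star_iso_class_of)
  have sub: "Cc_fns \<subseteq> acarrier (reg_alg G)" using Cc_subset_Bc Bc_subset_carrier by blast
  have "to_completion (Bc G) ` Cc_fns = class_of ` Cc_fns"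
    using Cc_subset_Bc by (intro image_cong refl to_completion_eq) auto
  then have carr: "cstar_generated (Br G) (to_completion (Bc G) ` Cc_fns) = class_of ` cstar_fns"
    by (simp only: cstar_generated_image[OF sub] cstar_fns_def)
  then have Cr: "Cr G = Br G\<lparr>acarrier := class_of ` cstar_fns\<rparr>"
    by (simp add: Cr_def)
  have "cstar_fns \<subseteq> acarrier (reg_alg G)"
    using cstar_subalgebra_cstar_fns by (simp add: cstar_subalgebra_def)
  then have "isotropy_subalgebra G = class_of ` isotropy_fns"
    unfolding isotropy_subalgebra_def isotropy_fns_def Cr supp_subset_isotropy_iff
    by (auto simp del: reg_alg_simps simp: jmap_class_of subset_iff)
  then show ?thesis
    unfolding Cr
    using star_iso.cartan_subalgebra_image[OF restrict[OF cstar_subalgebra_cstar_fns] assms] by simp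
qed

end

section \<open>Pointwise multiplication by compactly supported functions\<close>

text \<open>Finite sums of products of one-variable functions: the algebra for Stone-Weierstrass on
  pairs. It is real, as the theorem asks; complex kernels are split into real and imaginary
  parts.\<close>

inductive tensor_fn :: "('a::topological_space \<times> 'b::topological_space \<Rightarrow> real) \<Rightarrow> bool" where
  pure: "continuous_on UNIV p \<Longrightarrow> continuous_on UNIV q \<Longrightarrow> tensor_fn (\<lambda>z. p (fst z) * q (snd z))"
| add: "tensor_fn P \<Longrightarrow> tensor_fn Q \<Longrightarrow> tensor_fn (\<lambda>z. P z + Q z)"

lemma tensor_fn_continuous: "tensor_fn P \<Longrightarrow> continuous_on UNIV P"
proof (induction rule: tensor_fn.induct)
  case (pure p q)
  show ?case
    by (intro continuous_on_mult continuous_on_compose2[OF pure(1) continuous_on_fst]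
        continuous_on_compose2[OF pure(2) continuous_on_snd]) auto
qed (intro continuous_on_add)

lemma tensor_fn_mult:
  assumes "tensor_fn P" "tensor_fn Q"
  shows "tensor_fn (\<lambda>z. P z * Q z)"
  using assms(1)
proof (induction rule: tensor_fn.induct)
  case p: (pure p q)
  show ?case
    using assms(2)
  proof (induction rule: tensor_fn.induct)
    case (pure p' q')
    have "tensor_fn (\<lambda>z. (p (fst z) * p' (fst z)) * (q (snd z) * q' (snd z)))"
      using p pure by (intro tensor_fn.pure continuous_on_mult)
    then show ?case by (simp add: mult_ac)
  next
    case (add P' Q')
    then show ?case using tensor_fn.add[OF add.IH] by (simp add: distrib_left)
  qed
next
  case (add P' Q')
  then show ?case using tensor_fn.add[OF add.IH] by (simp add: distrib_right)
qed

context semi_etale_groupoid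
begin

section \<open>Bump functions, cut-offs and decomposition along bisections\<close>

lemma completely_regular: "completely_regular_space (euclidean :: 'g topology)"
proof (rule locally_compact_regular_imp_completely_regular_space[OF locally_compact], rule disjI1)
  show "Hausdorff_space (euclidean :: 'g topology)"
    unfolding Hausdorff_space_def by (simp add: disjnt_def) (metis hausdorff)
qed

lemma ex_bump:
  assumes W: "open W" "a \<in> W"
  shows "\<exists>\<eta>::'g \<Rightarrow> real. continuous_on UNIV \<eta> \<and> (\<forall>b. 0 \<le> \<eta> b \<and> \<eta> b \<le> 1) \<and>
     (\<exists>K. compact K \<and> (\<forall>b. b \<notin> K \<longrightarrow> \<eta> b = 0)) \<and> (\<forall>b. b \<notin> W \<longrightarrow> \<eta> b = 0) \<and>
     (\<exists>V. open V \<and> a \<in> V \<and> (\<forall>b\<in>V. \<eta> b = 1))"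
proof -
  obtain U K where UK: "open U" "compact K" "a \<in> U" "U \<subseteq> K"
    using locally_compact unfolding locally_compact_space_def by simp blast
  have "closedin euclidean (- (U \<inter> W))" "a \<in> topspace euclidean - (- (U \<inter> W))"
    using UK W by (auto simp: closed_closedin[symmetric])
  then obtain f :: "'g \<Rightarrow> real" where f: "continuous_map euclidean (top_of_set {0..1}) f" "f a = 0" "f ` (- (U \<inter> W)) \<subseteq> {1}"
    using completely_regular unfolding completely_regular_space_def by blast
  have fc: "continuous_on UNIV f" and f01: "\<And>b. 0 \<le> f b \<and> f b \<le> 1"
    using f(1) by (auto simp: continuous_map_in_subtopology Pi_iff)
  \<comment> \<open>The truncation makes \<eta> equal to 1 on the open set where
    \<open>f b < 1/2\<close> and not merely at \<open>a\<close>; covering arguments need this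
    neighbourhood.\<close>
  define \<eta> where "\<eta> b = min 1 (2 * (1 - f b))" for b
  have c: "continuous_on UNIV \<eta>" unfolding \<eta>_def by (intro continuous_intros fc)
  have z: "\<eta> b = 0" if "b \<notin> U \<inter> W" for b
  proof -
    have "f b = 1" using f(3) that by blast
    then show ?thesis by (simp add: \<eta>_def)
  qed
  have V: "open {b. f b < 1/2}" by (intro open_Collect_less fc continuous_on_const)
  show ?thesis
  proof (intro exI[of _ \<eta>] conjI allI impI)
    show "\<exists>K. compact K \<and> (\<forall>b. b \<notin> K \<longrightarrow> \<eta> b = 0)" using UK z by blast
    show "\<exists>V. open V \<and> a \<in> V \<and> (\<forall>b\<in>V. \<eta> b = 1)"
      using V f(2) by (intro exI[of _ "{b. f b < 1/2}"]) (auto simp: \<eta>_def)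
  qed (use c z f01 in \<open>auto simp: \<eta>_def\<close>)
qed

text \<open>The vanishing product stands in for a partition of unity: at each point of
  \<open>K\<close> some bump equals 1. One minus the product is then a cut-off, and its expansion
  decomposes functions.\<close>

lemma ex_finite_bumps:
  assumes K: "compact K" and W: "\<And>a. a \<in> K \<Longrightarrow> open (W a) \<and> a \<in> W a"
  shows "\<exists>I (\<eta>::'g \<Rightarrow> 'g \<Rightarrow> real). finite I \<and> I \<subseteq> K \<and>
    (\<forall>i\<in>I. continuous_on UNIV (\<eta> i) \<and> (\<forall>b. 0 \<le> \<eta> i b \<and> \<eta> i b \<le> 1) \<and>
       (\<exists>K. compact K \<and> (\<forall>b. b \<notin> K \<longrightarrow> \<eta> i b = 0)) \<and> (\<forall>b. b \<notin> W i \<longrightarrow> \<eta> i b = 0)) \<and>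
    (\<forall>b\<in>K. (\<Prod>i\<in>I. 1 - \<eta> i b) = 0)"
proof -
  have "\<forall>a. \<exists>\<eta>::'g \<Rightarrow> real. a \<in> K \<longrightarrow> continuous_on UNIV \<eta> \<and> (\<forall>b. 0 \<le> \<eta> b \<and> \<eta> b \<le> 1) \<and>
     (\<exists>K. compact K \<and> (\<forall>b. b \<notin> K \<longrightarrow> \<eta> b = 0)) \<and> (\<forall>b. b \<notin> W a \<longrightarrow> \<eta> b = 0) \<and>
     (\<exists>V. open V \<and> a \<in> V \<and> (\<forall>b\<in>V. \<eta> b = 1))"
  proof
    fix a
    show "\<exists>\<eta>::'g \<Rightarrow> real. a \<in> K \<longrightarrow> continuous_on UNIV \<eta> \<and> (\<forall>b. 0 \<le> \<eta> b \<and> \<eta> b \<le> 1) \<and>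
     (\<exists>K. compact K \<and> (\<forall>b. b \<notin> K \<longrightarrow> \<eta> b = 0)) \<and> (\<forall>b. b \<notin> W a \<longrightarrow> \<eta> b = 0) \<and>
     (\<exists>V. open V \<and> a \<in> V \<and> (\<forall>b\<in>V. \<eta> b = 1))"
    proof (cases "a \<in> K")
      case True
      have "open (W a)" "a \<in> W a" using W[OF True] by auto
      from ex_bump[OF this] show ?thesis by (rule exE) (rule exI, rule impI, assumption)
    qed simp
  qed
  from choice[OF this] obtain \<eta> where
    \<eta>: "\<forall>a. a \<in> K \<longrightarrow> continuous_on UNIV (\<eta> a) \<and> (\<forall>b. 0 \<le> \<eta> a b \<and> \<eta> a b \<le> (1::real)) \<and>
     (\<exists>K. compact K \<and> (\<forall>b. b \<notin> K \<longrightarrow> \<eta> a b = 0)) \<and> (\<forall>b. b \<notin> W a \<longrightarrow> \<eta> a b = 0) \<and>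
     (\<exists>V. open V \<and> a \<in> V \<and> (\<forall>b\<in>V. \<eta> a b = 1))" ..
  have "\<forall>a. \<exists>V. a \<in> K \<longrightarrow> open V \<and> a \<in> V \<and> (\<forall>b\<in>V. \<eta> a b = 1)"
  proof
    fix a
    show "\<exists>V. a \<in> K \<longrightarrow> open V \<and> a \<in> V \<and> (\<forall>b\<in>V. \<eta> a b = 1)"
      using \<eta>[THEN spec, of a] by (cases "a \<in> K") simp_all
  qed
  from choice[OF this] obtain V where V: "\<forall>a. a \<in> K \<longrightarrow> open (V a) \<and> a \<in> V a \<and> (\<forall>b\<in>V a. \<eta> a b = 1)" ..
  have "K \<subseteq> (\<Union>a\<in>K. V a)" using V by auto
  then obtain I where I: "I \<subseteq> K" "finite I" "K \<subseteq> (\<Union>a\<in>I. V a)"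
    using compactE_image[OF K, of K V] V by auto
  have "(\<Prod>i\<in>I. 1 - \<eta> i b) = 0" if b: "b \<in> K" for b
  proof -
    obtain i where i: "i \<in> I" "b \<in> V i" using I(3) b by auto
    then have "1 - \<eta> i b = 0" using V I(1) by auto
    then show ?thesis using i(1) I(2) by (auto simp: prod_zero_iff)
  qed
  moreover have "continuous_on UNIV (\<eta> i) \<and> (\<forall>b. 0 \<le> \<eta> i b \<and> \<eta> i b \<le> 1) \<and>
       (\<exists>K. compact K \<and> (\<forall>b. b \<notin> K \<longrightarrow> \<eta> i b = 0)) \<and> (\<forall>b. b \<notin> W i \<longrightarrow> \<eta> i b = 0)" if "i \<in> I" for i
  proof -
    have "i \<in> K" using I(1) that by auto
    from \<eta>[THEN spec, THEN mp, OF this] show ?thesis by (elim conjE) (intro conjI; assumption)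
  qed
  ultimately show ?thesis
    by (intro exI[of _ I] exI[of _ \<eta>] conjI[OF I(2) conjI[OF I(1)]] conjI) (rule ballI, assumption)+
qed

lemma ex_cutoff:
  assumes K: "compact K"
  shows "\<exists>\<eta>::'g \<Rightarrow> real. continuous_on UNIV \<eta> \<and> (\<forall>b. 0 \<le> \<eta> b \<and> \<eta> b \<le> 1) \<and>
     (\<exists>L. compact L \<and> K \<subseteq> L \<and> (\<forall>b. b \<notin> L \<longrightarrow> \<eta> b = 0)) \<and> (\<forall>b\<in>K. \<eta> b = 1)"
proof -
  obtain I and \<eta> :: "'g \<Rightarrow> 'g \<Rightarrow> real" where I: "finite I" and
    \<eta>: "\<forall>i\<in>I. continuous_on UNIV (\<eta> i) \<and> (\<forall>b. 0 \<le> \<eta> i b \<and> \<eta> i b \<le> 1) \<and>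
       (\<exists>K. compact K \<and> (\<forall>b. b \<notin> K \<longrightarrow> \<eta> i b = 0))" and
    z: "\<forall>b\<in>K. (\<Prod>i\<in>I. 1 - \<eta> i b) = 0"
    using ex_finite_bumps[OF K, of "\<lambda>_. UNIV"] by auto
  then have "\<forall>i\<in>I. \<exists>K. compact K \<and> (\<forall>b. b \<notin> K \<longrightarrow> \<eta> i b = 0)" by blast
  from bchoice[OF this] obtain L where L: "\<forall>i\<in>I. compact (L i) \<and> (\<forall>b. b \<notin> L i \<longrightarrow> \<eta> i b = 0)" ..
  let ?\<theta> = "\<lambda>b. 1 - (\<Prod>i\<in>I. 1 - \<eta> i b)" and ?L = "K \<union> (\<Union>i\<in>I. L i)"
  have "continuous_on UNIV ?\<theta>" using \<eta> by (intro continuous_intros) auto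
  moreover have "0 \<le> (\<Prod>i\<in>I. 1 - \<eta> i b) \<and> (\<Prod>i\<in>I. 1 - \<eta> i b) \<le> 1" for b
    using \<eta> by (intro conjI prod_nonneg prod_le_1) auto
  moreover have "compact ?L" using L I K by (intro compact_Un compact_UN) auto
  moreover have "?\<theta> b = 0" if "b \<notin> ?L" for b
    using that L by (simp add: prod.neutral)
  ultimately show ?thesis
    using z by (intro exI[of _ ?\<theta>] conjI exI[of _ ?L]) auto
qed

lemma Cc_mult: "continuous_on UNIV k \<Longrightarrow> f \<in> Cc_fns \<Longrightarrow> (\<lambda>a. k a * f a) \<in> Cc_fns"
proof (elim continuous_compact_supportE)
  fix K assume "continuous_on UNIV k" "continuous_on UNIV f" "compact K" "\<forall>a. a \<notin> K \<longrightarrow> f a = 0"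
  then show ?thesis
    by (intro continuous_compact_supportI[of _ K] continuous_on_mult) auto
qed

lemma Cc_invol: "f \<in> Cc_fns \<Longrightarrow> invol G f \<in> Cc_fns"
proof (elim continuous_compact_supportE)
  fix K assume K: "continuous_on UNIV f" "compact K" "\<forall>a. a \<notin> K \<longrightarrow> f a = 0"
  have "continuous_on UNIV (invol G f)"
    unfolding invol_def
    by (intro continuous_on_cnj continuous_on_compose2[OF K(1) continuous_ginv]) auto
  moreover have "invol G f a = 0" if "a \<notin> ginv G ` K" for a
  proof -
    have "ginv G a \<notin> K" using that by (metis ginv_ginv imageI)
    then show ?thesis using K by (simp add: invol_def)
  qed
  ultimately show ?thesis
    using K by (intro continuous_compact_supportI[of _ "ginv G ` K"] compact_ginv) auto
qed

lemma real_Cc: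
  fixes \<eta> :: "'g \<Rightarrow> real"
  assumes "continuous_on UNIV \<eta>" "compact K" "\<And>b. b \<notin> K \<Longrightarrow> \<eta> b = 0"
  shows "(\<lambda>a. of_real (\<eta> a)) \<in> Cc_fns"
  using assms by (intro continuous_compact_supportI[of _ K] continuous_on_of_real) auto

lemma conv_units_right:
  assumes "\<And>d. d \<notin> units G \<Longrightarrow> e d = 0"
  shows "conv G f e c = f c * e (src G c)"
proof -
  have "conv G f e c = f (gmul G c (ginv G (src G c))) * e (src G c)"
    unfolding conv_src
  proof (rule infsum_single)
    fix d assume "d \<in> {d. src G d = src G c}" "d \<noteq> src G c"
    then have "d \<notin> units G" unfolding mem_units_iff by (metis mem_Collect_eq src_rng)
    then show "f (gmul G c (ginv G d)) * e d = 0" using assms by simp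
  qed simp
  then show ?thesis by simp
qed

lemma conv_units_left:
  assumes "\<And>d. d \<notin> units G \<Longrightarrow> e d = 0"
  shows "conv G e f c = e (rng G c) * f c"
proof -
  have "conv G e f c = e (rng G c) * f (gmul G (ginv G (rng G c)) c)"
    unfolding conv_rng
  proof (rule infsum_single)
    fix d assume "d \<in> {d. rng G d = rng G c}" "d \<noteq> rng G c"
    then have "d \<notin> units G" unfolding mem_units_iff by auto
    then show "e d * f (gmul G (ginv G d) c) = 0" using assms by simp
  qed simp
  then show ?thesis by simp
qed

text \<open>The unit space is open and closed, so extension by zero from it remains
  continuous.\<close>

lemma unit_cutoff_Cc:
  fixes \<eta> :: "'g \<Rightarrow> real"
  assumes "continuous_on UNIV \<eta>" "compact K" "\<And>b. b \<notin> K \<Longrightarrow> \<eta> b = 0"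
  shows "(\<lambda>a. if a \<in> units G then of_real (\<eta> a) else 0) \<in> Cc_fns"
proof (rule continuous_compact_supportI[OF _ assms(2)])
  have "continuous_on (units G \<union> - units G) (\<lambda>a. if a \<in> units G then of_real (\<eta> a) else (0::complex))"
    using closed_units open_units
    by (intro continuous_on_cases continuous_on_of_real continuous_on_subset[OF assms(1)])
      (auto simp: closed_def)
  then show "continuous_on UNIV (\<lambda>a. if a \<in> units G then of_real (\<eta> a) else (0::complex))" by simp
qed (use assms(3) in auto)

text \<open>\<open>f\<close> minus the product of the \<open>1 - \<eta> i\<close> times
  \<open>f\<close> telescopes: each new index adds \<eta> i times the product over the previous
  indices times \<open>f\<close>, which is carried by one bisection. On the support of
  \<open>f\<close> the full product vanishes. Regularity is thereby reduced to functions carried by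
  a bisection.\<close>

lemma Cc_decompose:
  assumes add: "\<And>f g. f \<in> B \<Longrightarrow> g \<in> B \<Longrightarrow> (\<lambda>a. f a + g a) \<in> B" and zero: "(\<lambda>a. 0) \<in> B"
    and B: "\<And>f U. f \<in> Cc_fns \<Longrightarrow> bisection G U \<Longrightarrow> (\<And>a. a \<notin> U \<Longrightarrow> f a = 0) \<Longrightarrow> f \<in> B"
    and f: "f \<in> Cc_fns"
  shows "f \<in> B"
proof -
  obtain K where K: "compact K" "\<forall>a. a \<notin> K \<longrightarrow> f a = 0"
    using f unfolding continuous_compact_support_iff by blast
  have "\<forall>a. \<exists>U. bisection G U \<and> a \<in> U"
  proof
    fix a
    obtain U where "bisection G U" "a \<in> U" by (rule ex_bisection[OF open_UNIV UNIV_I])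
    then show "\<exists>U. bisection G U \<and> a \<in> U" by auto
  qed
  from choice[OF this] obtain W where W: "\<And>a. bisection G (W a)" "\<And>a. a \<in> W a" by auto
  have "open (W a) \<and> a \<in> W a" for a using W by (simp add: bisection_def)
  from ex_finite_bumps[OF K(1) this] obtain I and \<eta> :: "'g \<Rightarrow> 'g \<Rightarrow> real" where I: "finite I" "I \<subseteq> K" and
    \<eta>': "\<forall>i\<in>I. continuous_on UNIV (\<eta> i) \<and> (\<forall>b. 0 \<le> \<eta> i b \<and> \<eta> i b \<le> 1) \<and>
       (\<exists>K. compact K \<and> (\<forall>b. b \<notin> K \<longrightarrow> \<eta> i b = 0)) \<and> (\<forall>b. b \<notin> W i \<longrightarrow> \<eta> i b = 0)" and
    z: "\<forall>b\<in>K. (\<Prod>i\<in>I. 1 - \<eta> i b) = 0"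
    by (elim exE conjE) (rule that)
  have \<eta>: "\<forall>i\<in>I. continuous_on UNIV (\<eta> i) \<and> (\<forall>b. b \<notin> W i \<longrightarrow> \<eta> i b = 0)"
    using \<eta>' by simp
  have "(\<lambda>a. f a - of_real (\<Prod>i\<in>I. 1 - \<eta> i a) * f a) \<in> B"
    using I(1) \<eta>
  proof (induction I rule: finite_induct)
    case empty
    then show ?case using zero by simp
  next
    case (insert i J)
    let ?P = "\<lambda>a. of_real (\<Prod>i\<in>J. 1 - \<eta> i a) :: complex"
    have cont: "continuous_on UNIV (\<lambda>a. of_real (\<eta> i a) * ?P a)"
      using insert.prems by (intro continuous_intros) auto
    have "(\<lambda>a. (of_real (\<eta> i a) * ?P a) * f a) \<in> B"
      using insert.prems by (intro B[OF Cc_mult[OF cont f] W(1)[of i]]) auto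
    moreover have "(\<lambda>a. f a - ?P a * f a) \<in> B"
      using insert.prems by (intro insert.IH) auto
    ultimately have "(\<lambda>a. (f a - ?P a * f a) + (of_real (\<eta> i a) * ?P a) * f a) \<in> B" by (intro add)
    also have "(\<lambda>a. (f a - ?P a * f a) + (of_real (\<eta> i a) * ?P a) * f a) =
        (\<lambda>a. f a - of_real (\<Prod>i\<in>insert i J. 1 - \<eta> i a) * f a)"
      using insert.hyps by (simp add: algebra_simps)
    finally show ?case .
  qed
  also have "(\<lambda>a. f a - of_real (\<Prod>i\<in>I. 1 - \<eta> i a) * f a) = f"
  proof
    fix a show "f a - of_real (\<Prod>i\<in>I. 1 - \<eta> i a) * f a = f a"
      using z K(2) by (cases "a \<in> K") auto
  qed
  finally show ?thesis .
qed

section \<open>Closed subalgebras and continuity of pointwise multiplication\<close>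

lemma cstar_fns_carrier: "cstar_fns \<subseteq> op_closure G Bc_fns"
  using cstar_subalgebra_cstar_fns by (simp add: cstar_subalgebra_iff)

lemma cstar_fns_bounded: "f \<in> cstar_fns \<Longrightarrow> f \<in> op_bounded G"
  using cstar_fns_carrier op_closure_bounded by blast

lemma Cc_cstar_fns: "f \<in> Cc_fns \<Longrightarrow> f \<in> cstar_fns"
  unfolding cstar_fns_def by (rule subsetD[OF cstar_generated_superset])

lemma star_closed_cstar_fns: "star_closed (reg_alg G) cstar_fns"
  using cstar_subalgebra_cstar_fns by (simp add: cstar_subalgebra_iff)

lemmas cstar_fns_ops = star_closedD[OF star_closed_cstar_fns, unfolded reg_alg_simps]

lemma cstar_subalgebra_oplim:
  assumes B: "cstar_subalgebra (reg_alg G) B" and X: "\<And>n. X n \<in> B" "oplim G X f"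
  shows "f \<in> B"
proof (rule cstar_subalgebra_closed[OF B _ X(1)])
  have "B \<subseteq> op_closure G Bc_fns" using B by (simp add: cstar_subalgebra_iff)
  then show "f \<in> acarrier (reg_alg G)"
    unfolding reg_alg_simps using X(1) by (intro op_closure_closed[OF Bc_subset _ X(2)]) blast
  show "(\<lambda>n. adist (reg_alg G) (X n) f) \<longlonglongrightarrow> 0"
    using X(2) by (simp add: adist_reg_alg oplim_def)
qed

lemmas cstar_fns_oplim = cstar_subalgebra_oplim[OF cstar_subalgebra_cstar_fns]

lemma cstar_subalgebra_op_closure:
  assumes "Q \<subseteq> Bc_fns" "star_closed (reg_alg G) Q"
  shows "cstar_subalgebra (reg_alg G) (op_closure G Q)"
  unfolding cstar_subalgebra_iff
proof (intro conjI allI ballI impI)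
  have Q: "Q \<subseteq> op_bounded G" using assms(1) Bc_subset by blast
  show "op_closure G Q \<subseteq> acarrier (reg_alg G)"
    using op_closure_mono[OF assms(1)] by simp
  show "star_closed (reg_alg G) (op_closure G Q)"
    by (rule op_closure_star_closed[OF _ _ _ _ _ Q assms(2)]) simp_all
  fix X f assume "f \<in> acarrier (reg_alg G)" "(\<forall>n. X n \<in> op_closure G Q) \<and> (\<lambda>n. adist (reg_alg G) (X n) f) \<longlonglongrightarrow> 0"
  then have f: "f \<in> op_bounded G" and X: "\<And>n. X n \<in> op_closure G Q"
    and lim: "(\<lambda>n. opnorm G (\<lambda>a. X n a - f a)) \<longlonglongrightarrow> 0"
    using op_closure_bounded[of f Bc_fns] by (simp_all add: adist_reg_alg)
  have "oplim G X f"
    unfolding oplim_def using f lim op_closure_bounded[OF X] by simp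
  then show "f \<in> op_closure G Q" by (rule op_closure_closed[OF Q X])
qed

text \<open>The product vanishes off a compact set belonging to \<open>h\<close> and is bounded by
  the bound of \<open>h\<close> times \<open>opnorm G g\<close>, so \<open>op_bound_compact\<close>
  applies with a constant depending on \<open>h\<close> alone. Pointwise multiplication by
  \<open>h\<close> is therefore continuous in operator norm.\<close>

lemma mult_op_bounded:
  assumes h: "h \<in> Cc_fns"
  shows "\<exists>M\<ge>0. \<forall>g\<in>op_bounded G. op_bound G (\<lambda>a. h a * g a) (M * opnorm G g)"
proof -
  have "h \<in> Bc_fns" using h Cc_subset_Bc by blast
  then obtain K B where K: "compact K" "\<forall>a. a \<notin> K \<longrightarrow> h a = 0" and B: "0 \<le> B" "\<forall>a. cmod (h a) \<le> B"
    by (rule bounded_compact_supportE)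
  obtain N where N: "N \<ge> 0" "\<forall>f B. 0 \<le> B \<longrightarrow> (\<forall>a. cmod (f a) \<le> B) \<longrightarrow> (\<forall>a. a \<notin> K \<longrightarrow> f a = 0) \<longrightarrow> op_bound G f (B * N)"
    using op_bound_compact[OF K(1)] by blast
  have "op_bound G (\<lambda>a. h a * g a) ((B * N) * opnorm G g)" if g: "g \<in> op_bounded G" for g
  proof -
    have "op_bound G (\<lambda>a. h a * g a) ((B * opnorm G g) * N)"
      using K(2) B opnorm_nonneg[OF g] cmod_le_opnorm[OF g]
      by (intro N(2)[rule_format]) (auto simp: norm_mult mult_mono)
    then show ?thesis by (simp add: mult_ac)
  qed
  then show ?thesis using B N by (intro exI[of _ "B * N"]) auto
qed

lemma oplim_mult:
  assumes h: "h \<in> Cc_fns" and X: "oplim G X f"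
  shows "oplim G (\<lambda>n a. h a * X n a) (\<lambda>a. h a * f a)"
proof -
  obtain M where M: "\<forall>g\<in>op_bounded G. op_bound G (\<lambda>a. h a * g a) (M * opnorm G g)"
    using mult_op_bounded[OF h] by blast
  have XM: "\<And>n. X n \<in> op_bounded G" "f \<in> op_bounded G" and lim: "(\<lambda>n. opnorm G (\<lambda>a. X n a - f a)) \<longlonglongrightarrow> 0"
    using X by (auto simp: oplim_def)
  show ?thesis
  proof (rule oplimI)
    show "(\<lambda>a. h a * f a) \<in> op_bounded G" "\<And>n. (\<lambda>a. h a * X n a) \<in> op_bounded G"
      using M XM op_boundedI by blast+
    show "opnorm G (\<lambda>a. h a * X n a - h a * f a) \<le> M * opnorm G (\<lambda>a. X n a - f a)" for n
      using M[rule_format, OF op_bounded_diff[OF XM]] by (intro opnorm_le) (simp add: algebra_simps)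
    show "(\<lambda>n. M * opnorm G (\<lambda>a. X n a - f a)) \<longlonglongrightarrow> 0"
      using tendsto_mult_right_zero[OF lim] .
  qed
qed

text \<open>Functions for which invariance under pointwise multiplication is already established.
  Membership in \<open>Bc_fns\<close> supplies the uniform bound on \<open>g\<close> that turns
  kernel approximation into norm approximation.\<close>

definition multipliable :: "('g \<Rightarrow> complex) set" where
  "multipliable = {g \<in> Bc_fns \<inter> cstar_fns. \<forall>h\<in>Cc_fns. (\<lambda>a. h a * g a) \<in> cstar_fns}"

text \<open>The pointwise product \<open>h \<cdot> (f \<star> g)\<close> has the kernel \<open>h (a b) f a\<close> on composable pairs. By
  Stone--Weierstrass it is uniformly close to a sum of products \<open>p a * q b\<close>, which give the
  elements \<open>p \<star> (q \<cdot> g)\<close>.\<close>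

lemma conv_multipliable:
  assumes f: "f \<in> Cc_fns" and g: "g \<in> multipliable"
  shows "conv G f g \<in> multipliable"
proof -
  have gB: "g \<in> Bc_fns" and gC: "g \<in> cstar_fns" and gm: "\<And>h. h \<in> Cc_fns \<Longrightarrow> (\<lambda>a. h a * g a) \<in> cstar_fns"
    using g by (auto simp: multipliable_def)
  have fB: "f \<in> Bc_fns" using f Cc_subset_Bc by blast
  have fg: "conv G f g \<in> cstar_fns" using cstar_fns_ops(4)[OF Cc_cstar_fns[OF f] gC] .
  have "(\<lambda>c. h c * conv G f g c) \<in> cstar_fns" if h: "h \<in> Cc_fns" for h
  proof -
    obtain K1 where fc: "continuous_on UNIV f" and K1: "compact K1" "\<forall>a. a \<notin> K1 \<longrightarrow> f a = 0"
      using f unfolding continuous_compact_support_iff by blast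
    obtain Kh where hc: "continuous_on UNIV h" and Kh: "compact Kh" "\<forall>a. a \<notin> Kh \<longrightarrow> h a = 0"
      using h unfolding continuous_compact_support_iff by blast
    obtain Bg where Bg': "\<forall>a. cmod (g a) \<le> Bg"
      using gB unfolding bounded_compact_support_iff by blast
    have Bg: "0 \<le> Bg" "\<forall>a. cmod (g a) \<le> Bg"
      using order_trans[OF norm_ge_zero Bg'[rule_format]] Bg' by auto
    \<comment> \<open>If \<open>a\<close> is in \<open>K1\<close> and \<open>a b\<close> in
      \<open>Kh\<close>, then \<open>b = a^{-1} (a b)\<close> lies here; hence the kernel vanishes
      at composable pairs outside \<open>K1 \<times> K2\<close>.\<close>
    define K2 where "K2 = {gmul G a b |a b. a \<in> ginv G ` K1 \<and> b \<in> Kh \<and> src G a = rng G b}"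
    have K2: "compact K2" unfolding K2_def by (intro compact_mult compact_ginv K1 Kh)
    obtain \<eta>1 L1 where \<eta>1: "continuous_on UNIV \<eta>1" "\<forall>b. 0 \<le> \<eta>1 b \<and> \<eta>1 b \<le> (1::real)"
      "\<forall>b\<in>K1. \<eta>1 b = 1" and L1: "compact L1" "K1 \<subseteq> L1" "\<forall>b. b \<notin> L1 \<longrightarrow> \<eta>1 b = 0"
      using ex_cutoff[OF K1(1)] by blast
    obtain \<eta>2 L2 where \<eta>2: "continuous_on UNIV \<eta>2" "\<forall>b. 0 \<le> \<eta>2 b \<and> \<eta>2 b \<le> (1::real)"
      "\<forall>b\<in>K2. \<eta>2 b = 1" and L2: "compact L2" "K2 \<subseteq> L2" "\<forall>b. b \<notin> L2 \<longrightarrow> \<eta>2 b = 0"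
      using ex_cutoff[OF K2] by blast
    define X where "X = L1 \<times> L2 \<inter> {(a, b). src G a = rng G b}"
    have X: "compact X" unfolding X_def by (intro compact_Int_closed compact_Times L1 L2 closed_composable)
    define F where "F z = h (gmul G (fst z) (snd z)) * f (fst z)" for z
    have F0: "F (a, b) = 0" if "src G a = rng G b" "a \<notin> K1 \<or> b \<notin> K2" for a b
    proof (rule ccontr)
      assume "F (a, b) \<noteq> 0"
      then have ab: "a \<in> K1" "gmul G a b \<in> Kh" using K1 Kh by (auto simp: F_def)
      then have "gmul G (ginv G a) (gmul G a b) \<in> K2"
        unfolding K2_def using that(1)
        by (intro CollectI exI[of _ "ginv G a"] exI[of _ "gmul G a b"] conjI) auto
      then show False using ab that by simp
    qed
    have Fc: "continuous_on X F"
    proof -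
      have "continuous_on X (\<lambda>z. h ((\<lambda>(a, b). gmul G a b) z) * f (fst z))"
        by (intro continuous_on_mult continuous_on_compose2[OF hc] continuous_on_compose2[OF fc]
            continuous_on_subset[OF continuous_gmul] continuous_on_fst continuous_on_id)
          (auto simp: X_def)
      then show ?thesis by (simp add: F_def[abs_def] case_prod_unfold)
    qed
    \<comment> \<open>Distinct pairs differ in one coordinate, and a bump in that coordinate
      separates them.\<close>
    have sw: "\<exists>P. tensor_fn P \<and> (\<forall>z\<in>X. \<bar>u z - P z\<bar> < \<epsilon>)" if "continuous_on X u" "0 < \<epsilon>" for u :: "'g \<times> 'g \<Rightarrow> real" and \<epsilon>
    proof -
      have "\<exists>P. tensor_fn P \<and> (\<forall>z\<in>X. \<bar>u z - P z\<bar> < \<epsilon>)"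
      proof (rule Stone_Weierstrass_HOL[where P = tensor_fn, OF X])
        show "tensor_fn (\<lambda>z. c)" for c :: real
          using tensor_fn.pure[of "\<lambda>_. c" "\<lambda>_. 1"] by simp
        show "continuous_on X P" if "tensor_fn P" for P
          using tensor_fn_continuous[OF that] continuous_on_subset by blast
        show "tensor_fn (\<lambda>z. P z + Q z)" if "tensor_fn P \<and> tensor_fn Q" for P Q
          using that by (intro tensor_fn.add) auto
        show "tensor_fn (\<lambda>z. P z * Q z)" if "tensor_fn P \<and> tensor_fn Q" for P Q
          using that by (intro tensor_fn_mult) auto
        fix z w assume zw: "z \<in> X \<and> w \<in> X \<and> z \<noteq> w"
        have sep: "\<exists>p :: 'g \<Rightarrow> real. continuous_on UNIV p \<and> p a \<noteq> p b" if "a \<noteq> b" for a b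
        proof -
          have "open (- {b})" "a \<in> - {b}" using that by auto
          from ex_bump[OF this] show ?thesis by (elim exE conjE) (intro exI conjI, assumption, auto)
        qed
        show "\<exists>P. tensor_fn P \<and> P z \<noteq> P w"
        proof (cases "fst z = fst w")
          case False
          obtain p :: "'g \<Rightarrow> real" where "continuous_on UNIV p" "p (fst z) \<noteq> p (fst w)" using sep[OF False] by blast
          then show ?thesis using tensor_fn.pure[of p "\<lambda>_. 1"] by (intro exI[of _ "\<lambda>z. p (fst z) * 1"]) auto
        next
          case True
          then have "snd z \<noteq> snd w" using zw by (auto simp: prod_eq_iff)
          from sep[OF this] obtain p :: "'g \<Rightarrow> real" where "continuous_on UNIV p" "p (snd z) \<noteq> p (snd w)" by blast
          then show ?thesis using tensor_fn.pure[of "\<lambda>_. 1" p] by (intro exI[of _ "\<lambda>z. 1 * p (snd z)"]) auto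
        qed
      qed (use that in auto)
      then show ?thesis .
    qed
    \<comment> \<open>The linear map from kernels to functions that sends a product kernel of
      \<open>p\<close> and \<open>q\<close> to the convolution of \<open>p\<close> with
      \<open>q\<close> times \<open>g\<close>, for \<open>p\<close> vanishing off \<open>L1\<close>,
      and sends \<open>F\<close> to the function to be approximated.\<close>
    define T where "T \<Phi> c = (\<Sum>a\<in>{a \<in> L1. rng G a = rng G c}. \<Phi> (a, gmul G (ginv G a) c) * g (gmul G (ginv G a) c))"
      for \<Phi> :: "'g \<times> 'g \<Rightarrow> complex" and c
    have finL1: "finite {a \<in> L1. rng G a = x}" for x using compact_fibres[OF L1(1)] by blast
    have TF: "T F c = h c * conv G f g c" for c
    proof -
      have "conv G f g c = (\<Sum>a\<in>{a \<in> L1. rng G a = rng G c}. f a * g (gmul G (ginv G a) c))"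
        using K1(2) L1(2) by (intro conv_rng_finite finL1) auto
      then show ?thesis by (simp add: T_def F_def sum_distrib_left mult.assoc)
    qed
    \<comment> \<open>An approximant is controlled on \<open>X\<close> only. The two cut-offs remove
      it outside \<open>L1 \<times> L2\<close>, keep its product form and put both factors of each
      product into C_c(G).\<close>
    define cutP where "cutP P z = complex_of_real (\<eta>1 (fst z) * \<eta>2 (snd z) * P z)" for P and z :: "'g \<times> 'g"
    have T_tensor: "T (\<lambda>z. cutP P z) \<in> cstar_fns" if "tensor_fn P" for P
      using that
    proof (induction rule: tensor_fn.induct)
      case (pure p q)
      let ?p = "\<lambda>a. of_real (p a * \<eta>1 a) :: complex" and ?q = "\<lambda>a. of_real (q a * \<eta>2 a) :: complex"
      have "?p \<in> Cc_fns" "?q \<in> Cc_fns"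
        using L1 L2 by (intro real_Cc[of _ L1] real_Cc[of _ L2] continuous_on_mult pure \<eta>1 \<eta>2; simp)+
      then have "conv G ?p (\<lambda>a. ?q a * g a) \<in> cstar_fns"
        by (intro cstar_fns_ops(4) Cc_cstar_fns gm)
      also have "conv G ?p (\<lambda>a. ?q a * g a) = T (\<lambda>z. cutP (\<lambda>z. p (fst z) * q (snd z)) z)"
      proof
        fix c
        have "conv G ?p (\<lambda>a. ?q a * g a) c = (\<Sum>a\<in>{a \<in> L1. rng G a = rng G c}. ?p a * (?q (gmul G (ginv G a) c) * g (gmul G (ginv G a) c)))"
          using L1(3) by (intro conv_rng_finite finL1) auto
        then show "conv G ?p (\<lambda>a. ?q a * g a) c = T (\<lambda>z. cutP (\<lambda>z. p (fst z) * q (snd z)) z) c"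
          by (simp add: T_def cutP_def mult_ac)
      qed
      finally show ?case .
    next
      case (add P Q)
      have "T (\<lambda>z. cutP (\<lambda>z. P z + Q z) z) = (\<lambda>c. T (\<lambda>z. cutP P z) c + T (\<lambda>z. cutP Q z) c)"
        by (simp add: T_def cutP_def distrib_left distrib_right sum.distrib fun_eq_iff)
      then show ?case using cstar_fns_ops(2)[OF add.IH] by simp
    qed
    define M where "M = {gmul G a b |a b. a \<in> L1 \<and> b \<in> L2 \<and> src G a = rng G b}"
    have "compact M" unfolding M_def by (rule compact_mult[OF L1(1) L2(1)])
    then obtain N where N: "N \<ge> 0" "\<forall>f B. 0 \<le> B \<longrightarrow> (\<forall>a. cmod (f a) \<le> B) \<longrightarrow> (\<forall>a. a \<notin> M \<longrightarrow> f a = 0) \<longrightarrow> op_bound G f (B * N)"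
      using op_bound_compact by blast
    obtain N1 :: nat where N1: "\<forall>x. finite {a \<in> L1. rng G a = x} \<and> card {a \<in> L1. rng G a = x} \<le> N1"
      using compact_fibres[OF L1(1)] by blast
    \<comment> \<open>The constant collects the factor 2 from real and imaginary part, at most
      \<open>N1\<close> terms per sum, the bound \<open>Bg\<close> of \<open>g\<close>, and
      \<open>N\<close> for passing from supremum to operator norm.\<close>
    have approx: "\<exists>k\<in>cstar_fns. opnorm G (\<lambda>c. k c - h c * conv G f g c) \<le> \<epsilon> * (2 * real N1 * Bg * N)" if \<epsilon>: "0 < \<epsilon>" for \<epsilon>
    proof -
      obtain P where P: "tensor_fn P" "\<forall>z\<in>X. \<bar>Re (F z) - P z\<bar> < \<epsilon>"
        using sw[OF continuous_on_Re[OF Fc] \<epsilon>] by blast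
      obtain Q where Q: "tensor_fn Q" "\<forall>z\<in>X. \<bar>Im (F z) - Q z\<bar> < \<epsilon>"
        using sw[OF continuous_on_Im[OF Fc] \<epsilon>] by blast
      define k where "k c = T (\<lambda>z. cutP P z) c + \<i> * T (\<lambda>z. cutP Q z) c" for c
      have k: "k \<in> cstar_fns"
        unfolding k_def using cstar_fns_ops(2)[OF T_tensor[OF P(1)] cstar_fns_ops(3)[OF T_tensor[OF Q(1)], of \<i>]] .
      define \<Delta> where "\<Delta> z = cutP P z + \<i> * cutP Q z - F z" for z
      have eq: "k c - h c * conv G f g c = T \<Delta> c" for c
        unfolding TF[symmetric] k_def
        by (simp add: T_def \<Delta>_def sum_subtractf sum.distrib sum_distrib_left algebra_simps)
      have \<Delta>0: "\<Delta> (a, b) = 0" if "src G a = rng G b" "a \<notin> L1 \<or> b \<notin> L2" for a b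
      proof -
        have "F (a, b) = 0" using that L1(2) L2(2) by (intro F0) auto
        then show ?thesis using that L1(3) L2(3) by (auto simp: \<Delta>_def cutP_def)
      qed
      have \<Delta>\<epsilon>: "cmod (\<Delta> (a, b)) \<le> 2 * \<epsilon>" if ab: "src G a = rng G b" for a b
      proof (cases "a \<in> L1 \<and> b \<in> L2")
        case False
        then show ?thesis using \<Delta>0[OF ab] \<epsilon> by simp
      next
        case True
        then have z: "(a, b) \<in> X" using ab by (simp add: X_def)
        let ?c = "\<eta>1 a * \<eta>2 b" and ?d = "Complex (P (a, b) - Re (F (a, b))) (Q (a, b) - Im (F (a, b)))"
        have c01: "0 \<le> ?c" "?c \<le> 1" using \<eta>1(2) \<eta>2(2) by (auto simp: mult_le_one)
        \<comment> \<open>The cut-offs equal 1 wherever \<open>F\<close> is nonzero, so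
          \<open>F\<close> absorbs them and the error is the cut-off times the approximation error
          on \<open>X\<close>.\<close>
        have "F (a, b) = of_real ?c * F (a, b)"
          using F0[OF ab] \<eta>1(3) \<eta>2(3) by (cases "a \<in> K1 \<and> b \<in> K2") auto
        then have "\<Delta> (a, b) = of_real ?c * (of_real (P (a, b)) + \<i> * of_real (Q (a, b)) - F (a, b))"
          unfolding \<Delta>_def cutP_def by (simp add: algebra_simps)
        also have "of_real (P (a, b)) + \<i> * of_real (Q (a, b)) - F (a, b) = ?d"
          by (simp add: complex_eq_iff)
        finally have "cmod (\<Delta> (a, b)) = ?c * cmod ?d"
          using \<eta>1(2) \<eta>2(2) by (simp add: norm_mult)
        also have "\<dots> \<le> 1 * cmod ?d" using c01 by (intro mult_right_mono) auto
        also have "cmod ?d \<le> \<bar>Re ?d\<bar> + \<bar>Im ?d\<bar>" by (rule cmod_le)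
        also have "\<dots> \<le> 2 * \<epsilon>" using P(2)[rule_format, OF z] Q(2)[rule_format, OF z] by (simp add: abs_minus_commute)
        finally show ?thesis by simp
      qed
      have "op_bound G (T \<Delta>) ((real N1 * (2 * \<epsilon> * Bg)) * N)"
      proof (rule N(2)[rule_format])
        show "0 \<le> real N1 * (2 * \<epsilon> * Bg)" using \<epsilon> Bg by simp
        show "cmod (T \<Delta> c) \<le> real N1 * (2 * \<epsilon> * Bg)" for c
        proof -
          have "cmod (T \<Delta> c) \<le> (\<Sum>a\<in>{a \<in> L1. rng G a = rng G c}. 2 * \<epsilon> * Bg)"
            unfolding T_def using \<Delta>\<epsilon> Bg \<epsilon>
            by (intro order_trans[OF norm_sum] sum_mono) (auto simp: norm_mult intro!: mult_mono)
          also have "\<dots> \<le> real N1 * (2 * \<epsilon> * Bg)"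
            using N1 Bg \<epsilon> by (auto intro!: mult_right_mono)
          finally show ?thesis .
        qed
        show "T \<Delta> c = 0" if "c \<notin> M" for c
          unfolding T_def
        proof (intro sum.neutral ballI)
          fix a assume a: "a \<in> {a \<in> L1. rng G a = rng G c}"
          have "gmul G (ginv G a) c \<notin> L2"
          proof
            assume "gmul G (ginv G a) c \<in> L2"
            then have "gmul G a (gmul G (ginv G a) c) \<in> M"
              unfolding M_def using a by (intro CollectI exI conjI) auto
            then show False using that a by simp
          qed
          then have "\<Delta> (a, gmul G (ginv G a) c) = 0" using a by (intro \<Delta>0) auto
          then show "\<Delta> (a, gmul G (ginv G a) c) * g (gmul G (ginv G a) c) = 0" by simp
        qed
      qed
      then have "opnorm G (\<lambda>c. k c - h c * conv G f g c) \<le> (real N1 * (2 * \<epsilon> * Bg)) * N"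
        unfolding eq by (intro opnorm_le) simp
      then show ?thesis using k by (intro bexI[of _ k]) (simp_all add: mult_ac)
    qed
    have "(\<lambda>c. h c * conv G f g c) \<in> op_closure G cstar_fns"
    proof (rule op_closureI)
      show "(\<lambda>c. h c * conv G f g c) \<in> op_bounded G"
        using mult_op_bounded[OF h] cstar_fns_bounded[OF fg] op_boundedI by blast
      show "cstar_fns \<subseteq> op_bounded G" using cstar_fns_bounded by blast
      fix e :: real assume e: "0 < e"
      define C where "C = 2 * real N1 * Bg * N"
      have C: "0 \<le> C" unfolding C_def using Bg N(1) by simp
      \<comment> \<open>\<open>C\<close> may be 0, hence the denominator
        \<open>C + 1\<close>.\<close>
      have pos: "0 < e / (C + 1)" using C e by simp
      obtain k where k: "k \<in> cstar_fns" "opnorm G (\<lambda>c. k c - h c * conv G f g c) \<le> e / (C + 1) * C"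
        using approx[OF pos] unfolding C_def[symmetric] by blast
      have "e / (C + 1) * C < e" using C e by (simp add: divide_simps)
      then show "\<exists>k\<in>cstar_fns. opnorm G (\<lambda>c. k c - h c * conv G f g c) < e" using k by (intro bexI[of _ k]) auto
    qed
    then show ?thesis unfolding op_closure_def using cstar_fns_oplim by blast
  qed
  then show ?thesis using fg Bc_conv[OF fB gB] by (simp add: multipliable_def)
qed

section \<open>A dense star-algebra of multipliable functions\<close>

lemma multipliable_add: "f \<in> multipliable \<Longrightarrow> g \<in> multipliable \<Longrightarrow> (\<lambda>a. f a + g a) \<in> multipliable"
  using cstar_fns_ops(2) Bc_add by (simp add: multipliable_def distrib_left)

lemma multipliable_scale: "f \<in> multipliable \<Longrightarrow> (\<lambda>a. z * f a) \<in> multipliable"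
  using cstar_fns_ops(3)[of _ z] Bc_scale by (simp add: multipliable_def mult.left_commute)

lemma multipliable_zero: "(\<lambda>a. 0) \<in> multipliable"
  using cstar_fns_ops(1) Bc_zero by (simp add: multipliable_def)

lemma Cc_multipliable: "f \<in> Cc_fns \<Longrightarrow> f \<in> multipliable"
  unfolding multipliable_def using Cc_cstar_fns Cc_subset_Bc Cc_mult continuous_compact_support_iff by blast

text \<open>Closure of \<open>multipliable\<close> under products is not apparent, but the elements
  that stabilise it from the left are closed under products by associativity. The condition on
  \<open>invol G a\<close> makes the set invariant under the involution.\<close>

definition left_multipliers :: "('g \<Rightarrow> complex) set" where
  "left_multipliers = {a \<in> Bc_fns \<inter> cstar_fns. \<forall>g\<in>multipliable. conv G a g \<in> multipliable \<and> conv G (invol G a) g \<in> multipliable}"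

lemma star_closed_left_multipliers: "star_closed (reg_alg G) left_multipliers"
proof -
  have M: "g \<in> op_bounded G" if "g \<in> multipliable" for g using that Bc_op_bounded by (simp add: multipliable_def)
  show ?thesis
    unfolding star_closed_def reg_alg_simps
  proof (intro conjI ballI allI)
    have "invol G (\<lambda>a. 0) = (\<lambda>a. 0)" by (simp add: invol_def fun_eq_iff)
    then show "(\<lambda>a. 0) \<in> left_multipliers"
      using cstar_fns_ops(1) Bc_zero by (simp add: left_multipliers_def multipliable_zero)
  next
    fix f g assume fg: "f \<in> left_multipliers" "g \<in> left_multipliers"
    then have B: "f \<in> Bc_fns" "g \<in> Bc_fns" "f \<in> cstar_fns" "g \<in> cstar_fns" by (auto simp: left_multipliers_def)
    then have b: "f \<in> op_bounded G" "g \<in> op_bounded G" "invol G f \<in> op_bounded G" "invol G g \<in> op_bounded G"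
      by (auto simp: Bc_op_bounded op_bounded_invol)
    show "(\<lambda>a. f a + g a) \<in> left_multipliers"
      unfolding left_multipliers_def
      using fg B b by (simp add: Bc_add cstar_fns_ops(2) invol_add conv_add_left M multipliable_add left_multipliers_def)
    show "conv G f g \<in> left_multipliers"
      unfolding left_multipliers_def
      using fg B by (simp add: Bc_conv cstar_fns_ops(4) invol_conv Bc_conv_assoc Bc_invol left_multipliers_def)
  next
    fix f z assume f: "f \<in> left_multipliers"
    then show "(\<lambda>a. z * f a) \<in> left_multipliers"
      by (simp add: left_multipliers_def Bc_scale cstar_fns_ops(3) invol_scale conv_scale_left multipliable_scale)
    show "invol G f \<in> left_multipliers"
      using f by (simp add: left_multipliers_def Bc_invol cstar_fns_ops(5))
  qed
qed

lemma left_multipliers_subset: "left_multipliers \<subseteq> Bc_fns"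
  by (auto simp: left_multipliers_def)

text \<open>The norm closure of \<open>left_multipliers\<close> is a C*-subalgebra containing
  C_c(G), and \<open>cstar_fns\<close> is the smallest one.\<close>

lemma cstar_fns_subset_closure: "cstar_fns \<subseteq> op_closure G left_multipliers"
  unfolding cstar_fns_def
proof (rule cstar_generated_least[OF cstar_subalgebra_op_closure[OF left_multipliers_subset star_closed_left_multipliers]])
  have "Cc_fns \<subseteq> left_multipliers"
    using Cc_subset_Bc Cc_cstar_fns Cc_invol conv_multipliable by (auto simp: left_multipliers_def)
  also have "\<dots> \<subseteq> op_closure G left_multipliers"
    using left_multipliers_subset Bc_subset by (intro op_closure_superset) blast
  finally show "Cc_fns \<subseteq> op_closure G left_multipliers" .
qed

text \<open>A cut-off \<open>e\<close> on the unit space that equals 1 on the sources of the support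
  satisfies \<open>conv G f e = f\<close>. Since \<open>e\<close> is multipliable and
  \<open>f\<close> stabilises that class, \<open>f\<close> is multipliable too.\<close>

lemma left_multipliers_multipliable: "left_multipliers \<subseteq> multipliable"
proof
  fix f assume f: "f \<in> left_multipliers"
  then obtain K where K: "compact K" "\<forall>a. a \<notin> K \<longrightarrow> f a = 0"
    by (auto simp: left_multipliers_def bounded_compact_support_iff)
  have "compact (src G ` K)" using K(1) continuous_src by (meson compact_continuous_image continuous_on_subset subset_UNIV)
  from ex_cutoff[OF this] obtain \<eta> L where \<eta>: "continuous_on UNIV \<eta>" "\<forall>b\<in>src G ` K. \<eta> b = (1::real)"
    and L: "compact L" "\<forall>b. b \<notin> L \<longrightarrow> \<eta> b = 0" by blast
  define e where "e a = (if a \<in> units G then complex_of_real (\<eta> a) else 0)" for a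
  have "e \<in> Cc_fns" unfolding e_def using \<eta> L by (intro unit_cutoff_Cc) auto
  then have "conv G f e \<in> multipliable"
    using f Cc_multipliable by (simp add: left_multipliers_def)
  moreover have "conv G f e = f"
  proof
    fix c
    have "conv G f e c = f c * e (src G c)" by (rule conv_units_right) (simp add: e_def)
    also have "\<dots> = f c"
      using K(2) \<eta>(2) by (cases "c \<in> K") (auto simp: e_def units_def)
    finally show "conv G f e c = f c" .
  qed
  ultimately show "f \<in> multipliable" by simp
qed

lemma mult_cstar_fns:
  assumes h: "h \<in> Cc_fns" and f: "f \<in> cstar_fns"
  shows "(\<lambda>a. h a * f a) \<in> cstar_fns"
proof -
  obtain X where X: "\<And>n. X n \<in> left_multipliers" "oplim G X f"
    using f cstar_fns_subset_closure by (auto simp: op_closure_def)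
  have "(\<lambda>a. h a * X n a) \<in> cstar_fns" for n
    using X(1) left_multipliers_multipliable h by (auto simp: multipliable_def)
  then show ?thesis by (rule cstar_fns_oplim[OF _ oplim_mult[OF h X(2)]])
qed

end

section \<open>The isotropy subalgebra\<close>

lemma discrete_compact_imp_finite:
  fixes S :: "'a::topological_space set"
  assumes "compact S" "discrete S"
  shows "finite S"
proof -
  have "\<forall>x. \<exists>T. x \<in> S \<longrightarrow> open T \<and> T \<inter> S = {x}"
    using assms(2) unfolding discrete_def isolated_in_def by blast
  from choice[OF this] obtain T where T: "\<And>x. x \<in> S \<Longrightarrow> open (T x) \<and> T x \<inter> S = {x}" by auto
  then have "S \<subseteq> (\<Union>x\<in>S. T x)" by auto
  then obtain C where C: "C \<subseteq> S" "finite C" "S \<subseteq> (\<Union>x\<in>C. T x)"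
    using compactE_image[OF assms(1), of S T] T by auto
  have "S \<subseteq> C"
  proof
    fix x assume x: "x \<in> S"
    then obtain y where "y \<in> C" "x \<in> T y" using C(3) by auto
    then have "T y \<inter> S = {y}" using T[of y] C(1) by auto
    moreover have "x \<in> T y \<inter> S" using x \<open>x \<in> T y\<close> by simp
    ultimately show "x \<in> C" using \<open>y \<in> C\<close> by simp
  qed
  then show ?thesis using C(2) finite_subset by blast
qed

definition point_fn :: "'g \<Rightarrow> 'g \<Rightarrow> complex" where
  "point_fn c a = (if a = c then 1 else 0)"

context groupoid
begin

section \<open>Point functions and compatibility of compression with convolution\<close>

lemma pos_semidef_scale:
  assumes "pos_semidef G f" "0 \<le> s"
  shows "pos_semidef G (\<lambda>a. complex_of_real s * f a)"
  unfolding pos_semidef_def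
proof (intro allI impI)
  fix x S and \<phi> :: "'g \<Rightarrow> complex"
  assume S: "finite S" "S \<subseteq> {a. src G a = x}"
  obtain r where r: "0 \<le> r" "(\<Sum>a\<in>S. \<Sum>b\<in>S. cnj (\<phi> a) * f (gmul G a (ginv G b)) * \<phi> b) = of_real r"
    using assms(1) S unfolding pos_semidef_def by blast
  have "(\<Sum>a\<in>S. \<Sum>b\<in>S. cnj (\<phi> a) * (of_real s * f (gmul G a (ginv G b))) * \<phi> b) =
      of_real s * (\<Sum>a\<in>S. \<Sum>b\<in>S. cnj (\<phi> a) * f (gmul G a (ginv G b)) * \<phi> b)"
    by (simp add: sum_distrib_left mult_ac)
  then show "\<exists>r\<ge>0. (\<Sum>a\<in>S. \<Sum>b\<in>S. cnj (\<phi> a) * (of_real s * f (gmul G a (ginv G b))) * \<phi> b) = of_real r"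
    unfolding r(2) using r(1) assms(2) by (intro exI[of _ "s * r"]) simp
qed

lemma isotropy_ginv: "a \<in> isotropy G \<Longrightarrow> ginv G a \<in> isotropy G"
  by (simp add: isotropy_def)

lemma isotropy_gmul: "a \<in> isotropy G \<Longrightarrow> b \<in> isotropy G \<Longrightarrow> src G a = rng G b \<Longrightarrow> gmul G a b \<in> isotropy G"
  by (simp add: isotropy_def)

lemma units_isotropy: "units G \<subseteq> isotropy G"
  by (auto simp: isotropy_def units_def)

lemma conv_point:
  assumes "src G p = rng G q"
  shows "conv G (point_fn p) (point_fn q) = point_fn (gmul G p q)"
proof
  fix c
  show "conv G (point_fn p) (point_fn q) c = point_fn (gmul G p q) c"
  proof (cases "rng G c = rng G p")
    case True
    have "conv G (point_fn p) (point_fn q) c = point_fn p p * point_fn q (gmul G (ginv G p) c)"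
      unfolding conv_rng by (rule infsum_single) (auto simp: point_fn_def True)
    moreover have "gmul G (ginv G p) c = q \<longleftrightarrow> c = gmul G p q"
      using True assms by (metis cancel_ginv_left ginv_cancel_left)
    ultimately show ?thesis by (simp add: point_fn_def)
  next
    case False
    have "conv G (point_fn p) (point_fn q) c = 0"
      unfolding conv_rng using False by (intro infsum_0) (auto simp: point_fn_def)
    moreover have "c \<noteq> gmul G p q" using False assms by auto
    ultimately show ?thesis by (simp add: point_fn_def)
  qed
qed

lemma invol_point: "invol G (point_fn c) = point_fn (ginv G c)"
  by (auto simp: invol_def point_fn_def fun_eq_iff)

text \<open>For \<open>a \<in> H\<close> the element \<open>a^{-1} c\<close> lies in
  \<open>H\<close> exactly if \<open>c\<close> does, so the cut commutes with the sum term by term.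
  This is the bimodule property of the expectation.\<close>

lemma cut_conv_left:
  assumes H: "wide_subgroupoid G H" and d: "\<And>a. a \<notin> H \<Longrightarrow> d a = 0"
  shows "cut H (conv G d f) = conv G d (cut H f)"
proof
  fix c
  have mem: "gmul G (ginv G a) c \<in> H \<longleftrightarrow> c \<in> H" if "rng G a = rng G c" "a \<in> H" for a
  proof
    assume "gmul G (ginv G a) c \<in> H"
    moreover have "src G a = rng G (gmul G (ginv G a) c)" using that by simp
    ultimately have "gmul G a (gmul G (ginv G a) c) \<in> H" using H that(2) unfolding wide_subgroupoid_def by blast
    then show "c \<in> H" using that by simp
  next
    assume "c \<in> H"
    moreover have "ginv G a \<in> H" "src G (ginv G a) = rng G c" using that H by (auto simp: wide_subgroupoid_def)
    ultimately show "gmul G (ginv G a) c \<in> H" using H unfolding wide_subgroupoid_def by blast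
  qed
  have "d a * cut H f (gmul G (ginv G a) c) = (if c \<in> H then d a * f (gmul G (ginv G a) c) else 0)"
    if "a \<in> {a. rng G a = rng G c}" for a
    using mem[of a] d[of a] that by (cases "a \<in> H") (auto simp: cut_def)
  then have "conv G d (cut H f) c = (\<Sum>\<^sub>\<infinity>a\<in>{a. rng G a = rng G c}. if c \<in> H then d a * f (gmul G (ginv G a) c) else 0)"
    unfolding conv_rng by (rule infsum_cong)
  then show "cut H (conv G d f) c = conv G d (cut H f) c"
    by (cases "c \<in> H") (simp_all add: cut_def conv_rng)
qed

lemma cut_invol: "wide_subgroupoid G H \<Longrightarrow> cut H (invol G f) = invol G (cut H f)"
  unfolding wide_subgroupoid_def by (auto simp: cut_def invol_def fun_eq_iff)

lemma cut_conv_right: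
  assumes H: "wide_subgroupoid G H" and d: "\<And>a. a \<notin> H \<Longrightarrow> d a = 0"
  shows "cut H (conv G f d) = conv G (cut H f) d"
proof -
  have "invol G d a = 0" if "a \<notin> H" for a
    using d H that unfolding invol_def wide_subgroupoid_def by (metis complex_cnj_zero ginv_ginv)
  from cut_conv_left[OF H this, where f = "invol G f"]
  have "invol G (cut H (conv G f d)) = invol G (conv G (cut H f) d)"
    by (simp add: invol_conv cut_invol[OF H, symmetric])
  then show ?thesis by (metis invol_invol)
qed

lemma star_mult_unit_zero:
  assumes f: "f \<in> op_bounded G" and z: "conv G (invol G f) f (src G d) = 0"
  shows "f d = 0"
proof -
  have "((\<lambda>b. invol G f (gmul G (src G d) (ginv G b)) * f b) has_sum conv G (invol G f) f (src G d)) {b. src G b = src G (src G d)}"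
    by (rule conv_has_sum_src[OF op_bounded_invol[OF f] f])
  then have "((\<lambda>b. invol G f (gmul G (src G d) (ginv G b)) * f b) has_sum 0) {b. src G b = src G d}"
    unfolding z by simp
  then have hs: "((\<lambda>b. complex_of_real ((cmod (f b))\<^sup>2)) has_sum 0) {b. src G b = src G d}"
  proof (rule has_sum_cong[THEN iffD1, rotated])
    fix b assume "b \<in> {b. src G b = src G d}"
    then have "gmul G (src G d) (ginv G b) = ginv G b" by simp
    then show "invol G f (gmul G (src G d) (ginv G b)) * f b = complex_of_real ((cmod (f b))\<^sup>2)"
      unfolding complex_norm_square by (simp add: invol_def mult.commute)
  qed
  have "((\<lambda>b. (cmod (f b))\<^sup>2) has_sum 0) {b. src G b = src G d}"
    using has_sum_Re[OF hs] by simp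
  then have "(cmod (f d))\<^sup>2 = 0"
    by (rule nonneg_has_sum_le_0D) auto
  then show ?thesis by simp
qed

end

context semi_etale_groupoid
begin

definition cstar_alg :: "('g \<Rightarrow> complex) star_algebra" where
  "cstar_alg = reg_alg G\<lparr>acarrier := cstar_fns\<rparr>"

lemma cstar_alg_simps [simp]: "acarrier cstar_alg = cstar_fns"
  "azero cstar_alg = (\<lambda>a. 0)"
  "aplus cstar_alg f g = (\<lambda>a. f a + g a)" "ascale cstar_alg z f = (\<lambda>a. z * f a)"
  "atimes cstar_alg f g = conv G f g" "astar cstar_alg f = invol G f" "anorm cstar_alg f = opnorm G f"
  by (simp_all add: cstar_alg_def)

lemma adist_cstar_alg: "adist cstar_alg f g = opnorm G (\<lambda>a. f a - g a)"
  by (simp add: adist_def)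

lemma star_closed_cstar_alg: "star_closed cstar_alg B \<longleftrightarrow> star_closed (reg_alg G) B"
  by (simp add: star_closed_def)

text \<open>A limit in the larger algebra of elements of \<open>B\<close> already lies in the
  norm-closed \<open>cstar_fns\<close>, where closedness of \<open>B\<close> is known.\<close>

lemma cstar_subalgebra_cstar_alg:
  assumes "cstar_subalgebra cstar_alg B"
  shows "cstar_subalgebra (reg_alg G) B"
  unfolding cstar_subalgebra_iff
proof (intro conjI allI ballI impI)
  have B: "B \<subseteq> cstar_fns" "star_closed (reg_alg G) B"
    using assms by (simp_all add: cstar_subalgebra_iff star_closed_cstar_alg)
  then show "B \<subseteq> acarrier (reg_alg G)" "star_closed (reg_alg G) B" using cstar_fns_carrier by auto
  fix X f assume f: "f \<in> acarrier (reg_alg G)" and "(\<forall>n. X n \<in> B) \<and> (\<lambda>n. adist (reg_alg G) (X n) f) \<longlonglongrightarrow> 0"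
  then have X: "\<And>n. X n \<in> B" and lim: "(\<lambda>n. opnorm G (\<lambda>a. X n a - f a)) \<longlonglongrightarrow> 0"
    by (simp_all add: adist_reg_alg)
  have Xc: "\<And>n. X n \<in> cstar_fns" using B(1) X by blast
  have "oplim G X f"
    unfolding oplim_def using lim cstar_fns_bounded[OF Xc] op_closure_bounded f by simp
  then have "f \<in> cstar_fns" by (rule cstar_fns_oplim[OF Xc])
  then show "f \<in> B"
    using cstar_subalgebra_closed[OF assms, of f X] X lim by (simp add: adist_cstar_alg)
qed

section \<open>D' is a maximal abelian subalgebra\<close>

lemma isotropy_fnsD: "f \<in> isotropy_fns \<Longrightarrow> f \<in> cstar_fns" "f \<in> isotropy_fns \<Longrightarrow> a \<notin> isotropy G \<Longrightarrow> f a = 0"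
  by (auto simp: isotropy_fns_def)

lemma star_closed_isotropy_fns: "star_closed (reg_alg G) isotropy_fns"
proof -
  have "conv G f g c = 0" if "\<forall>a. a \<notin> isotropy G \<longrightarrow> f a = 0" "\<forall>a. a \<notin> isotropy G \<longrightarrow> g a = 0" "c \<notin> isotropy G" for f g c
  proof (rule ccontr)
    assume "conv G f g c \<noteq> 0"
    then obtain a b where ab: "f a \<noteq> 0" "g b \<noteq> 0" "src G a = rng G b" "c = gmul G a b"
      by (rule conv_nonzeroE)
    then have "a \<in> isotropy G" "b \<in> isotropy G" using that(1,2) by blast+
    then show False using isotropy_gmul ab that(3) by blast
  qed
  moreover have "invol G f c = 0" if "\<forall>a. a \<notin> isotropy G \<longrightarrow> f a = 0" "c \<notin> isotropy G" for f c
    using that isotropy_ginv[of "ginv G c"] by (auto simp: invol_def)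
  ultimately show ?thesis
    unfolding star_closed_def reg_alg_simps isotropy_fns_def using cstar_fns_ops by simp
qed

lemma cstar_subalgebra_isotropy_fns: "cstar_subalgebra cstar_alg isotropy_fns"
  unfolding cstar_subalgebra_iff
proof (intro conjI allI ballI impI)
  show "isotropy_fns \<subseteq> acarrier cstar_alg" by (auto simp: isotropy_fns_def)
  show "star_closed cstar_alg isotropy_fns" by (simp add: star_closed_cstar_alg star_closed_isotropy_fns)
  fix X f assume f: "f \<in> acarrier cstar_alg" and "(\<forall>n. X n \<in> isotropy_fns) \<and> (\<lambda>n. adist cstar_alg (X n) f) \<longlonglongrightarrow> 0"
  then have X: "\<And>n. X n \<in> isotropy_fns" and lim: "(\<lambda>n. opnorm G (\<lambda>a. X n a - f a)) \<longlonglongrightarrow> 0"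
    by (simp_all add: adist_cstar_alg)
  have "oplim G X f"
    unfolding oplim_def using lim cstar_fns_bounded[OF isotropy_fnsD(1)[OF X]] cstar_fns_bounded f by simp
  have "f a = 0" if "a \<notin> isotropy G" for a
  proof -
    have "(\<lambda>n. X n a) \<longlonglongrightarrow> f a" using \<open>oplim G X f\<close> by (rule oplim_pointwise)
    then have "(\<lambda>n::nat. 0) \<longlonglongrightarrow> f a" using isotropy_fnsD(2)[OF X that] by simp
    then show ?thesis using LIMSEQ_unique tendsto_const by metis
  qed
  then show "f \<in> isotropy_fns" using f by (simp add: isotropy_fns_def)
qed

lemmas isotropy_fns_ops = star_closedD[OF star_closed_isotropy_fns, unfolded reg_alg_simps]

lemma abelian_isotropy_fns:
  assumes ab: "abelian_isotropy G"
  shows "abelian cstar_alg isotropy_fns"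
  unfolding abelian_def cstar_alg_simps
proof (intro ballI ext)
  fix f g c assume fg: "f \<in> isotropy_fns" "g \<in> isotropy_fns"
  let ?P = "{(a, b). a \<in> isotropy G \<and> b \<in> isotropy G \<and> src G a = rng G b \<and> gmul G a b = c}"
  have eq: "conv G f g c = (\<Sum>\<^sub>\<infinity>(a, b)\<in>?P. f a * g b)" if fg: "f \<in> isotropy_fns" "g \<in> isotropy_fns" for f g
    unfolding conv_def
  proof (rule infsum_cong_neutral)
    fix z assume z: "z \<in> {(a, b). src G a = rng G b \<and> gmul G a b = c} - ?P"
    then have "fst z \<notin> isotropy G \<or> snd z \<notin> isotropy G" by auto
    then have "f (fst z) * g (snd z) = 0"
      using isotropy_fnsD(2)[OF fg(1)] isotropy_fnsD(2)[OF fg(2)] by auto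
    then show "(case z of (a, b) \<Rightarrow> f a * g b) = 0" by (simp add: case_prod_unfold)
  qed auto
  have "(\<Sum>\<^sub>\<infinity>(a, b)\<in>?P. f a * g b) = (\<Sum>\<^sub>\<infinity>(a, b)\<in>?P. g a * f b)"
  proof -
    \<comment> \<open>For isotropy elements composability means having the same base point, which is
      symmetric; commutativity of the isotropy keeps the product equal to \<open>c\<close>.\<close>
    have sw: "prod.swap z \<in> ?P" if "z \<in> ?P" for z
      using that ab unfolding abelian_isotropy_def by (auto simp: isotropy_def)
    show ?thesis
      by (rule infsum_reindex_bij_witness[where i = prod.swap and j = prod.swap])
        (erule sw | simp add: case_prod_unfold mult.commute)+
  qed
  then show "conv G f g c = conv G g f c" by (simp only: eq fg)
qed

lemma unit_Cc_isotropy_fns: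
  assumes "e \<in> Cc_fns" "\<And>a. a \<notin> units G \<Longrightarrow> e a = 0"
  shows "e \<in> isotropy_fns"
  unfolding isotropy_fns_def using Cc_cstar_fns[OF assms(1)] assms(2) units_isotropy by blast

lemma maximal_abelian_isotropy_fns:
  assumes ab: "abelian_isotropy G"
  shows "maximal_abelian cstar_alg isotropy_fns"
  unfolding maximal_abelian_def
proof (intro conjI allI impI cstar_subalgebra_isotropy_fns abelian_isotropy_fns[OF ab])
  fix E assume "cstar_subalgebra cstar_alg E \<and> abelian cstar_alg E \<and> isotropy_fns \<subseteq> E"
  then have E: "E \<subseteq> cstar_fns" "abelian cstar_alg E" "isotropy_fns \<subseteq> E"
    by (simp_all add: cstar_subalgebra_iff)
  have "f a = 0" if f: "f \<in> E" and a: "a \<notin> isotropy G" for f a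
  proof -
    \<comment> \<open>Commuting with a function on the units that is 1 at \<open>rng G a\<close> and
      0 at \<open>src G a\<close> forces \<open>f a = 0\<close>.\<close>
    have "open (- {src G a})" "rng G a \<in> - {src G a}" using a by (auto simp: isotropy_def)
    from ex_bump[OF this] obtain \<eta> :: "'g \<Rightarrow> real" and K V where \<eta>: "continuous_on UNIV \<eta>"
      and K: "compact K" "\<forall>b. b \<notin> K \<longrightarrow> \<eta> b = 0" and "\<forall>b. b \<notin> - {src G a} \<longrightarrow> \<eta> b = 0"
      and "rng G a \<in> V" "\<forall>b\<in>V. \<eta> b = 1"
      by (elim exE conjE) (rule that)
    then have ra: "\<eta> (rng G a) = 1" and sa: "\<eta> (src G a) = 0" by auto
    define e where "e b = (if b \<in> units G then complex_of_real (\<eta> b) else 0)" for b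
    have e0: "e b = 0" if "b \<notin> units G" for b using that by (simp add: e_def)
    have "e \<in> Cc_fns" unfolding e_def using K by (intro unit_cutoff_Cc \<eta>) auto
    then have "e \<in> isotropy_fns" by (rule unit_Cc_isotropy_fns[where e = e, OF _ e0])
    then have "e \<in> E" using E(3) by blast
    then have "conv G e f = conv G f e" using E(2) f by (simp add: abelian_def)
    then have "e (rng G a) * f a = f a * e (src G a)"
      using conv_units_left[of e f a, OF e0] conv_units_right[of e f a, OF e0] by metis
    then show ?thesis using ra sa by (simp add: e_def mem_units_iff)
  qed
  then show "E = isotropy_fns" using E(1,3) by (auto simp: isotropy_fns_def)
qed

text \<open>A tail, indexed by \<open>K\<close>, of the net of cut-offs on the unit space. Taking
  \<eta> on the whole groupoid lets \<open>ex_cutoff\<close> supply members directly.\<close>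

definition approx_units :: "'g set \<Rightarrow> ('g \<Rightarrow> complex) set" where
  "approx_units K = {e. \<exists>\<eta>::'g \<Rightarrow> real. (\<lambda>a. if a \<in> units G then complex_of_real (\<eta> a) else 0) = e \<and>
     continuous_on UNIV \<eta> \<and> (\<forall>a. 0 \<le> \<eta> a \<and> \<eta> a \<le> 1) \<and>
     (\<exists>L. compact L \<and> (\<forall>a. a \<notin> L \<longrightarrow> \<eta> a = 0)) \<and> (\<forall>a\<in>K. \<eta> a = 1)}"

lemma approx_units_props:
  assumes "e \<in> approx_units K"
  shows "e \<in> isotropy_fns" "positive cstar_alg e" "op_bound G e 1"
    "\<And>a. a \<notin> units G \<Longrightarrow> e a = 0" "\<And>a. a \<in> units G \<Longrightarrow> a \<in> K \<Longrightarrow> e a = 1"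
proof -
  obtain \<eta> :: "'g \<Rightarrow> real" and L where e: "e = (\<lambda>a. if a \<in> units G then complex_of_real (\<eta> a) else 0)"
    and \<eta>: "continuous_on UNIV \<eta>" "\<forall>a. 0 \<le> \<eta> a \<and> \<eta> a \<le> 1" "\<forall>a\<in>K. \<eta> a = 1"
    and L: "compact L" "\<forall>a. a \<notin> L \<longrightarrow> \<eta> a = 0"
    using assms unfolding approx_units_def by auto
  show e0: "\<And>a. a \<notin> units G \<Longrightarrow> e a = 0" "\<And>a. a \<in> units G \<Longrightarrow> a \<in> K \<Longrightarrow> e a = 1"
    using \<eta>(3) by (auto simp: e)
  have "e \<in> Cc_fns" unfolding e using L by (intro unit_cutoff_Cc \<eta>(1)) auto
  then show "e \<in> isotropy_fns" by (rule unit_Cc_isotropy_fns[OF _ e0(1)])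
  \<comment> \<open>The square root of the cut-off is real and carried by the units, so
    \<open>b\<close> is its own adjoint and witnesses positivity.\<close>
  define b where "b = (\<lambda>a. if a \<in> units G then complex_of_real (sqrt (\<eta> a)) else 0)"
  have "b \<in> Cc_fns" unfolding b_def
    using L by (intro unit_cutoff_Cc continuous_on_real_sqrt \<eta>(1)) auto
  moreover have "e = conv G (invol G b) b"
  proof
    fix c
    have ib: "invol G b d = 0" if "d \<notin> units G" for d
    proof -
      have "ginv G d \<notin> units G"
        using that by (metis ginv_ginv ginv_rng mem_units_iff)
      then show ?thesis by (simp add: invol_def b_def)
    qed
    have "conv G (invol G b) b c = invol G b (rng G c) * b c" by (rule conv_units_left[OF ib])
    also have "\<dots> = e c"
    proof (cases "c \<in> units G")
      case True
      then have "ginv G c = c" "rng G c = c" by (metis ginv_rng mem_units_iff)+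
      then show ?thesis using True \<eta>(2) by (simp add: invol_def b_def e flip: of_real_mult)
    qed (simp add: b_def e)
    finally show "e c = conv G (invol G b) b c" by simp
  qed
  ultimately show "positive cstar_alg e"
    unfolding positive_def using Cc_cstar_fns by auto
  \<comment> \<open>A fibre contains at most one unit, so Schur's test applies with the unit space
    as carrier and \<open>N = 1\<close>.\<close>
  have "op_bound G e (1 * real 1)"
  proof (rule op_bound_schur_test)
    show "cmod (e a) \<le> 1" for a using \<eta>(2) by (simp add: e)
    have "{a \<in> units G. rng G a = x} \<subseteq> {x}" "{a \<in> units G. src G a = x} \<subseteq> {x}" for x
      by (auto simp: mem_units_iff) (metis src_rng)
    then show "finite {a \<in> units G. rng G a = x} \<and> card {a \<in> units G. rng G a = x} \<le> 1"
      "finite {a \<in> units G. src G a = x} \<and> card {a \<in> units G. src G a = x} \<le> 1" for x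
      using card_mono[of "{x}"] finite_subset[of _ "{x}"] by fastforce+
  qed (use e0 in auto)
  then show "op_bound G e 1" by simp
qed

lemma approx_units_ex: "compact K \<Longrightarrow> approx_units K \<noteq> {}"
  using ex_cutoff[of K] unfolding approx_units_def by blast

text \<open>The tails form a filter base, since \<open>approx_units (K \<union> L)\<close> is
  contained in both \<open>approx_units K\<close> and \<open>approx_units L\<close>.\<close>

lemma contains_approximate_unit_isotropy_fns: "contains_approximate_unit cstar_alg isotropy_fns"
proof -
  define F where "F = (INF K\<in>{K. compact K}. principal (approx_units K))"
  have ev: "eventually P F \<longleftrightarrow> (\<exists>K\<in>{K. compact K}. eventually P (principal (approx_units K)))" for P
    unfolding F_def
  proof (rule eventually_INF_base)
    show "{K :: 'g set. compact K} \<noteq> {}" using compact_empty by blast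
    fix K L :: "'g set" assume "K \<in> {K. compact K}" "L \<in> {K. compact K}"
    then have "K \<union> L \<in> {K. compact K}" by (simp add: compact_Un)
    moreover have "approx_units (K \<union> L) \<subseteq> approx_units K \<inter> approx_units L"
      unfolding approx_units_def by auto
    ultimately show "\<exists>x\<in>{K. compact K}. principal (approx_units x) \<le> inf (principal (approx_units K)) (principal (approx_units L))"
      by (intro bexI[of _ "K \<union> L"]) auto
  qed
  have "F \<noteq> bot"
    unfolding trivial_limit_def ev eventually_principal using approx_units_ex by fastforce
  moreover have "\<forall>\<^sub>F e in F. e \<in> isotropy_fns \<and> positive cstar_alg e \<and> anorm cstar_alg e \<le> 1"
    unfolding ev eventually_principal
    by (intro bexI[of _ "{}"] ballI) (auto simp: approx_units_props opnorm_le)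
  moreover have "((\<lambda>e. adist cstar_alg (atimes cstar_alg e f) f) \<longlongrightarrow> 0) F \<and>
      ((\<lambda>e. adist cstar_alg (atimes cstar_alg f e) f) \<longlongrightarrow> 0) F" if f: "f \<in> acarrier cstar_alg" for f
  proof -
    have fM: "f \<in> op_bounded G" using f cstar_fns_bounded by simp
    have close: "\<exists>K. compact K \<and> (\<forall>e\<in>approx_units K. opnorm G (\<lambda>a. conv G e f a - f a) < \<epsilon> \<and> opnorm G (\<lambda>a. conv G f e a - f a) < \<epsilon>)"
      if \<epsilon>: "0 < \<epsilon>" for \<epsilon>
    proof -
      \<comment> \<open>\<open>f\<close> is replaced by a compactly supported \<open>g\<close>
        within \<epsilon>/2. An \<open>e\<close> equal to 1 at the ranges and sources of the support
        fixes \<open>g\<close> from both sides and, having norm at most 1, does not enlarge the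
        remaining error.\<close>
      have "f \<in> op_closure G Bc_fns" using f cstar_fns_carrier by auto
      from op_closure_near[OF this, of "\<epsilon>/2"] obtain g where g: "g \<in> Bc_fns" "opnorm G (\<lambda>a. g a - f a) < \<epsilon> / 2"
        using \<epsilon> by auto
      have gM: "g \<in> op_bounded G" using g(1) by (rule Bc_op_bounded)
      obtain K where K: "compact K" "\<forall>a. a \<notin> K \<longrightarrow> g a = 0"
        using g(1) unfolding bounded_compact_support_iff by blast
      have "compact (rng G ` K \<union> src G ` K)"
        using K(1) continuous_src continuous_rng
        by (meson compact_Un compact_continuous_image continuous_on_subset subset_UNIV)
      moreover have "opnorm G (\<lambda>a. conv G e f a - f a) < \<epsilon> \<and> opnorm G (\<lambda>a. conv G f e a - f a) < \<epsilon>"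
        if e: "e \<in> approx_units (rng G ` K \<union> src G ` K)" for e
      proof -
        note ep = approx_units_props[OF e]
        have eM: "e \<in> op_bounded G" using ep(3) by (rule op_boundedI)
        have e1: "e (rng G a) = 1" "e (src G a) = 1" if "a \<in> K" for a
          using that by (intro ep(5); auto simp: mem_units_iff)+
        have eg: "conv G e g = g" "conv G g e = g"
        proof -
          show "conv G e g = g"
          proof
            fix a show "conv G e g a = g a"
              using conv_units_left[of e g a, OF ep(4)] e1 K(2) by (cases "a \<in> K") auto
          qed
          show "conv G g e = g"
          proof
            fix a show "conv G g e a = g a"
              using conv_units_right[of e g a, OF ep(4)] e1 K(2) by (cases "a \<in> K") auto
          qed
        qed
        have n: "opnorm G e \<le> 1" using ep(3) by (rule opnorm_le)
        have fg: "opnorm G (\<lambda>a. f a - g a) = opnorm G (\<lambda>a. g a - f a)" by (rule opnorm_minus_commute[OF fM gM])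
        have nn: "0 \<le> opnorm G (\<lambda>a. f a - g a)" by (intro opnorm_nonneg op_bounded_diff fM gM)
        have "opnorm G (\<lambda>a. conv G e f a - f a) \<le> opnorm G (\<lambda>a. conv G e f a - conv G e g a) + opnorm G (\<lambda>a. g a - f a)"
          using opnorm_triangle[OF op_bounded_conv[OF eM fM] op_bounded_conv[OF eM gM] fM] by (simp add: eg)
        also have "opnorm G (\<lambda>a. conv G e f a - conv G e g a) \<le> opnorm G e * opnorm G (\<lambda>a. f a - g a)"
          unfolding conv_diff_right[OF fM gM eM, symmetric] by (intro opnorm_conv op_bounded_diff eM fM gM)
        also have "\<dots> \<le> 1 * opnorm G (\<lambda>a. f a - g a)" by (rule mult_right_mono[OF n nn])
        finally have 1: "opnorm G (\<lambda>a. conv G e f a - f a) < \<epsilon>" using g(2) fg by simp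
        have "opnorm G (\<lambda>a. conv G f e a - f a) \<le> opnorm G (\<lambda>a. conv G f e a - conv G g e a) + opnorm G (\<lambda>a. g a - f a)"
          using opnorm_triangle[OF op_bounded_conv[OF fM eM] op_bounded_conv[OF gM eM] fM] by (simp add: eg)
        also have "opnorm G (\<lambda>a. conv G f e a - conv G g e a) \<le> opnorm G (\<lambda>a. f a - g a) * opnorm G e"
          unfolding conv_diff_left[OF fM gM eM, symmetric] by (intro opnorm_conv op_bounded_diff eM fM gM)
        also have "\<dots> \<le> opnorm G (\<lambda>a. f a - g a) * 1" by (rule mult_left_mono[OF n nn])
        finally have 2: "opnorm G (\<lambda>a. conv G f e a - f a) < \<epsilon>" using g(2) fg by simp
        show ?thesis using 1 2 by simp
      qed
      ultimately show ?thesis by blast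
    qed
    have nn: "0 \<le> opnorm G (\<lambda>a. conv G e f a - f a)" "0 \<le> opnorm G (\<lambda>a. conv G f e a - f a)"
      if "e \<in> approx_units K" for e K
      using approx_units_props(3)[OF that] by (intro opnorm_nonneg op_bounded_diff op_bounded_conv fM; blast intro: op_boundedI)+
    show ?thesis
      unfolding tendsto_iff ev eventually_principal adist_cstar_alg cstar_alg_simps dist_real_def
    proof (intro conjI allI impI)
      fix \<epsilon> :: real assume "0 < \<epsilon>"
      from close[OF this] obtain K where K: "compact K"
        "\<forall>e\<in>approx_units K. opnorm G (\<lambda>a. conv G e f a - f a) < \<epsilon> \<and> opnorm G (\<lambda>a. conv G f e a - f a) < \<epsilon>" by blast
      show "\<exists>K\<in>{K. compact K}. \<forall>x\<in>approx_units K. \<bar>opnorm G (\<lambda>a. conv G x f a - f a) - 0\<bar> < \<epsilon>"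
        "\<exists>K\<in>{K. compact K}. \<forall>x\<in>approx_units K. \<bar>opnorm G (\<lambda>a. conv G f x a - f a) - 0\<bar> < \<epsilon>"
        using K nn by (auto intro!: bexI[of _ K])
    qed
  qed
  ultimately show ?thesis unfolding contains_approximate_unit_def by (intro exI[of _ F]) simp
qed

text \<open>A point where \<open>conv G (conv G (invol G f) d) f\<close> is nonzero has the form
  \<open>a q b\<close> with \<open>a^{-1}\<close> and \<open>b\<close> in \<open>U\<close> and
  \<open>q\<close> in the isotropy. Then \<open>a^{-1}\<close> and \<open>b\<close> have the same
  range, so they coincide and the point is \<open>b^{-1} q b\<close>, again isotropy. The other
  product is treated with sources in place of ranges.\<close>

lemma bisection_normalizer:
  assumes f: "f \<in> Cc_fns" and U: "bisection G U" "\<And>a. a \<notin> U \<Longrightarrow> f a = 0"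
  shows "f \<in> normalizers cstar_alg isotropy_fns"
proof -
  have inj: "a = b" if "a \<in> U" "b \<in> U" "rng G a = rng G b \<or> src G a = src G b" for a b
    using U(1) that by (auto simp: bisection_def inj_on_def)
  have fC: "f \<in> cstar_fns" using f by (rule Cc_cstar_fns)
  have "conv G (conv G (invol G f) d) f \<in> isotropy_fns" "conv G (conv G f d) (invol G f) \<in> isotropy_fns"
    if d: "d \<in> isotropy_fns" for d
  proof -
    have dC: "d \<in> cstar_fns" using d by (simp add: isotropy_fns_def)
    have "c \<in> isotropy G" if "conv G (conv G (invol G f) d) f c \<noteq> 0" for c
    proof -
      from that obtain p b where pb: "conv G (invol G f) d p \<noteq> 0" "f b \<noteq> 0" "src G p = rng G b" "c = gmul G p b"
        by (rule conv_nonzeroE)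
      from pb(1) obtain a q where aq: "invol G f a \<noteq> 0" "d q \<noteq> 0" "src G a = rng G q" "p = gmul G a q"
        by (rule conv_nonzeroE)
      have q: "rng G q = src G q" using aq(2) d by (auto simp: isotropy_fns_def isotropy_def)
      have "ginv G a \<in> U" "b \<in> U" using aq(1) pb(2) U(2) by (auto simp: invol_def)
      then have "ginv G a = b" using aq pb q by (intro inj) auto
      then have "rng G a = src G b" by auto
      then show ?thesis using aq pb by (simp add: isotropy_def)
    qed
    then show "conv G (conv G (invol G f) d) f \<in> isotropy_fns"
      unfolding isotropy_fns_def using cstar_fns_ops(4,5) fC dC by blast
    have "c \<in> isotropy G" if "conv G (conv G f d) (invol G f) c \<noteq> 0" for c
    proof -
      from that obtain p b where pb: "conv G f d p \<noteq> 0" "invol G f b \<noteq> 0" "src G p = rng G b" "c = gmul G p b"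
        by (rule conv_nonzeroE)
      from pb(1) obtain a q where aq: "f a \<noteq> 0" "d q \<noteq> 0" "src G a = rng G q" "p = gmul G a q"
        by (rule conv_nonzeroE)
      have q: "rng G q = src G q" using aq(2) d by (auto simp: isotropy_fns_def isotropy_def)
      have "a \<in> U" "ginv G b \<in> U" using aq(1) pb(2) U(2) by (auto simp: invol_def)
      then have "a = ginv G b" using aq pb q by (intro inj) auto
      then have "rng G a = src G b" by auto
      then show ?thesis using aq pb by (simp add: isotropy_def)
    qed
    then show "conv G (conv G f d) (invol G f) \<in> isotropy_fns"
      unfolding isotropy_fns_def using cstar_fns_ops(4,5) fC dC by blast
  qed
  then show ?thesis unfolding normalizers_def using fC by simp
qed

lemma regular_isotropy_fns: "regular cstar_alg isotropy_fns"
proof -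
  let ?C = "cstar_generated cstar_alg (normalizers cstar_alg isotropy_fns)"
  have "cstar_subalgebra cstar_alg ?C"
    by (rule cstar_generated_subalgebra)
      (auto simp: star_closed_cstar_alg star_closed_cstar_fns normalizers_def)
  then have C: "?C \<subseteq> cstar_fns" "cstar_subalgebra (reg_alg G) ?C"
    by (simp_all add: cstar_subalgebra_iff[of cstar_alg] cstar_subalgebra_cstar_alg)
  then have sc: "star_closed (reg_alg G) ?C" by (simp add: cstar_subalgebra_iff)
  have "f \<in> ?C" if f: "f \<in> Cc_fns" for f
  proof (rule Cc_decompose[OF _ _ _ f])
    show "(\<lambda>a. f a + g a) \<in> ?C" if "f \<in> ?C" "g \<in> ?C" for f g
      using star_closedD(2)[OF sc that] by simp
    show "(\<lambda>a. 0) \<in> ?C" using star_closedD(1)[OF sc] by simp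
    show "f \<in> ?C" if "f \<in> Cc_fns" "bisection G U" "\<And>a. a \<notin> U \<Longrightarrow> f a = 0" for f U
      by (rule subsetD[OF cstar_generated_superset bisection_normalizer[OF that]])
  qed
  then have "cstar_fns \<subseteq> ?C"
    unfolding cstar_fns_def[symmetric]
    by (subst cstar_fns_def) (intro cstar_generated_least C(2), blast)
  then show ?thesis unfolding regular_def using C(1) by simp
qed

text \<open>Off the units, membership is tested in the algebra and not in the topology. The test
  passes to products and inverses through convolution and involution of point functions, which makes
  the set a subgroupoid.\<close>

definition expectation_support :: "'g set" where
  "expectation_support = {a \<in> isotropy G. a \<in> units G \<or> point_fn a \<in> cstar_fns}"

section \<open>The conditional expectation\<close>

lemma wide_subgroupoid_expectation_support: "wide_subgroupoid G expectation_support"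
  unfolding wide_subgroupoid_def
proof (intro conjI ballI impI)
  show "units G \<subseteq> expectation_support" using units_isotropy by (auto simp: expectation_support_def)
  fix a assume a: "a \<in> expectation_support"
  then show "ginv G a \<in> expectation_support"
    unfolding expectation_support_def using isotropy_ginv cstar_fns_ops(5)[of "point_fn a"]
    by (auto simp: invol_point) (metis ginv_rng mem_units_iff)
  fix b assume b: "b \<in> expectation_support" and ab: "src G a = rng G b"
  have "gmul G a b \<in> isotropy G" using a b ab by (auto simp: expectation_support_def isotropy_gmul)
  moreover have "gmul G a b = b" if "a \<in> units G"
    using that ab by (metis gmul_rng mem_units_iff rng_src src_rng)
  moreover have "gmul G a b = a" if "b \<in> units G"
    using that ab by (metis gmul_src mem_units_iff)
  moreover have "point_fn (gmul G a b) \<in> cstar_fns" if "point_fn a \<in> cstar_fns" "point_fn b \<in> cstar_fns"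
    using cstar_fns_ops(4)[OF that] by (simp add: conv_point[OF ab])
  ultimately show "gmul G a b \<in> expectation_support"
    using a b unfolding expectation_support_def by auto
qed

lemma isolated_point_fn:
  assumes disc: "discrete_isotropy G" and f: "f \<in> isotropy_fns" and fc: "f c \<noteq> 0" "c \<notin> units G"
  shows "point_fn c \<in> cstar_fns"
proof -
  have c: "c \<in> isotropy G" using f fc(1) by (auto simp: isotropy_fns_def)
  then have "c isolated_in (isotropy G - units G)"
    using disc fc(2) by (simp add: discrete_isotropy_def discrete_def)
  then obtain T where T: "open T" "T \<inter> (isotropy G - units G) = {c}"
    unfolding isolated_in_def by blast
  \<comment> \<open>The units are closed, so removing them leaves a neighbourhood of
    \<open>c\<close> in which \<open>c\<close> is the only isotropy element. A bump there times
    \<open>f\<close> is \<open>f c\<close> times the point function.\<close>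
  have "open (T - units G)" "c \<in> T - units G" using T closed_units fc(2) by (auto simp: open_Diff)
  from ex_bump[OF this] obtain \<eta> :: "'g \<Rightarrow> real" and K V where \<eta>: "continuous_on UNIV \<eta>"
    and K: "compact K" "\<forall>b. b \<notin> K \<longrightarrow> \<eta> b = 0" and z: "\<forall>b. b \<notin> T - units G \<longrightarrow> \<eta> b = 0"
    and "c \<in> V" "\<forall>b\<in>V. \<eta> b = 1"
    by (elim exE conjE) (rule that)
  then have "\<eta> c = 1" by auto
  have "(\<lambda>a. complex_of_real (\<eta> a)) \<in> Cc_fns" using K by (intro real_Cc[OF \<eta> K(1)]) auto
  then have "(\<lambda>a. complex_of_real (\<eta> a) * f a) \<in> cstar_fns"
    using isotropy_fnsD(1)[OF f] by (rule mult_cstar_fns)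
  from cstar_fns_ops(3)[OF this, of "1 / f c"]
  have "(\<lambda>a. 1 / f c * (complex_of_real (\<eta> a) * f a)) \<in> cstar_fns" .
  also have "(\<lambda>a. 1 / f c * (complex_of_real (\<eta> a) * f a)) = point_fn c"
  proof
    fix a
    show "1 / f c * (complex_of_real (\<eta> a) * f a) = point_fn c a"
    proof (cases "a = c")
      case True
      then show ?thesis using fc(1) \<open>\<eta> c = 1\<close> by (simp add: point_fn_def)
    next
      case False
      then have "a \<notin> T - units G \<or> a \<notin> isotropy G" using T(2) by blast
      then have "\<eta> a = 0 \<or> f a = 0" using z isotropy_fnsD(2)[OF f] by blast
      then show ?thesis using False by (auto simp: point_fn_def)
    qed
  qed
  finally show ?thesis .
qed

lemma cut_isotropy_fns:
  assumes disc: "discrete_isotropy G" and f: "f \<in> isotropy_fns"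
  shows "cut expectation_support f = f"
proof
  fix a
  have "f a = 0" if "a \<notin> expectation_support"
    using that isolated_point_fn[OF disc f, of a] isotropy_fnsD(2)[OF f, of a]
    by (auto simp: expectation_support_def)
  then show "cut expectation_support f a = f a" by (simp add: cut_def)
qed

lemma cut_Bc_cstar_fns:
  assumes disc: "discrete_isotropy G" and f: "f \<in> Bc_fns" "f \<in> cstar_fns"
  shows "cut expectation_support f \<in> cstar_fns"
proof -
  obtain K where K: "compact K" "\<forall>a. a \<notin> K \<longrightarrow> f a = 0"
    using f(1) unfolding bounded_compact_support_iff by blast
  define \<Phi> where "\<Phi> = K \<inter> expectation_support - units G"
  \<comment> \<open>The units are open, so the isotropy off the units is closed and its part in
    \<open>K\<close> is compact; being discrete, it is finite.\<close>
  have "compact (K \<inter> (isotropy G - units G))"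
    by (intro compact_Int_closed K(1) closed_Diff closed_isotropy open_units)
  moreover have "discrete (K \<inter> (isotropy G - units G))"
    using disc unfolding discrete_isotropy_def by (rule discrete_subset) auto
  ultimately have "finite (K \<inter> (isotropy G - units G))" by (rule discrete_compact_imp_finite)
  then have fin: "finite \<Phi>" by (rule rev_finite_subset) (auto simp: \<Phi>_def expectation_support_def)
  obtain \<eta> L where \<eta>: "continuous_on UNIV \<eta>" "\<forall>b\<in>K. \<eta> b = (1::real)"
    and L: "compact L" "\<forall>b. b \<notin> L \<longrightarrow> \<eta> b = 0"
    using ex_cutoff[OF K(1)] by blast
  \<comment> \<open>The cut-off is 1 on \<open>K\<close>, so pointwise multiplication by
    \<open>e\<close> restricts \<open>f\<close> to the units.\<close>
  define e where "e b = (if b \<in> units G then complex_of_real (\<eta> b) else 0)" for b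
  have "e \<in> Cc_fns" unfolding e_def using L by (intro unit_cutoff_Cc \<eta>(1)) auto
  then have 1: "(\<lambda>a. e a * f a) \<in> cstar_fns" using f(2) by (rule mult_cstar_fns)
  have 2: "(\<lambda>a. \<Sum>c\<in>\<Phi>. f c * point_fn c a) \<in> cstar_fns"
  proof -
    have "(\<lambda>a. \<Sum>c\<in>J. f c * point_fn c a) \<in> cstar_fns" if "finite J" "J \<subseteq> \<Phi>" for J
      using that
    proof (induction J rule: finite_induct)
      case empty
      then show ?case using cstar_fns_ops(1) by simp
    next
      case (insert c J)
      then have "point_fn c \<in> cstar_fns" by (auto simp: \<Phi>_def expectation_support_def)
      then have "(\<lambda>a. f c * point_fn c a + (\<Sum>c\<in>J. f c * point_fn c a)) \<in> cstar_fns"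
        using insert by (intro cstar_fns_ops(2) cstar_fns_ops(3)) auto
      then show ?case using insert.hyps by simp
    qed
    then show ?thesis using fin by blast
  qed
  have "cut expectation_support f = (\<lambda>a. e a * f a + (\<Sum>c\<in>\<Phi>. f c * point_fn c a))"
  proof
    fix a
    have s: "(\<Sum>c\<in>\<Phi>. f c * point_fn c a) = (if a \<in> \<Phi> then f a else 0)"
      using fin by (simp add: point_fn_def if_distrib cong: if_cong)
    have "a \<in> units G \<Longrightarrow> a \<in> expectation_support"
      using units_isotropy by (auto simp: expectation_support_def)
    then show "cut expectation_support f a = e a * f a + (\<Sum>c\<in>\<Phi>. f c * point_fn c a)"
      unfolding s using K(2) \<eta>(2) by (cases "a \<in> K"; cases "a \<in> units G") (auto simp: cut_def e_def \<Phi>_def)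
  qed
  then show ?thesis using cstar_fns_ops(2)[OF 1 2] by simp
qed

lemma cut_cstar_fns:
  assumes disc: "discrete_isotropy G" and f: "f \<in> cstar_fns"
  shows "cut expectation_support f \<in> isotropy_fns"
proof -
  \<comment> \<open>The approximants must have compact support and belong to
    \<open>cstar_fns\<close>; membership in \<open>left_multipliers\<close> supplies both.\<close>
  obtain X where X: "\<And>n. X n \<in> left_multipliers" "oplim G X f"
    using f cstar_fns_subset_closure by (auto simp: op_closure_def)
  have "cut expectation_support (X n) \<in> cstar_fns" for n
    using X(1)[of n] by (intro cut_Bc_cstar_fns disc) (auto simp: left_multipliers_def)
  then have "cut expectation_support f \<in> cstar_fns"
    by (rule cstar_fns_oplim[OF _ oplim_cut[OF wide_subgroupoid_expectation_support X(2)]])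
  then show ?thesis by (auto simp: isotropy_fns_def cut_def expectation_support_def)
qed

text \<open>Compression keeps the kernel positive semidefinite, and after normalisation
  \<open>op_sqrt\<close> converts this into a factorisation whose factor lies in
  \<open>cstar_fns\<close>.\<close>

lemma positive_cut:
  assumes disc: "discrete_isotropy G" and p: "positive cstar_alg f"
  shows "positive cstar_alg (cut expectation_support f)"
proof -
  note H = wide_subgroupoid_expectation_support
  obtain b where b: "b \<in> cstar_fns" and f: "f = conv G (invol G b) b"
    using p by (auto simp: positive_def)
  have bM: "b \<in> op_bounded G" using b by (rule cstar_fns_bounded)
  have fC: "f \<in> cstar_fns" unfolding f by (intro cstar_fns_ops b)
  let ?p = "cut expectation_support f"
  have pD: "?p \<in> isotropy_fns" by (rule cut_cstar_fns[OF disc fC])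
  then have pM: "?p \<in> op_bounded G" by (intro cstar_fns_bounded isotropy_fnsD)
  \<comment> \<open>Adding 1 keeps \<open>s\<close> positive when the compression is 0, while
    dividing by it still brings the norm down to at most 1.\<close>
  define s where "s = opnorm G ?p + 1"
  have s: "0 < s" using opnorm_nonneg[OF pM] by (simp add: s_def)
  define q where "q a = complex_of_real (1 / s) * ?p a" for a
  have qD: "q \<in> isotropy_fns" unfolding q_def using pD by (rule isotropy_fns_ops(3))
  then have qM: "q \<in> op_bounded G" by (intro cstar_fns_bounded isotropy_fnsD)
  have "pos_semidef G q"
    unfolding q_def using s
    by (intro pos_semidef_scale pos_semidef_cut[OF H]) (simp_all add: f pos_semidef_star_mult bM)
  moreover have "invol G q = q"
  proof -
    have "invol G f = f" unfolding f invol_conv by simp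
    then have "invol G ?p = ?p" by (simp add: cut_invol[OF H, symmetric])
    then show ?thesis unfolding q_def invol_scale by simp
  qed
  moreover have "opnorm G q \<le> 1"
  proof -
    have "opnorm G q \<le> cmod (complex_of_real (1 / s)) * opnorm G ?p"
      unfolding q_def by (rule opnorm_scale_le[OF pM])
    also have "\<dots> \<le> 1" using s by (simp add: norm_divide s_def)
    finally show ?thesis .
  qed
  ultimately obtain r where r: "r \<in> op_bounded G" "invol G r = r" "conv G r r = q"
    "(\<lambda>n. opnorm G (\<lambda>c. sqrt_step q n c - r c)) \<longlonglongrightarrow> 0"
    by (rule op_sqrt[OF qM])
  \<comment> \<open>The iterates involve no multiple of the identity, so they stay among the
    isotropy functions, and norm closedness retains their limit in \<open>cstar_fns\<close>.\<close>
  have step: "sqrt_step q n \<in> isotropy_fns" for n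
  proof (induction n)
    case 0
    then show ?case using isotropy_fns_ops(1) by simp
  next
    case (Suc n)
    then show ?case
      unfolding sqrt_step.simps
      by (intro isotropy_fns_ops(2) isotropy_fns_ops(3) isotropy_fns_ops(4) qD)
  qed
  have "oplim G (sqrt_step q) r"
    unfolding oplim_def using r cstar_fns_bounded[OF isotropy_fnsD(1)[OF step]] by simp
  then have rC: "r \<in> cstar_fns" by (rule cstar_fns_oplim[OF isotropy_fnsD(1)[OF step]])
  define t where "t a = complex_of_real (sqrt s) * r a" for a
  have "t \<in> cstar_fns" unfolding t_def using rC by (rule cstar_fns_ops(3))
  moreover have "?p = conv G (invol G t) t"
  proof
    fix c
    have ss: "complex_of_real (sqrt s) * complex_of_real (sqrt s) = complex_of_real s"
      using s by (simp flip: of_real_mult)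
    have "conv G (invol G t) t c = complex_of_real (sqrt s) * (complex_of_real (sqrt s) * q c)"
      unfolding t_def invol_scale conv_scale_left conv_scale_right by (simp add: r)
    also have "\<dots> = complex_of_real s * q c" unfolding mult.assoc[symmetric] ss ..
    also have "\<dots> = ?p c" using s by (simp add: q_def)
    finally show "?p c = conv G (invol G t) t c" by simp
  qed
  ultimately show ?thesis unfolding positive_def by auto
qed

lemma conditional_expectation_cut:
  assumes disc: "discrete_isotropy G"
  shows "conditional_expectation cstar_alg isotropy_fns (cut expectation_support)"
proof -
  note H = wide_subgroupoid_expectation_support
  have d0: "d a = 0" if "d \<in> isotropy_fns" "a \<notin> expectation_support" for d a
    using fun_cong[OF cut_isotropy_fns[OF disc that(1)], of a] that(2) by (simp add: cut_def)
  have cut_add: "cut expectation_support (\<lambda>a. f a + g a) = (\<lambda>a. cut expectation_support f a + cut expectation_support g a)"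
    and cut_scale: "cut expectation_support (\<lambda>a. z * f a) = (\<lambda>a. z * cut expectation_support f a)" for f g z
    by (simp_all add: cut_def fun_eq_iff)
  show ?thesis
    unfolding conditional_expectation_def cstar_alg_simps
  proof (intro conjI ballI allI impI)
    fix f d assume "d \<in> isotropy_fns"
    then show "cut expectation_support (conv G d f) = conv G d (cut expectation_support f)"
      "cut expectation_support (conv G f d) = conv G (cut expectation_support f) d"
      using d0 by (auto intro!: cut_conv_left[OF H] cut_conv_right[OF H])
  qed (auto simp: cut_cstar_fns[OF disc] cut_isotropy_fns[OF disc] positive_cut[OF disc] opnorm_cut[OF H]
      cstar_fns_bounded cut_add cut_scale)
qed

lemma faithful_cut: "faithful cstar_alg (cut expectation_support)"
  unfolding faithful_def cstar_alg_simps
proof (intro ballI impI ext)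
  fix f d assume f: "f \<in> cstar_fns" and z: "cut expectation_support (conv G (invol G f) f) = (\<lambda>a. 0)"
  have "src G d \<in> expectation_support" using units_isotropy by (auto simp: expectation_support_def units_def)
  then have "conv G (invol G f) f (src G d) = 0" using fun_cong[OF z, of "src G d"] by (simp add: cut_def)
  then show "f d = 0" by (rule star_mult_unit_zero[OF cstar_fns_bounded[OF f]])
qed

lemma cartan_subalgebra_isotropy:
  assumes "abelian_isotropy G" "discrete_isotropy G"
  shows "cartan_subalgebra (Cr G) (isotropy_subalgebra G)"
proof (rule cartan_transfer)
  have "cartan_subalgebra cstar_alg isotropy_fns"
    unfolding cartan_subalgebra_def
    using contains_approximate_unit_isotropy_fns maximal_abelian_isotropy_fns[OF assms(1)]
      regular_isotropy_fns conditional_expectation_cut[OF assms(2)] faithful_cut by blast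
  then show "cartan_subalgebra (reg_alg G\<lparr>acarrier := cstar_fns\<rparr>) isotropy_fns"
    by (simp add: cstar_alg_def)
qed

end

theorem theorem2p23:
  fixes G :: "'g::t2_space groupoid"
  assumes "semi_etale_groupoid G"
    and "abelian_isotropy G"
    and "discrete_isotropy G"
  shows "cartan_subalgebra (Cr G) (isotropy_subalgebra G)"
  using assms semi_etale_groupoid.cartan_subalgebra_isotropy by blast

end
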